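(* Fix $\alpha,\beta>0$ and let $\omega$ be an i.i.d. Beta$(\alpha,\beta)$ environment on $\mathbb Z^2$. Let $I_q$ and $I_a$ be the quenched and averaged large deviation rate functions and $\lambda(\xi)$ the parameter defined in the context. Then $I_q(\xi^* )=0$ and for $\xi=(\xi_1,\xi_2)\in\mathcal U$, $$I_q(\xi)=\begin{cases}\xi_1\psi_0(\alpha+\beta+\lambda(\xi))+\xi_2\psi_0(\lambda(\xi))-\psi_0(\alpha+\lambda(\xi)) &\text{for }\xi_1\in(\xi^*_1,1],\\[3pt]\xi_2\psi_0(\alpha+\beta+\lambda(\xi))+\xi_1\psi_0(\lambda(\xi))-\psi_0(\beta+\lambda(\xi))&\text{for }\xi_1\in[0,\xi_1^* ).\end{cases}$$ Moreover, $I_q$, viewed as a function of $\xi_1\in[0,1]$, is strictly convex on $[0,1]$, and $I_q(\xi)>I_a(\xi)$ for all $\xi\in\mathcal U\setminus\{\xi^*\}$.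
   Context: Let $e_1=(1,0)$, $e_2=(0,1)$. Fix $\alpha,\beta>0$. Under $\mathbb P$, $\omega_{x,x+e_1}$, $x\in\mathbb Z^2$, are i.i.d. Beta$(\alpha,\beta)$, and $\omega_{x,x+e_2}=1-\omega_{x,x+e_1}$. $P^\omega_x$ is the law of the Markov chain $(X_n)_{n\ge0}$ on $\mathbb Z^2$ with $X_0=x$ and $P^\omega_x(X_{n+1}=y+e_i\mid X_n=y)=\omega_{y,y+e_i}$. Let $\mathcal U=\{te_1+(1-t)e_2:0\le t\le1\}$, $\xi=(\xi_1,\xi_2)$ with $\xi_2=1-\xi_1$, and $\xi^*=(\frac{\alpha}{\alpha+\beta},\frac{\beta}{\alpha+\beta})$. For $\xi\in\mathcal U$, $[N\xi]$ is a point of $\{(x_1,x_2)\in\mathbb Z^2:x_1+x_2=N\}$ closest to $N\xi$. Quenched rate function: $I_q(\xi)=-\lim_{N\to\infty}N^{-1}\log P_0^\omega\{X_N=[N\xi]\}$; it is a known fact that this limit exists $\mathbb P$-a.s. for every $\xi\in\mathcal U$, is deterministic, and $I_q$ is a nonnegative convex continuous function on $\mathcal U$. Averaged rate function: $I_a(\xi)=\xi_1\log\frac{\xi_1}{\xi_1^*}+\xi_2\log\frac{\xi_2}{\xi_2^*}$ (with $0\log 0=0$). Polygamma functions: $\psi_0(s)=\Gamma'(s)/\Gamma(s)$, $\psi_1=\psi_0'$ on $(0,\infty)$. For $\xi\in\mathcal U$, $\lambda=\lambda(\xi)\in[0,\infty]$ is the unique solution of $$\xi_1=\frac{\psi_1(\lambda)-\psi_1(\alpha+\lambda)}{\psi_1(\lambda)-\psi_1(\alpha+\beta+\lambda)}\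 \text{ if }\xi_1\in[\xi_1^*,1],\qquad \xi_1=1-\frac{\psi_1(\lambda)-\psi_1(\beta+\lambda)}{\psi_1(\lambda)-\psi_1(\alpha+\beta+\lambda)}\ \text{ if }\xi_1\in[0,\xi_1^*],$$ where the right-hand sides at $\lambda=0$ and $\lambda=\infty$ are understood as limits; $\lambda=0$ iff $\xi\in\{e_1,e_2\}$ and $\lambda=\infty$ iff $\xi=\xi^*$. At $\xi\in\{e_1,e_2\}$ (where $\lambda=0$), the term $0\cdot\psi_0(0)$ is interpreted as its limit value $0$. *)

theory Defs
  imports "HOL-Probability.Probability"
begin

type_synonym site = "int \<times> int"

definition e1 :: site where "e1 = (1, 0)"
definition e2 :: site where "e2 = (0, 1)"

section \<open>The random environment\<close>

definition beta_density :: "real \<Rightarrow> real \<Rightarrow> real \<Rightarrow> real" where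
  "beta_density \<alpha> \<beta> t =
     indicator {0<..<1} t * (t powr (\<alpha> - 1) * (1 - t) powr (\<beta> - 1) / Beta \<alpha> \<beta>)"

text \<open>
  An environment is the function \<open>w\<close> with \<open>w x\<close> the weight of the edge from \<open>x\<close> to \<open>x + e1\<close>;
  the edge from \<open>x\<close> to \<open>x + e2\<close> has weight \<open>1 - w x\<close>.
  In a random environment \<open>\<omega>\<close>, the weight at \<open>x\<close> is the random variable \<open>\<omega> x\<close>.
\<close>

definition beta_environment :: "real \<Rightarrow> real \<Rightarrow> 's measure \<Rightarrow> (site \<Rightarrow> 's \<Rightarrow> real) \<Rightarrow> bool" where
  "beta_environment \<alpha> \<beta> M \<omega> \<longleftrightarrow>
     prob_space M \<and>
     prob_space.indep_vars M (\<lambda>_. borel) \<omega> UNIV \<and>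
     (\<forall>x. distributed M lborel (\<omega> x) (\<lambda>t. ennreal (beta_density \<alpha> \<beta> t)))"

section \<open>The quenched walk\<close>

text \<open>
  \<^const>\<open>bernoulli_pmf\<close> truncates its parameter to the unit interval, so \<open>step w y\<close> has the
  intended meaning when \<open>w y\<close> is in \<open>[0,1]\<close>, which holds almost surely for all \<open>y\<close> in a Beta
  environment.
\<close>

definition step :: "(site \<Rightarrow> real) \<Rightarrow> site \<Rightarrow> site pmf" where
  "step w y = map_pmf (\<lambda>b. if b then y + e1 else y + e2) (bernoulli_pmf (w y))"

text \<open>The law of \<open>X\<^sub>n\<close> given the past \<open>(X\<^sub>0, \<dots>, X\<^sub>n\<^sub>-\<^sub>1)\<close>.\<close>

definition walk_kernel ::
    "(site \<Rightarrow> real) \<Rightarrow> site \<Rightarrow> nat \<Rightarrow> (nat \<Rightarrow> site) \<Rightarrow> site measure" where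
  "walk_kernel w x n h =
     (case n of 0 \<Rightarrow> measure_pmf (return_pmf x) | Suc m \<Rightarrow> measure_pmf (step w (h m)))"

lemma walk_kernel_measurable:
  "walk_kernel w x n \<in>
     measurable (PiM {0..<n} (\<lambda>_. count_space UNIV)) (subprob_algebra (count_space UNIV))"
proof (cases n)
  case 0
  then show ?thesis
    by (auto simp: walk_kernel_def[abs_def] measure_pmf_in_subprob_algebra)
next
  case (Suc m)
  have "(\<lambda>h. h m) \<in> measurable (PiM {0..<n} (\<lambda>_. count_space (UNIV :: site set))) (count_space UNIV)"
    using Suc by (intro measurable_component_singleton) auto
  moreover have "(\<lambda>y. measure_pmf (step w y)) \<in>
      measurable (count_space UNIV) (subprob_algebra (count_space UNIV))"
    by (auto simp: measure_pmf_in_subprob_algebra)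
  ultimately show ?thesis
    using Suc by (simp add: walk_kernel_def[abs_def] measurable_compose)
qed

lemma prob_space_walk_kernel: "prob_space (walk_kernel w x n h)"
  by (cases n) (auto simp: walk_kernel_def intro: measure_pmf.prob_space_axioms)

interpretation walk: Ionescu_Tulcea "walk_kernel w x" "\<lambda>_. count_space UNIV" for w x
  by (rule Ionescu_Tulcea.intro) (rule walk_kernel_measurable prob_space_walk_kernel)+

text \<open>The path measure \<open>P\<^sub>x\<^sup>w\<close> on the product space of all trajectories.\<close>

definition quenched_law :: "(site \<Rightarrow> real) \<Rightarrow> site \<Rightarrow> (nat \<Rightarrow> site) measure" where
  "quenched_law w x = walk.PF.lim w x"

lemma space_quenched_law [simp]: "space (quenched_law w x) = UNIV"
  by (simp add: quenched_law_def space_PiM)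

lemma sets_quenched_law [simp, measurable_cong]:
  "sets (quenched_law w x) = sets (PiM UNIV (\<lambda>_. count_space UNIV))"
  by (simp add: quenched_law_def)

lemma singleton_sets_PiM:
  "{restrict p {0..<n}} \<in> sets (PiM {0..<n} (\<lambda>_. count_space (UNIV :: site set)))" for p :: "nat \<Rightarrow> site"
proof -
  have "{restrict p {0..<n}} = PiE {0..<n} (\<lambda>i. {restrict p {0..<n} i})"
    by (rule PiE_singleton[symmetric]) (rule restrict_extensional)
  also have "\<dots> \<in> sets (PiM {0..<n} (\<lambda>_. count_space (UNIV :: site set)))"
    by (intro sets_PiM_I_finite) auto
  finally show ?thesis .
qed

lemma quenched_law_cylinder:
  "emeasure (quenched_law w x) {X. \<forall>i<n. X i = p i} =
   emeasure (walk.C w x 0 n (\<lambda>_. undefined)) {restrict p {0..<n}}"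
proof -
  have eq: "{X. \<forall>i<n. X i = p i} =
      prod_emb UNIV (\<lambda>_. count_space UNIV) {0..<n} {restrict p {0..<n}}"
  proof (rule set_eqI)
    fix X
    have "restrict X {0..<n} = restrict p {0..<n} \<longleftrightarrow> (\<forall>i<n. X i = p i)"
      by (simp add: fun_eq_iff restrict_def)
    then show "X \<in> {X. \<forall>i<n. X i = p i} \<longleftrightarrow>
        X \<in> prod_emb UNIV (\<lambda>_. count_space UNIV) {0..<n} {restrict p {0..<n}}"
      by (simp add: prod_emb_def space_PiM del: restrict_apply)
  qed
  have "prod_emb {0..<n} (\<lambda>_. count_space UNIV) {0..<n} {restrict p {0..<n}} = {restrict p {0..<n}}"
    using sets.sets_into_space[OF singleton_sets_PiM[of p n]]
    by (intro prod_emb_id) (auto simp: space_PiM)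
  then show ?thesis
    unfolding eq quenched_law_def
    using walk.lim[of "{0..<n}" "{restrict p {0..<n}}" w x]
      walk.emeasure_CI[of "{0..<n}" n "{restrict p {0..<n}}" w x] singleton_sets_PiM[of p n]
    by simp
qed

lemma quenched_law_cylinder_Suc:
  "emeasure (quenched_law w x) {X. \<forall>i<Suc n. X i = p i} =
   emeasure (quenched_law w x) {X. \<forall>i<n. X i = p i} * emeasure (walk_kernel w x n p) {p n}"
proof -
  let ?u = "\<lambda>_. undefined" and ?C = "walk.C w x 0"
  let ?M = "\<lambda>_::nat. count_space (UNIV :: site set)"
  have u: "?u \<in> space (PiM {0..<0} ?M)" by simp
  have "emeasure (?C (Suc n) ?u) {restrict p {0..<Suc n}} =
     (\<integral>\<^sup>+h. emeasure (walk.eP w x n h) {restrict p {0..<Suc n}} \<partial>?C n ?u)"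
    using walk.space_C[OF u, of w x n] walk.sets_C[OF u, of w x n] walk.measurable_eP[of w x n]
    by (simp del: walk.eP_def, subst emeasure_bind[where N = "PiM {0..<Suc n} ?M"])
      (auto simp: singleton_sets_PiM measurable_cong_sets[OF walk.sets_C[OF u, of w x n] refl]
        space_PiM)
  also have "\<dots> = (\<integral>\<^sup>+h. emeasure (walk_kernel w x n p) {p n} * indicator {restrict p {0..<n}} h \<partial>?C n ?u)"
  proof (rule nn_integral_cong)
    fix h assume "h \<in> space (?C n ?u)"
    then have h: "h \<in> space (PiM {0..<n} ?M)" using walk.space_C[OF u, of w x n] by simp
    then have ext: "h \<in> extensional {0..<n}" by (auto simp: space_PiM PiE_def)
    have eq: "fun_upd h n y = restrict p {0..<Suc n} \<longleftrightarrow> h = restrict p {0..<n} \<and> y = p n" for y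
    proof
      assume *: "fun_upd h n y = restrict p {0..<Suc n}"
      have "y = p n" using fun_cong[OF *, of n] by simp
      moreover have "h = restrict p {0..<n}"
      proof
        fix i show "h i = restrict p {0..<n} i"
          using fun_cong[OF *, of i] ext by (cases "i < n") (auto simp: extensional_def)
      qed
      ultimately show "h = restrict p {0..<n} \<and> y = p n" by simp
    qed (auto simp: fun_eq_iff)
    have ker: "walk_kernel w x n (restrict p {0..<n}) = walk_kernel w x n p"
      by (auto simp: walk_kernel_def split: nat.split)
    have "emeasure (walk.eP w x n h) {restrict p {0..<Suc n}} =
        emeasure (walk_kernel w x n h) ((\<lambda>y. fun_upd h n y) -` {restrict p {0..<Suc n}} \<inter> UNIV)"
      using walk.emeasure_eP[OF h singleton_sets_PiM[of p "Suc n"], of w x] by simp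
    also have "(\<lambda>y. fun_upd h n y) -` {restrict p {0..<Suc n}} \<inter> UNIV =
        (if h = restrict p {0..<n} then {p n} else {})"
      using eq by auto
    finally show "emeasure (walk.eP w x n h) {restrict p {0..<Suc n}} =
        emeasure (walk_kernel w x n p) {p n} * indicator {restrict p {0..<n}} h"
      by (cases "h = restrict p {0..<n}") (simp_all add: ker del: restrict_apply)
  qed
  also have "\<dots> = emeasure (walk_kernel w x n p) {p n} * emeasure (?C n ?u) {restrict p {0..<n}}"
    using singleton_sets_PiM[of p n] walk.sets_C[OF u, of w x n]
    by (simp add: nn_integral_cmult_indicator)
  finally show ?thesis
    by (simp only: quenched_law_cylinder mult.commute)
qed

lemma prob_space_quenched_law: "prob_space (quenched_law w x)"
proof (rule prob_spaceI)
  have "emeasure (quenched_law w x) (space (quenched_law w x)) =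
      emeasure (walk.C w x 0 0 (\<lambda>_. undefined)) {restrict undefined {0..<0}}"
    using quenched_law_cylinder[of w x 0 undefined] by simp
  also have "\<dots> = 1"
    using singleton_sets_PiM[of undefined 0] by (simp add: restrict_def)
  finally show "emeasure (quenched_law w x) (space (quenched_law w x)) = 1" .
qed

text \<open>The two facts that characterise the law of the Markov chain.\<close>

lemma quenched_law_start: "measure (quenched_law w x) {X. X 0 = x} = 1"
  using quenched_law_cylinder_Suc[of w x 0 "\<lambda>_. x"]
    prob_space.emeasure_space_1[OF prob_space_quenched_law[of w x]]
  by (simp add: walk_kernel_def emeasure_pmf_single measure_def)

lemma quenched_law_step:
  "measure (quenched_law w x) {X. \<forall>i<Suc (Suc n). X i = p i} =
   measure (quenched_law w x) {X. \<forall>i<Suc n. X i = p i} * pmf (step w (p n)) (p (Suc n))"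
  using quenched_law_cylinder_Suc[of w x "Suc n" p]
  by (simp add: walk_kernel_def emeasure_pmf_single measure_def enn2real_mult)

lemma pmf_step:
  assumes "0 \<le> w y" "w y \<le> 1"
  shows "pmf (step w y) (y + e1) = w y" "pmf (step w y) (y + e2) = 1 - w y"
proof -
  let ?f = "\<lambda>b. if b then y + e1 else y + e2"
  have "inj ?f" by (auto simp: inj_on_def e1_def e2_def prod_eq_iff)
  then show "pmf (step w y) (y + e1) = w y" "pmf (step w y) (y + e2) = 1 - w y"
    using pmf_map_inj'[of ?f "bernoulli_pmf (w y)" True]
      pmf_map_inj'[of ?f "bernoulli_pmf (w y)" False] assms
    by (simp_all add: step_def)
qed

section \<open>Rate functions\<close>

definition dirs :: "(real \<times> real) set" where
  "dirs = {t *\<^sub>R (1, 0) + (1 - t) *\<^sub>R (0, 1) | t. 0 \<le> t \<and> t \<le> 1}"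

definition xi_star :: "real \<Rightarrow> real \<Rightarrow> real \<times> real" where
  "xi_star \<alpha> \<beta> = (\<alpha> / (\<alpha> + \<beta>), \<beta> / (\<alpha> + \<beta>))"

text \<open>
  \<open>z\<close> is an admissible choice of \<open>[N\<xi>]\<close>; the norm on pairs of reals is the Euclidean one.
\<close>

definition nearest_site :: "nat \<Rightarrow> real \<times> real \<Rightarrow> site \<Rightarrow> bool" where
  "nearest_site N \<xi> z \<longleftrightarrow>
     is_arg_min (\<lambda>x. dist (real_of_int (fst x), real_of_int (snd x)) (real N *\<^sub>R \<xi>))
       (\<lambda>x. fst x + snd x = int N) z"

text \<open>
  \<open>I\<close> is the quenched rate function on \<open>dirs\<close>: for each direction separately, the defining limit
  holds almost surely with a deterministic value. The argument \<open>br\<close> is the chosen rounding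
  \<open>\<lambda>N \<xi>. [N\<xi>]\<close>. The values of \<open>I\<close> off \<open>dirs\<close> are irrelevant. The probability under the
  logarithm is almost surely positive, so the convention \<open>ln 0 = 0\<close> plays no role.
\<close>

definition quenched_rate_function ::
    "'s measure \<Rightarrow> (site \<Rightarrow> 's \<Rightarrow> real) \<Rightarrow> (nat \<Rightarrow> real \<times> real \<Rightarrow> site) \<Rightarrow> (real \<times> real \<Rightarrow> real) \<Rightarrow> bool"
  where
  "quenched_rate_function M \<omega> br I \<longleftrightarrow>
     (\<forall>\<xi>\<in>dirs. AE s in M.
        (\<lambda>N. - (ln (measure (quenched_law (\<lambda>x. \<omega> x s) 0) {X. X N = br N \<xi>}) / real N))
          \<longlonglongrightarrow> I \<xi>)"

text \<open>Here \<open>ln 0 = 0\<close> gives the convention \<open>0 log 0 = 0\<close>.\<close>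

definition averaged_rate :: "real \<Rightarrow> real \<Rightarrow> real \<times> real \<Rightarrow> real" where
  "averaged_rate \<alpha> \<beta> \<xi> =
     fst \<xi> * ln (fst \<xi> / fst (xi_star \<alpha> \<beta>)) + snd \<xi> * ln (snd \<xi> / snd (xi_star \<alpha> \<beta>))"

section \<open>The parameter \<open>\<lambda>(\<xi>)\<close>\<close>

definition right_ratio :: "real \<Rightarrow> real \<Rightarrow> real \<Rightarrow> real" where
  "right_ratio \<alpha> \<beta> l =
     (Polygamma 1 l - Polygamma 1 (\<alpha> + l)) / (Polygamma 1 l - Polygamma 1 (\<alpha> + \<beta> + l))"

definition left_ratio :: "real \<Rightarrow> real \<Rightarrow> real \<Rightarrow> real" where
  "left_ratio \<alpha> \<beta> l =
     1 - (Polygamma 1 l - Polygamma 1 (\<beta> + l)) / (Polygamma 1 l - Polygamma 1 (\<alpha> + \<beta> + l))"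

text \<open>Extension of a function on \<open>(0,\<infinity>)\<close> to \<open>[0,\<infinity>]\<close> by its limits at the end points.\<close>

definition extend_by_limits :: "(real \<Rightarrow> real) \<Rightarrow> ennreal \<Rightarrow> real" where
  "extend_by_limits f l =
     (if l = 0 then Lim (at_right 0) f
      else if l = \<infinity> then Lim at_top f
      else f (enn2real l))"

definition lambda_param :: "real \<Rightarrow> real \<Rightarrow> real \<times> real \<Rightarrow> ennreal" where
  "lambda_param \<alpha> \<beta> \<xi> =
     (THE l. (fst (xi_star \<alpha> \<beta>) \<le> fst \<xi> \<longrightarrow> fst \<xi> = extend_by_limits (right_ratio \<alpha> \<beta>) l) \<and>
             (fst \<xi> \<le> fst (xi_star \<alpha> \<beta>) \<longrightarrow> fst \<xi> = extend_by_limits (left_ratio \<alpha> \<beta>) l))"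

text \<open>
  The real number \<open>\<lambda>(\<xi>)\<close>, for \<open>\<xi> \<noteq> \<xi>\<^sup>*\<close>. When it is \<open>0\<close>, the formula for the rate function
  contains \<open>\<psi>\<^sub>0(0)\<close> only with the factor \<open>0\<close>, and that product is \<open>0\<close> since
  \<^const>\<open>Polygamma\<close> is total.
\<close>

definition lambda_real :: "real \<Rightarrow> real \<Rightarrow> real \<times> real \<Rightarrow> real" where
  "lambda_real \<alpha> \<beta> \<xi> = enn2real (lambda_param \<alpha> \<beta> \<xi>)"

definition strictly_convex_on :: "real set \<Rightarrow> (real \<Rightarrow> real) \<Rightarrow> bool" where
  "strictly_convex_on S f \<longleftrightarrow>
     convex S \<and>
     (\<forall>x\<in>S. \<forall>y\<in>S. x \<noteq> y \<longrightarrow>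
        (\<forall>u. 0 < u \<and> u < 1 \<longrightarrow> f ((1 - u) * x + u * y) < (1 - u) * f x + u * f y))"

end

theory Submission
  imports Defs "HOL-Real_Asymp.Real_Asymp"
begin

text \<open>
  For \<open>l > 0\<close> take harmonic functions of the quenched walk on a rectangle whose ratios along horizontal
  edges of the top side are \<open>Beta(\<alpha> + l, \<beta>)\<close> and whose inverse ratios along vertical edges of the right
  side are \<open>Beta(l, \<alpha>)\<close>, all independent of the weights inside. The beta-gamma (Dirichlet) identity
  makes this family of ratios stationary: the ratios along the bottom side are again independent and
  \<open>Beta(\<alpha> + l, \<beta>)\<close>. Hence the harmonic function decays along direction \<open>\<xi>\<close> at the explicit linear rate
  \<open>f\<^sub>l(\<xi>) = \<xi>\<^sub>1 (\<psi>\<^sub>0(\<alpha> + \<beta> + l) - \<psi>\<^sub>0(\<alpha> + l)) + \<xi>\<^sub>2 (\<psi>\<^sub>0(l) - \<psi>\<^sub>0(\<alpha> + l))\<close>. It dominates the hitting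
  probability of a corner, so \<open>I\<^sub>q \<ge> f\<^sub>l\<close> for every \<open>l\<close>. Conversely it is an average of its boundary values
  over the exit point of the walk; when \<open>l\<close> maximises \<open>f\<^sub>l(\<xi>)\<close>, comparison with a slightly smaller and a
  slightly larger parameter shows that exit points far from the corner do not contribute, which gives
  \<open>I\<^sub>q(\<xi>) \<le> f\<^sub>l(\<xi>)\<close>. Thus \<open>I\<^sub>q\<close> is a maximum of affine functions with distinct contact points, hence
  strictly convex, and \<open>I\<^sub>q > I\<^sub>a\<close> amounts to strict convexity of \<open>exp \<circ> \<psi>\<^sub>0\<close>. Directions on the other side
  of \<open>\<xi>\<^sup>*\<close> follow by exchanging the coordinates.
\<close>

section \<open>Polygamma functions\<close>

text \<open>The defining limit of the quenched rate is given as an almost sure limit with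
  deterministic value, so every bound is only needed with probability tending to 1. This permits
  Markov's inequality with moments of a small order s. Such moments are subadditive over exit
  points, and the logarithm of a boundary moment has minus a Digamma rate as its derivative at s =
  0, so a strict inequality between rates already produces some s > 0 with exponential decay.
  Positive orders bound exit probabilities from above, negative orders bound the harmonic function
  from below. The obstacle is that the stationary harmonic function receives mass from all exit
  points. An exit term is a product of a bulk part, whose law does not involve l, and boundary
  ratios, whose law does; bounding the bulk part with one parameter and the boundary part with
  another gains a factor per boundary edge. Two directions have no critical parameter in (0,
  \<infinity>): e1, where the walk stays on the axis and the probability is a product of independent
  weights, and \<open>xi_star\<close>, which is treated by a limit.\<close>

lemma pos_of_decreasing_shift:
  fixes d :: "real \<Rightarrow> real"
  assumes "x > 0" and step: "\<And>x. x > 0 \<Longrightarrow> d (x + 1) < d x"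
    and lim: "(\<lambda>n. d (x + real n)) \<longlonglongrightarrow> 0"
  shows "d x > 0"
proof -
  have "d (x + real (Suc n)) < d (x + real n)" for n
    using step[of "x + real n"] assms(1) by (simp add: add_ac)
  then have "decseq (\<lambda>n. d (x + real n))"
    by (intro decseq_SucI less_imp_le)
  then have "d (x + real 1) \<ge> 0" using decseq_ge[OF _ lim] by blast
  with step[OF assms(1)] show ?thesis by simp
qed

text \<open>The recurrence removes from \<open>Polygamma n x\<close> exactly the partial sums of its
  own series, so what remains tends to 0.\<close>

lemma Polygamma_shift_tendsto_0:
  assumes "x > (0::real)" "n > 0"
  shows "(\<lambda>k. Polygamma n (x + real k)) \<longlonglongrightarrow> 0"
proof -
  have S: "(\<lambda>k. inverse ((x + real k)^Suc n)) sums ((-1) ^ Suc n * Polygamma n x / fact n)"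
    using Polygamma_LIMSEQ[of x n] assms by simp
  have eq: "Polygamma n (x + real m) =
      Polygamma n x + (-1)^n * fact n * (\<Sum>k<m. inverse ((x + real k)^Suc n))" for m
  proof (induction m)
    case (Suc m)
    have "Polygamma n (x + real m + 1) = Polygamma n (x + real m) + (-1)^n * fact n / ((x + real m)^Suc n)"
      by (rule Polygamma_plus1) (use assms in simp)
    with Suc show ?case by (simp add: algebra_simps inverse_eq_divide del: power_Suc)
  qed simp
  have "(\<lambda>m. Polygamma n x + (-1)^n * fact n * (\<Sum>k<m. inverse ((x + real k)^Suc n)))
     \<longlonglongrightarrow> Polygamma n x + (-1)^n * fact n * ((-1) ^ Suc n * Polygamma n x / fact n)"
    by (intro tendsto_intros S[unfolded sums_def])
  also have "Polygamma n x + (-1)^n * fact n * ((-1) ^ Suc n * Polygamma n x / fact n) = (0::real)"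
    by (cases "even n") simp_all
  finally show ?thesis unfolding eq .
qed

lemma inverse_power_shift_tendsto_0:
  assumes "n > 0"
  shows "(\<lambda>k. c / (x + real k) ^ n) \<longlonglongrightarrow> (0::real)"
  by (intro real_tendsto_divide_at_top[OF tendsto_const] filterlim_at_top_mult_tendsto_pos filterlim_pow_at_top
      filterlim_tendsto_add_at_top[OF tendsto_const] filterlim_real_sequentially assms)

text \<open>The bound consists of the first terms of the asymptotic expansion. The recurrence makes
  the step from x to x + 1 a rational function, so only one step and the decay at infinity have to
  be checked. This truncation is the one that \<open>Trigamma_square_gt\<close> consumes.\<close>

lemma Trigamma_gt:
  assumes "x > (0::real)"
  shows "Polygamma 1 x > 1 / x + 1 / (2 * x\<^sup>2)"
proof -
  define d where "d = (\<lambda>x::real. Polygamma 1 x - (1 / x + 1 / (2 * x\<^sup>2)))"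
  have "d x > 0"
  proof (rule pos_of_decreasing_shift[OF assms])
    fix x :: real assume x: "x > 0"
    have "Polygamma 1 (x + 1) = Polygamma 1 x - 1 / x\<^sup>2"
      using Polygamma_plus1[of x 1] x by (simp add: power2_eq_square)
    then have "d x - d (x + 1) = (1 / x)\<^sup>2 - 1 / x + 1 / (x + 1) - (1 / x)\<^sup>2 / 2 + (1 / (x + 1))\<^sup>2 / 2"
      unfolding d_def by (simp add: power_one_over)
    moreover have ab: "1 / x - 1 / (x + 1) = (1 / x) * (1 / (x + 1))" using x by (simp add: field_simps)
    \<comment> \<open>With a = 1 / x and b = 1 / (x + 1) the relation a - b = a * b makes the step
      half a square.\<close>
    moreover have "a\<^sup>2 - a + b - a\<^sup>2 / 2 + b\<^sup>2 / 2 = (a - b)\<^sup>2 / 2" if "a - b = a * b" for a b :: real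
      using that unfolding power2_diff by (simp add: field_simps)
    ultimately have "d x - d (x + 1) = (1 / x - 1 / (x + 1))\<^sup>2 / 2" by presburger
    also have "\<dots> > 0" unfolding ab using x by simp
    finally show "d (x + 1) < d x" by simp
  next
    have "(\<lambda>n. Polygamma 1 (x + real n) - (1 / (x + real n)^1 + (1/2) / (x + real n)^2)) \<longlonglongrightarrow> 0 - (0 + 0)"
      by (intro tendsto_diff tendsto_add Polygamma_shift_tendsto_0 inverse_power_shift_tendsto_0 assms) auto
    then show "(\<lambda>n. d (x + real n)) \<longlonglongrightarrow> 0" by (simp add: d_def)
  qed
  then show ?thesis by (simp add: d_def)
qed

text \<open>One more term of the expansion; the step of the difference collapses to 1 / (6 x^3 (x +
  1)^3). Together with \<open>Trigamma_gt\<close> it determines Trigamma up to order x^-3.\<close>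

lemma Trigamma_lt:
  assumes "x > (0::real)"
  shows "Polygamma 1 x < 1 / x + 1 / (2 * x\<^sup>2) + 1 / (6 * x ^ 3)"
proof -
  define d where "d = (\<lambda>x::real. 1 / x + 1 / (2 * x\<^sup>2) + 1 / (6 * x ^ 3) - Polygamma 1 x)"
  have "d x > 0"
  proof (rule pos_of_decreasing_shift[OF assms])
    fix x :: real assume x: "x > 0"
    have "Polygamma 1 (x + 1) = Polygamma 1 x - 1 / x\<^sup>2"
      using Polygamma_plus1[of x 1] x by (simp add: power2_eq_square)
    then have "d x - d (x + 1) = 1 / x - 1 / (x + 1) - 1 / (2 * x\<^sup>2) - 1 / (2 * (x+1)\<^sup>2)
        + 1 / (6 * x ^ 3) - 1 / (6 * (x + 1) ^ 3)"
      unfolding d_def by simp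
    also have "\<dots> = 1 / (6 * x ^ 3 * (x + 1) ^ 3)"
      using x by (simp add: divide_simps) algebra
    also have "\<dots> > 0" using x by simp
    finally show "d (x + 1) < d x" by simp
  next
    have "(\<lambda>n. 1 / (x + real n)^1 + (1/2) / (x + real n)^2 + (1/6) / (x + real n)^3 - Polygamma 1 (x + real n)) \<longlonglongrightarrow> 0 + 0 + 0 - 0"
      by (intro tendsto_diff tendsto_add Polygamma_shift_tendsto_0 inverse_power_shift_tendsto_0 assms) auto
    then show "(\<lambda>n. d (x + real n)) \<longlonglongrightarrow> 0" by (simp add: d_def)
  qed
  then show ?thesis by (simp add: d_def)
qed

text \<open>This expression is the second derivative of exp o Digamma divided by exp o Digamma. Its
  decrease over one step is 2 / x^2 times the slack in \<open>Trigamma_gt\<close>.\<close>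

lemma Trigamma_square_gt:
  assumes "x > (0::real)"
  shows "(Polygamma 1 x)\<^sup>2 + Polygamma 2 x > 0"
proof -
  define d where "d = (\<lambda>x::real. (Polygamma 1 x)\<^sup>2 + Polygamma 2 x)"
  have "d x > 0"
  proof (rule pos_of_decreasing_shift[OF assms])
    fix x :: real assume x: "x > 0"
    have 1: "Polygamma 1 (x + 1) = Polygamma 1 x - 1 / x\<^sup>2"
      using Polygamma_plus1[of x 1] x by (simp add: power2_eq_square)
    have 2: "Polygamma 2 (x + 1) = Polygamma 2 x + 2 / x^3"
      using Polygamma_plus1[of x 2] x by (simp add: power_numeral_reduce)
    have "d x - d (x + 1) = 2 / x\<^sup>2 * (Polygamma 1 x - (1 / x + 1 / (2 * x\<^sup>2)))"
      unfolding d_def 1 2 using x by (simp add: field_simps power2_eq_square power3_eq_cube)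
    also have "\<dots> > 0" using Trigamma_gt[OF x] x by simp
    finally show "d (x + 1) < d x" by simp
  next
    have "(\<lambda>n. (Polygamma 1 (x + real n))\<^sup>2 + Polygamma 2 (x + real n)) \<longlonglongrightarrow> 0\<^sup>2 + 0"
      by (intro tendsto_add tendsto_power Polygamma_shift_tendsto_0 assms) auto
    then show "(\<lambda>n. d (x + real n)) \<longlonglongrightarrow> 0" by (simp add: d_def)
  qed
  then show ?thesis by (simp add: d_def)
qed

lemma has_real_derivative_Polygamma_pos:
  "(x::real) > 0 \<Longrightarrow> (Polygamma n has_real_derivative Polygamma (Suc n) x) (at x)"
  by (intro derivative_intros) (auto elim!: nonpos_Ints_cases)

text \<open>Cauchy-Schwarz for the series S n of (x + k)^-n gives S4^2 \<le> S3 S5. The factorials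
  make it strict, since 6^2 = 36 is less than 2 * 24 = 48.\<close>

lemma Polygamma_3_square_less:
  assumes "x > (0::real)"
  shows "(Polygamma 3 x)\<^sup>2 < Polygamma 2 x * Polygamma 4 x"
proof -
  define S where "S n = (\<Sum>k. inverse ((x + real k)^n))" for n
  have sm: "summable (\<lambda>k. inverse ((x + real k)^n))" if "n \<ge> 2" for n
    using Polygamma_converges'[of x n] that assms by simp
  have P: "Polygamma n x = (-1)^Suc n * fact n * S (Suc n)" if "n > 0" for n
    using that by (simp add: Polygamma_def S_def)
  have S3: "S 3 > 0" and S4: "S 4 > 0" unfolding S_def
    by (intro suminf_pos sm; use assms in simp)+
  \<comment> \<open>The minimiser of the quadratic S 5 - 2 t S 4 + t^2 S 3, which is a series of
    nonnegative terms for every t.\<close>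
  define t where "t = S 4 / S 3"
  have "0 \<le> (\<Sum>k. inverse ((x + real k)^5) - 2 * t * inverse ((x + real k)^4) + t\<^sup>2 * inverse ((x + real k)^3))"
  proof (intro suminf_nonneg summable_add summable_diff summable_mult sm)
    fix k
    define u where "u = inverse (x + real k)"
    have "inverse ((x + real k)^5) - 2 * t * inverse ((x + real k)^4) + t\<^sup>2 * inverse ((x + real k)^3)
      = u ^ 3 * (u - t)\<^sup>2"
      unfolding u_def power_inverse[symmetric] by algebra
    moreover have "u \<ge> 0" using assms by (simp add: u_def)
    ultimately show "0 \<le> inverse ((x + real k)^5) - 2 * t * inverse ((x + real k)^4) + t\<^sup>2 * inverse ((x + real k)^3)"
      by simp
  qed auto
  also have "\<dots> = S 5 - 2 * t * S 4 + t\<^sup>2 * S 3"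
    unfolding S_def
    by (subst suminf_add[symmetric] suminf_diff[symmetric] suminf_mult,
        (intro summable_add summable_diff summable_mult sm; simp)+)+ simp
  also have "\<dots> = S 5 - (S 4)\<^sup>2 / S 3"
    using S3 by (simp add: t_def field_simps power2_eq_square)
  finally have "(S 4)\<^sup>2 \<le> S 3 * S 5" using S3 by (simp add: field_simps)
  moreover have "(S 4)\<^sup>2 > 0" using S4 by simp
  moreover have P: "Polygamma 2 x = - 2 * S 3" "Polygamma 3 x = 6 * S 4" "Polygamma 4 x = - 24 * S 5"
    by (simp_all add: P fact_numeral eval_nat_numeral)
  ultimately have "3 * (S 4)\<^sup>2 < 4 * (S 3 * S 5)" by linarith
  then show ?thesis unfolding P by (simp add: power_mult_distrib)
qed

text \<open>\<open>Polygamma 2\<close> is negative and its absolute value is log-convex by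
  \<open>Polygamma_3_square_less\<close>, so its logarithmic derivative increases.\<close>

lemma Polygamma_ratio_strict_mono:
  assumes "0 < x" "x < (y::real)"
  shows "Polygamma 3 x / Polygamma 2 x < Polygamma 3 y / Polygamma 2 y"
proof (rule DERIV_pos_imp_increasing[OF assms(2)])
  fix t assume t: "x \<le> t" "t \<le> y"
  then have t0: "t > 0" using assms by simp
  have neg: "Polygamma 2 t < 0" using Polygamma_real_even_neg[of t 2] t0 by simp
  have "((\<lambda>x. Polygamma 3 x / Polygamma 2 x) has_real_derivative
     (Polygamma 4 t * Polygamma 2 t - Polygamma 3 t * Polygamma 3 t) / (Polygamma 2 t * Polygamma 2 t)) (at t)"
    using DERIV_divide[OF has_real_derivative_Polygamma_pos[OF t0, of 3] has_real_derivative_Polygamma_pos[OF t0, of 2]] neg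
    by simp
  moreover have "(Polygamma 4 t * Polygamma 2 t - Polygamma 3 t * Polygamma 3 t) / (Polygamma 2 t * Polygamma 2 t) > 0"
    using Polygamma_3_square_less[OF t0] neg
    by (intro divide_pos_pos) (auto simp: power2_eq_square mult.commute mult_neg_neg)
  ultimately show "\<exists>z. ((\<lambda>x. Polygamma 3 x / Polygamma 2 x) has_real_derivative z) (at t) \<and> 0 < z" by blast
qed

text \<open>Cauchy's mean value theorem. It allows ratios of increments over neighbouring intervals
  to be compared through \<open>Polygamma_ratio_strict_mono\<close>.\<close>

lemma Polygamma_chord:
  assumes "0 < x" "x < (y::real)"
  obtains s where "x < s" "s < y"
    "(Polygamma 2 x - Polygamma 2 y) / (Polygamma 1 x - Polygamma 1 y) = Polygamma 3 s / Polygamma 2 s"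
proof -
  have "\<exists>s. x < s \<and> s < y \<and> (Polygamma 2 y - Polygamma 2 x) * Polygamma (Suc 1) s = (Polygamma 1 y - Polygamma 1 x) * Polygamma (Suc 2) s"
  proof (rule GMVT')
    fix z assume "x < z" "z < y"
    then have "z > 0" using assms by simp
    then show "(Polygamma 1 has_real_derivative Polygamma (Suc 1) z) (at z)"
      "(Polygamma 2 has_real_derivative Polygamma (Suc 2) z) (at z)"
      by (rule has_real_derivative_Polygamma_pos)+
  next
    fix z assume "x \<le> z" "z \<le> y"
    then have "z > 0" using assms by simp
    then show "isCont (Polygamma 2) z" "isCont (Polygamma 1) z"
      by (rule DERIV_isCont[OF has_real_derivative_Polygamma_pos])+
  qed (use assms in simp)
  then obtain s where s: "x < s" "s < y"
     "(Polygamma 2 y - Polygamma 2 x) * Polygamma 2 s = (Polygamma 1 y - Polygamma 1 x) * Polygamma 3 s"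
    by (auto simp: eval_nat_numeral)
  have "Polygamma 2 s < 0" using Polygamma_real_even_neg[of s 2] s assms by simp
  moreover have "Polygamma 1 x - Polygamma 1 y > 0"
    using Polygamma_real_strict_antimono[of x y 1] assms by simp
  ultimately show ?thesis using s by (intro that[of s]) (auto simp: field_simps)
qed

section \<open>Linear rates as functions of the parameter\<close>

definition rate_h :: "real \<Rightarrow> real \<Rightarrow> real \<Rightarrow> real" where
  "rate_h \<alpha> \<beta> l = Digamma (\<alpha> + \<beta> + l) - Digamma (\<alpha> + l)"

text \<open>Both rates are mean logarithms: \<open>rate_h\<close> is minus that of a Beta(\<alpha> +
  l, \<beta>) variable, \<open>rate_v\<close> is that of a Beta(l, \<alpha>) variable. The latter is
  negative because the harmonic function grows on the way down the right side.\<close>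

definition rate_v :: "real \<Rightarrow> real \<Rightarrow> real" where
  "rate_v \<alpha> l = Digamma l - Digamma (\<alpha> + l)"

text \<open>Two free coefficients instead of one direction: the treatment of \<open>xi_star\<close>
  uses a + b < 1.\<close>

definition lin_rate :: "real \<Rightarrow> real \<Rightarrow> real \<Rightarrow> real \<Rightarrow> real \<Rightarrow> real" where
  "lin_rate \<alpha> \<beta> a b l = a * rate_h \<alpha> \<beta> l + b * rate_v \<alpha> l"

context
  notes One_nat_def [simp del]
begin

lemma has_real_derivative_Polygamma_shift:
  "c + x > 0 \<Longrightarrow> ((\<lambda>x. Polygamma n (c + x)) has_real_derivative Polygamma (Suc n) (c + x)) (at (x::real))"
  using DERIV_chain'[of "\<lambda>x. c + x" 1 x UNIV "Polygamma n" "Polygamma (Suc n) (c + x)"]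
    has_real_derivative_Polygamma_pos[of "c + x" n]
  by (auto intro!: derivative_eq_intros)

lemma isCont_Polygamma_shift: "c + x > 0 \<Longrightarrow> isCont (\<lambda>x. Polygamma n (c + x)) (x::real)"
  by (rule DERIV_isCont[OF has_real_derivative_Polygamma_shift])

lemma tendsto_Polygamma_shift_at_right_0:
  "c > 0 \<Longrightarrow> ((\<lambda>x. Polygamma n (c + x)) \<longlongrightarrow> Polygamma n (c::real)) (at_right 0)"
  using isCont_Polygamma_shift[of c 0 n] unfolding isCont_def
  by (auto intro: tendsto_mono at_le)

lemma Trigamma_gt_inverse:
  assumes "x > (0::real)"
  shows "1 / x < Polygamma 1 x"
proof -
  have "1 / (2 * x\<^sup>2) > 0" using assms by simp
  with Trigamma_gt[OF assms] show ?thesis by linarith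
qed

lemma Trigamma_tendsto_0: "((Polygamma 1 :: real \<Rightarrow> real) \<longlongrightarrow> 0) at_top"
proof (rule tendsto_sandwich)
  show "\<forall>\<^sub>F x in at_top. 1 / x + 1 / (2 * x\<^sup>2) \<le> (Polygamma 1 x :: real)"
    using eventually_gt_at_top[of 0] by eventually_elim (auto intro: less_imp_le Trigamma_gt)
  show "\<forall>\<^sub>F x in at_top. (Polygamma 1 x :: real) \<le> 1 / x + 1 / (2 * x\<^sup>2) + 1 / (6 * x ^ 3)"
    using eventually_gt_at_top[of 0] by eventually_elim (auto intro: less_imp_le Trigamma_lt)
  show "((\<lambda>x::real. 1 / x + 1 / (2 * x\<^sup>2)) \<longlongrightarrow> 0) at_top" by real_asymp
  show "((\<lambda>x::real. 1 / x + 1 / (2 * x\<^sup>2) + 1 / (6 * x ^ 3)) \<longlongrightarrow> 0) at_top" by real_asymp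
qed

lemma Digamma_diff_bounds:
  assumes "x > (0::real)" "a > 0"
  shows "0 < Digamma (a + x) - Digamma x" "Digamma (a + x) - Digamma x < a * Polygamma 1 x"
proof -
  have "\<exists>s. x < s \<and> s < a + x \<and> Digamma (a + x) - Digamma x = (a + x - x) * Polygamma (Suc 0) s"
    using assms by (intro MVT2 has_real_derivative_Polygamma_pos) auto
  then obtain s where s: "x < s" "Digamma (a + x) - Digamma x = a * Polygamma 1 s" by (auto simp: One_nat_def)
  have "Polygamma 1 s < Polygamma 1 x"
    using s assms by (intro Polygamma_real_strict_antimono) auto
  then show "Digamma (a + x) - Digamma x < a * Polygamma 1 x" using s assms by simp
  show "0 < Digamma (a + x) - Digamma x" using Digamma_real_strict_mono[of x "a + x"] assms by simp
qed

lemma Digamma_diff_tendsto_0: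
  assumes "a > (0::real)"
  shows "((\<lambda>x. Digamma (a + x) - Digamma x) \<longlongrightarrow> 0) at_top"
proof (rule tendsto_sandwich)
  show "\<forall>\<^sub>F x in at_top. 0 \<le> Digamma (a + x) - Digamma x"
    using eventually_gt_at_top[of 0] by eventually_elim (use assms in \<open>auto intro: Digamma_real_mono\<close>)
  show "\<forall>\<^sub>F x in at_top. Digamma (a + x) - Digamma x \<le> a * Polygamma 1 x"
    using eventually_gt_at_top[of 0] 
    by eventually_elim (use assms Digamma_diff_bounds(2) in \<open>auto intro: less_imp_le\<close>)
  show "((\<lambda>x. a * Polygamma 1 x) \<longlongrightarrow> 0) at_top"
    by (rule tendsto_mult_right_zero[OF Trigamma_tendsto_0])
qed simp

text \<open>The bounds of \<open>Trigamma_gt\<close> and \<open>Trigamma_lt\<close> differ by a term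
  of order x^-3, which disappears after multiplication by x^2.\<close>

lemma Trigamma_diff_asymp:
  assumes "a > (0::real)"
  shows "((\<lambda>x. x\<^sup>2 * (Polygamma 1 x - Polygamma 1 (a + x))) \<longlongrightarrow> a) at_top"
proof (rule tendsto_sandwich)
  show "\<forall>\<^sub>F x in at_top. x\<^sup>2 * (1 / x + 1 / (2 * x\<^sup>2) - (1 / (a + x) + 1 / (2 * (a + x)\<^sup>2) + 1 / (6 * (a + x) ^ 3)))
      \<le> x\<^sup>2 * (Polygamma 1 x - Polygamma 1 (a + x))"
    using eventually_gt_at_top[of 0]
  proof eventually_elim
    case (elim x)
    show ?case using Trigamma_gt[of x] Trigamma_lt[of "a + x"] elim assms
      by (intro mult_left_mono) auto
  qed
  show "\<forall>\<^sub>F x in at_top. x\<^sup>2 * (Polygamma 1 x - Polygamma 1 (a + x)) \<le>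
      x\<^sup>2 * (1 / x + 1 / (2 * x\<^sup>2) + 1 / (6 * x ^ 3) - (1 / (a + x) + 1 / (2 * (a + x)\<^sup>2)))"
    using eventually_gt_at_top[of 0]
  proof eventually_elim
    case (elim x)
    show ?case using Trigamma_lt[of x] Trigamma_gt[of "a + x"] elim assms
      by (intro mult_left_mono) auto
  qed
  show "((\<lambda>x::real. x\<^sup>2 * (1 / x + 1 / (2 * x\<^sup>2) - (1 / (a + x) + 1 / (2 * (a + x)\<^sup>2) + 1 / (6 * (a + x) ^ 3)))) \<longlongrightarrow> a) at_top"
    by real_asymp
  show "((\<lambda>x::real. x\<^sup>2 * (1 / x + 1 / (2 * x\<^sup>2) + 1 / (6 * x ^ 3) - (1 / (a + x) + 1 / (2 * (a + x)\<^sup>2)))) \<longlongrightarrow> a) at_top"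
    by real_asymp
qed

lemma Trigamma_filterlim_at_right_0: "filterlim (Polygamma 1 :: real \<Rightarrow> real) at_top (at_right 0)"
proof (rule filterlim_at_top_mono)
  show "filterlim (\<lambda>x::real. 1 / x) at_top (at_right 0)" by real_asymp
  show "\<forall>\<^sub>F x::real in at_right 0. 1 / x \<le> Polygamma 1 x"
    unfolding eventually_at_right_field
  proof (intro exI[of _ 1] conjI allI impI)
    fix x :: real assume "0 < x" "x < 1"
    then show "1 / x \<le> Polygamma 1 x" using Trigamma_gt_inverse[of x] by simp
  qed simp
qed

context
  fixes \<alpha> \<beta> :: real
  assumes pos: "\<alpha> > 0" "\<beta> > 0"
begin

lemma Trigamma_gap_pos: "l > 0 \<Longrightarrow> c > 0 \<Longrightarrow> Polygamma 1 (c + l) < Polygamma 1 (l :: real)"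
  using Polygamma_real_strict_antimono[of l "c + l" 1] by simp

text \<open>A form suited to l \<rightarrow> 0: the numerator stays bounded while the denominator
  tends to infinity.\<close>

lemma right_ratio_eq:
  "right_ratio \<alpha> \<beta> l = 1 - (Polygamma 1 (\<alpha> + l) - Polygamma 1 (\<alpha> + \<beta> + l)) / (Polygamma 1 l - Polygamma 1 (\<alpha> + \<beta> + l))"
  if "l > 0"
  using Trigamma_gap_pos[OF that, of "\<alpha> + \<beta>"] pos by (simp add: right_ratio_def field_simps)

text \<open>With A and C the decrease of Trigamma over [l, \<alpha> + l] and over
  [\<alpha> + l, \<alpha> + \<beta> + l], the ratio equals 1 / (1 + C / A). The logarithmic
  derivatives of A and C are values of Polygamma 3 / Polygamma 2 at a point of the first and of the
  second interval. The second point lies to the right of the first, so C / A increases.\<close>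

lemma right_ratio_strict_antimono:
  assumes "0 < l" "l < l'"
  shows "right_ratio \<alpha> \<beta> l' < right_ratio \<alpha> \<beta> l"
proof -
  define A where "A = (\<lambda>l. Polygamma 1 l - Polygamma 1 (\<alpha> + l))"
  define C where "C = (\<lambda>l. Polygamma 1 (\<alpha> + l) - Polygamma 1 (\<alpha> + \<beta> + l))"
  have A0: "A l > 0" and C0: "C l > 0" if "l > 0" for l
    using Trigamma_gap_pos[of l \<alpha>] Trigamma_gap_pos[of "\<alpha> + l" \<beta>] that pos
    by (auto simp: A_def C_def add_ac)
  have R: "right_ratio \<alpha> \<beta> l = 1 / (1 + C l / A l)" if "l > 0" for l
    using A0[OF that] C0[OF that] by (simp add: right_ratio_def A_def C_def field_simps)
  have "C l / A l < C l' / A l'"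
  proof (rule DERIV_pos_imp_increasing[OF assms(2)])
    fix t assume "l \<le> t" "t \<le> l'"
    then have t: "t > 0" using assms by simp
    define A' where "A' = Polygamma 2 t - Polygamma 2 (\<alpha> + t)"
    define C' where "C' = Polygamma 2 (\<alpha> + t) - Polygamma 2 (\<alpha> + \<beta> + t)"
    have dA: "(A has_real_derivative A') (at t)"
      unfolding A_def A'_def
      using has_real_derivative_Polygamma_shift[of 0 t 1] has_real_derivative_Polygamma_shift[of \<alpha> t 1] t pos
      by (intro DERIV_diff) (auto simp: numeral_2_eq_2)
    have dC: "(C has_real_derivative C') (at t)"
      unfolding C_def C'_def
      using has_real_derivative_Polygamma_shift[of "\<alpha> + \<beta>" t 1] has_real_derivative_Polygamma_shift[of \<alpha> t 1] t pos
      by (intro DERIV_diff) (auto simp: numeral_2_eq_2)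
    obtain s where s: "t < s" "s < \<alpha> + t" "A' / A t = Polygamma 3 s / Polygamma 2 s"
      using Polygamma_chord[of t "\<alpha> + t"] t pos unfolding A_def A'_def by auto
    obtain u where u: "\<alpha> + t < u" "u < \<alpha> + \<beta> + t" "C' / C t = Polygamma 3 u / Polygamma 2 u"
      using Polygamma_chord[of "\<alpha> + t" "\<alpha> + \<beta> + t"] t pos unfolding C_def C'_def by auto
    have "A' / A t < C' / C t"
      unfolding s u using s u t by (intro Polygamma_ratio_strict_mono) auto
    then have "C' * A t - C t * A' > 0"
      using A0[OF t] C0[OF t] by (simp add: field_simps)
    moreover have "((\<lambda>l. C l / A l) has_real_derivative (C' * A t - C t * A') / (A t * A t)) (at t)"
      using A0[OF t] by (intro DERIV_divide dA dC) auto
    ultimately show "\<exists>z. ((\<lambda>l. C l / A l) has_real_derivative z) (at t) \<and> 0 < z"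
      using A0[OF t] by (intro exI[of _ "(C' * A t - C t * A') / (A t * A t)"]) (auto intro!: divide_pos_pos)
  qed
  moreover have "C l / A l > 0" using A0 C0 assms by simp
  ultimately show ?thesis using R assms by (simp add: frac_less2)
qed

lemma isCont_right_ratio: "l > 0 \<Longrightarrow> isCont (right_ratio \<alpha> \<beta>) l"
  unfolding right_ratio_def[abs_def]
  using isCont_Polygamma_shift[of 0 l 1] isCont_Polygamma_shift[of \<alpha> l 1]
    isCont_Polygamma_shift[of "\<alpha> + \<beta>" l 1] Trigamma_gap_pos[of l "\<alpha> + \<beta>"] pos
  by (intro continuous_divide continuous_diff) auto

lemma right_ratio_tendsto_at_top: "(right_ratio \<alpha> \<beta> \<longlongrightarrow> \<alpha> / (\<alpha> + \<beta>)) at_top"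
proof (rule Lim_transform_eventually)
  show "((\<lambda>x. (x\<^sup>2 * (Polygamma 1 x - Polygamma 1 (\<alpha> + x))) / (x\<^sup>2 * (Polygamma 1 x - Polygamma 1 ((\<alpha> + \<beta>) + x)))) \<longlongrightarrow> \<alpha> / (\<alpha> + \<beta>)) at_top"
    using pos by (intro tendsto_divide Trigamma_diff_asymp) auto
  show "\<forall>\<^sub>F x in at_top. (x\<^sup>2 * (Polygamma 1 x - Polygamma 1 (\<alpha> + x))) / (x\<^sup>2 * (Polygamma 1 x - Polygamma 1 ((\<alpha> + \<beta>) + x))) = right_ratio \<alpha> \<beta> x"
    using eventually_gt_at_top[of 0] by eventually_elim (auto simp: right_ratio_def)
qed

lemma right_ratio_tendsto_at_0: "(right_ratio \<alpha> \<beta> \<longlongrightarrow> 1) (at_right 0)"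
proof (rule Lim_transform_eventually)
  have "((\<lambda>l. 1 - (Polygamma 1 (\<alpha> + l) - Polygamma 1 (\<alpha> + \<beta> + l)) / (- Polygamma 1 (\<alpha> + \<beta> + l) + Polygamma 1 l))
    \<longlongrightarrow> 1 - 0) (at_right 0)"
    using pos
    by (intro tendsto_diff tendsto_const real_tendsto_divide_at_top[where c = "Polygamma 1 \<alpha> - Polygamma 1 (\<alpha> + \<beta>)"]
       tendsto_Polygamma_shift_at_right_0 filterlim_tendsto_add_at_top[where c = "- Polygamma 1 (\<alpha> + \<beta>)"]
       tendsto_minus Trigamma_filterlim_at_right_0) auto
  then show "((\<lambda>l. 1 - (Polygamma 1 (\<alpha> + l) - Polygamma 1 (\<alpha> + \<beta> + l)) / (- Polygamma 1 (\<alpha> + \<beta> + l) + Polygamma 1 l))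
    \<longlongrightarrow> 1) (at_right 0)" by simp
  show "\<forall>\<^sub>F l in at_right 0. 1 - (Polygamma 1 (\<alpha> + l) - Polygamma 1 (\<alpha> + \<beta> + l)) / (- Polygamma 1 (\<alpha> + \<beta> + l) + Polygamma 1 l)
     = right_ratio \<alpha> \<beta> l"
    unfolding eventually_at_right_field
    by (intro exI[of _ 1]) (auto simp: right_ratio_eq)
qed

lemma right_ratio_less_1: "l > 0 \<Longrightarrow> right_ratio \<alpha> \<beta> l < 1"
  using Trigamma_gap_pos[of l "\<alpha> + \<beta>"] Trigamma_gap_pos[of "\<alpha> + l" \<beta>] pos
  by (simp add: right_ratio_eq add_ac)

lemma right_ratio_gt: 
  assumes "l > 0"
  shows "\<alpha> / (\<alpha> + \<beta>) < right_ratio \<alpha> \<beta> l"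
proof -
  \<comment> \<open>The limit only yields \<le>; the bound is taken at l + 1, and strict
    monotonicity recovers < at l.\<close>
  have "\<alpha> / (\<alpha> + \<beta>) \<le> right_ratio \<alpha> \<beta> (l + 1)"
  proof (rule tendsto_upperbound[OF right_ratio_tendsto_at_top])
    show "\<forall>\<^sub>F x in at_top. right_ratio \<alpha> \<beta> x \<le> right_ratio \<alpha> \<beta> (l + 1)"
      using eventually_gt_at_top[of "l + 1"] 
      by eventually_elim (use assms in \<open>auto intro!: less_imp_le right_ratio_strict_antimono\<close>)
  qed simp
  with right_ratio_strict_antimono[OF assms, of "l + 1"] show ?thesis by simp
qed

lemma right_ratio_inj: "l > 0 \<Longrightarrow> l' > 0 \<Longrightarrow> right_ratio \<alpha> \<beta> l = right_ratio \<alpha> \<beta> l' \<Longrightarrow> l = l'"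
  using right_ratio_strict_antimono[of l l'] right_ratio_strict_antimono[of l' l] by linarith

lemma right_ratio_surj:
  assumes "\<alpha> / (\<alpha> + \<beta>) < a" "a < 1"
  obtains l where "l > 0" "right_ratio \<alpha> \<beta> l = a"
proof -
  have "\<forall>\<^sub>F l in at_right 0. right_ratio \<alpha> \<beta> l > a"
    by (rule order_tendstoD(1)[OF right_ratio_tendsto_at_0 assms(2)])
  then obtain b where b: "b > 0" "\<And>l. 0 < l \<Longrightarrow> l < b \<Longrightarrow> right_ratio \<alpha> \<beta> l > a"
    unfolding eventually_at_right_field by auto
  have "\<forall>\<^sub>F l in at_top. right_ratio \<alpha> \<beta> l < a \<and> l > b"
    by (intro eventually_conj order_tendstoD(2)[OF right_ratio_tendsto_at_top assms(1)] eventually_gt_at_top)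
  then obtain c where c: "right_ratio \<alpha> \<beta> c < a" "c > b"
    using eventually_happens[OF \<open>eventually _ at_top\<close>] by auto
  have "\<exists>x\<ge>b/2. x \<le> c \<and> right_ratio \<alpha> \<beta> x = a"
    using b b(2)[of "b/2"] c by (intro IVT2 allI impI isCont_right_ratio less_imp_le[of a]) auto
  then obtain x where "b/2 \<le> x" "right_ratio \<alpha> \<beta> x = a" by auto
  then show ?thesis using that[of x] b by auto
qed


lemma has_real_derivative_lin_rate:
  assumes "l > 0"
  shows "(lin_rate \<alpha> \<beta> a b has_real_derivative
     b * (Polygamma 1 l - Polygamma 1 (\<alpha> + l)) - a * (Polygamma 1 (\<alpha> + l) - Polygamma 1 (\<alpha> + \<beta> + l))) (at l)"
proof -
  have "((\<lambda>l. a * (Digamma (\<alpha> + \<beta> + l) - Digamma (\<alpha> + l)) + b * (Digamma (0 + l) - Digamma (\<alpha> + l)))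
     has_real_derivative
     a * (Polygamma (Suc 0) (\<alpha> + \<beta> + l) - Polygamma (Suc 0) (\<alpha> + l)) + b * (Polygamma (Suc 0) (0 + l) - Polygamma (Suc 0) (\<alpha> + l))) (at l)"
    using assms pos
    by (intro DERIV_add DERIV_cmult DERIV_diff has_real_derivative_Polygamma_shift) auto
  then show ?thesis
    by (simp add: lin_rate_def[abs_def] rate_h_def rate_v_def One_nat_def algebra_simps)
qed

text \<open>The derivative of the linear rate in l has the sign of
  \<open>right_ratio \<alpha> \<beta> l - a\<close>. Hence the equation that defines
  \<lambda>(\<xi>) is the critical point equation of the linear rates.\<close>

lemma lin_rate_derivative_eq:
  assumes "l > 0"
  shows "(1 - a) * (Polygamma 1 l - Polygamma 1 (\<alpha> + l)) - a * (Polygamma 1 (\<alpha> + l) - Polygamma 1 (\<alpha> + \<beta> + l))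
    = (Polygamma 1 l - Polygamma 1 (\<alpha> + \<beta> + l)) * (right_ratio \<alpha> \<beta> l - a)"
  using Trigamma_gap_pos[OF assms, of "\<alpha> + \<beta>"] pos
  by (simp add: right_ratio_def field_simps)

lemma lin_rate_increasing:
  assumes "0 < x" "x < y" "\<And>l. x < l \<Longrightarrow> l < y \<Longrightarrow> a < right_ratio \<alpha> \<beta> l"
  shows "lin_rate \<alpha> \<beta> a (1 - a) x < lin_rate \<alpha> \<beta> a (1 - a) y"
proof (rule DERIV_pos_imp_increasing_open[OF assms(2)])
  fix l assume l: "x < l" "l < y"
  then show "\<exists>z. (lin_rate \<alpha> \<beta> a (1 - a) has_real_derivative z) (at l) \<and> 0 < z"
    using assms Trigamma_gap_pos[of l "\<alpha> + \<beta>"] pos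
      has_real_derivative_lin_rate[of l a "1 - a"] lin_rate_derivative_eq[of l a]
    by (intro exI[of _ "(Polygamma 1 l - Polygamma 1 (\<alpha> + \<beta> + l)) * (right_ratio \<alpha> \<beta> l - a)"])
      (auto simp: mult_less_0_iff)
next
  show "continuous_on {x..y} (lin_rate \<alpha> \<beta> a (1 - a))"
    using assms by (intro continuous_at_imp_continuous_on ballI DERIV_isCont[OF has_real_derivative_lin_rate]) auto
qed

lemma lin_rate_decreasing:
  assumes "0 < x" "x < y" "\<And>l. x < l \<Longrightarrow> l < y \<Longrightarrow> right_ratio \<alpha> \<beta> l < a"
  shows "lin_rate \<alpha> \<beta> a (1 - a) y < lin_rate \<alpha> \<beta> a (1 - a) x"
proof (rule DERIV_neg_imp_decreasing_open[OF assms(2)])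
  fix l assume l: "x < l" "l < y"
  then show "\<exists>z. (lin_rate \<alpha> \<beta> a (1 - a) has_real_derivative z) (at l) \<and> z < 0"
    using assms Trigamma_gap_pos[of l "\<alpha> + \<beta>"] pos
      has_real_derivative_lin_rate[of l a "1 - a"] lin_rate_derivative_eq[of l a]
    by (intro exI[of _ "(Polygamma 1 l - Polygamma 1 (\<alpha> + \<beta> + l)) * (right_ratio \<alpha> \<beta> l - a)"])
      (auto simp: mult_less_0_iff)
next
  show "continuous_on {x..y} (lin_rate \<alpha> \<beta> a (1 - a))"
    using assms by (intro continuous_at_imp_continuous_on ballI DERIV_isCont[OF has_real_derivative_lin_rate]) auto
qed

lemma lin_rate_strict_max:
  assumes "l > 0" "l0 > 0" "right_ratio \<alpha> \<beta> l0 = a" "l \<noteq> l0"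
  shows "lin_rate \<alpha> \<beta> a (1 - a) l < lin_rate \<alpha> \<beta> a (1 - a) l0"
proof (cases "l < l0")
  case True
  then show ?thesis
    using assms by (intro lin_rate_increasing) (auto intro: right_ratio_strict_antimono)
next
  case False
  then show ?thesis
    using assms by (intro lin_rate_decreasing) (auto intro: right_ratio_strict_antimono)
qed

lemma rate_h_tendsto_at_top: "(rate_h \<alpha> \<beta> \<longlongrightarrow> 0) at_top"
proof (rule Lim_transform_eventually)
  have "((\<lambda>l. (Digamma ((\<alpha> + \<beta>) + l) - Digamma l) - (Digamma (\<alpha> + l) - Digamma l)) \<longlongrightarrow> 0 - 0) at_top"
    using pos by (intro tendsto_diff Digamma_diff_tendsto_0) auto
  then show "((\<lambda>l. (Digamma ((\<alpha> + \<beta>) + l) - Digamma l) - (Digamma (\<alpha> + l) - Digamma l)) \<longlongrightarrow> 0) at_top" by simp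
qed (auto simp: rate_h_def)

lemma rate_v_tendsto_at_top: "(rate_v \<alpha> \<longlongrightarrow> 0) at_top"
  using tendsto_minus[OF Digamma_diff_tendsto_0[OF pos(1)]] by (simp add: rate_v_def[abs_def])

lemma lin_rate_tendsto_at_top: "(lin_rate \<alpha> \<beta> a b \<longlongrightarrow> 0) at_top"
  unfolding lin_rate_def[abs_def]
  using tendsto_add[OF tendsto_mult_right_zero[OF rate_h_tendsto_at_top] tendsto_mult_right_zero[OF rate_v_tendsto_at_top]]
  by simp

lemma rate_h_tendsto_at_0: "(rate_h \<alpha> \<beta> \<longlongrightarrow> rate_h \<alpha> \<beta> 0) (at_right 0)"
  unfolding rate_h_def[abs_def] using pos
  by (auto intro!: tendsto_diff tendsto_Polygamma_shift_at_right_0)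

text \<open>Beyond its maximiser the linear rate decreases to the limit 0, so the maximum is
  positive.\<close>

lemma lin_rate_pos:
  assumes "l0 > 0" "right_ratio \<alpha> \<beta> l0 = a"
  shows "lin_rate \<alpha> \<beta> a (1 - a) l0 > 0"
proof -
  have "lin_rate \<alpha> \<beta> a (1 - a) (l0 + 1) \<ge> 0"
  proof (rule tendsto_upperbound[OF lin_rate_tendsto_at_top])
    show "\<forall>\<^sub>F l in at_top. lin_rate \<alpha> \<beta> a (1 - a) l \<le> lin_rate \<alpha> \<beta> a (1 - a) (l0 + 1)"
      using eventually_gt_at_top[of "l0 + 1"]
    proof eventually_elim
      case (elim l)
      then show ?case using assms right_ratio_strict_antimono[of l0]
        by (intro less_imp_le lin_rate_decreasing) auto
    qed
  qed simp
  with lin_rate_strict_max[of "l0 + 1" l0 a] assms show ?thesis by simp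
qed

text \<open>Here the right ratio exceeds a for every l, so the linear rate increases to its limit 0.
  This keeps the supporting lines built to the right of \<open>xi_star\<close> below 0 on the other
  side.\<close>

lemma lin_rate_neg:
  assumes "l > 0" "a \<le> \<alpha> / (\<alpha> + \<beta>)"
  shows "lin_rate \<alpha> \<beta> a (1 - a) l < 0"
proof -
  have inc: "lin_rate \<alpha> \<beta> a (1 - a) x < lin_rate \<alpha> \<beta> a (1 - a) y" if "0 < x" "x < y" for x y
    using that right_ratio_gt assms by (intro lin_rate_increasing) (auto intro: le_less_trans)
  have "lin_rate \<alpha> \<beta> a (1 - a) (l + 1) \<le> 0"
  proof (rule tendsto_lowerbound[OF lin_rate_tendsto_at_top])
    show "\<forall>\<^sub>F x in at_top. lin_rate \<alpha> \<beta> a (1 - a) (l + 1) \<le> lin_rate \<alpha> \<beta> a (1 - a) x"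
      using eventually_gt_at_top[of "l + 1"]
      by eventually_elim (use assms inc in \<open>auto intro: less_imp_le\<close>)
  qed simp
  with inc[of l "l + 1"] assms show ?thesis by simp
qed

lemma rate_h_antimono:
  assumes "0 \<le> x" "x < y"
  shows "rate_h \<alpha> \<beta> y < rate_h \<alpha> \<beta> x"
proof (rule DERIV_neg_imp_decreasing[OF assms(2)])
  fix l assume l: "x \<le> l" "l \<le> y"
  have "(rate_h \<alpha> \<beta> has_real_derivative Polygamma (Suc 0) (\<alpha> + \<beta> + l) - Polygamma (Suc 0) (\<alpha> + l)) (at l)"
    unfolding rate_h_def[abs_def] using l assms pos
    by (intro DERIV_diff has_real_derivative_Polygamma_shift) auto
  moreover have "Polygamma (Suc 0) (\<alpha> + \<beta> + l) - Polygamma (Suc 0) (\<alpha> + l) < 0"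
    using Trigamma_gap_pos[of "\<alpha> + l" \<beta>] l assms pos by (simp add: add_ac One_nat_def)
  ultimately show "\<exists>z. (rate_h \<alpha> \<beta> has_real_derivative z) (at l) \<and> z < 0" by blast
qed

lemma rate_h_pos:
  assumes "0 \<le> l"
  shows "rate_h \<alpha> \<beta> l > 0"
  using Digamma_diff_bounds(1)[of "\<alpha> + l" \<beta>] assms pos by (simp add: rate_h_def add_ac)

lemma rate_v_filterlim_at_0: "filterlim (rate_v \<alpha>) at_bot (at_right 0)"
proof -
  have "filterlim (\<lambda>l. - rate_v \<alpha> l) at_top (at_right 0)"
  proof (rule filterlim_at_top_mono)
    \<comment> \<open>The pole at 0 is split off by Digamma l = Digamma (1 + l) - 1 / l; the
      remaining difference has a finite limit.\<close>
    have "((\<lambda>l. Digamma (\<alpha> + l) - Digamma (1 + l)) \<longlongrightarrow> Digamma \<alpha> - Digamma 1) (at_right 0)"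
      using pos by (intro tendsto_diff tendsto_Polygamma_shift_at_right_0) auto
    moreover have "filterlim (\<lambda>l::real. 1 / l) at_top (at_right 0)" by real_asymp
    ultimately show "filterlim (\<lambda>l. (Digamma (\<alpha> + l) - Digamma (1 + l)) + 1 / l) at_top (at_right 0)"
      by (rule filterlim_tendsto_add_at_top)
    show "\<forall>\<^sub>F l in at_right 0. (Digamma (\<alpha> + l) - Digamma (1 + l)) + 1 / l \<le> - rate_v \<alpha> l"
      unfolding eventually_at_right_field
    proof (intro exI[of _ 1] conjI allI impI)
      fix l :: real assume "0 < l" "l < 1"
      then show "(Digamma (\<alpha> + l) - Digamma (1 + l)) + 1 / l \<le> - rate_v \<alpha> l"
        using Digamma_plus1[of l] by (simp add: rate_v_def add.commute)
    qed simp
  qed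
  then show ?thesis by (simp add: filterlim_uminus_at_top)
qed

lemma rate_v_surj:
  assumes "y < 0"
  obtains l where "l > 0" "rate_v \<alpha> l = y"
proof -
  have "\<forall>\<^sub>F l in at_right 0. rate_v \<alpha> l < y"
    using rate_v_filterlim_at_0 by (simp add: filterlim_at_bot_dense)
  then obtain b where b: "b > 0" "\<And>l. 0 < l \<Longrightarrow> l < b \<Longrightarrow> rate_v \<alpha> l < y"
    unfolding eventually_at_right_field by auto
  have "\<forall>\<^sub>F l in at_top. rate_v \<alpha> l > y \<and> l > b"
    by (intro eventually_conj order_tendstoD(1)[OF rate_v_tendsto_at_top assms(1)] eventually_gt_at_top)
  then obtain c where c: "rate_v \<alpha> c > y" "c > b"
    using eventually_happens[OF \<open>eventually _ at_top\<close>] by auto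
  have cont: "isCont (rate_v \<alpha>) l" if "l > 0" for l
    unfolding rate_v_def[abs_def]
    using isCont_Polygamma_shift[of 0 l 0] isCont_Polygamma_shift[of \<alpha> l 0] that pos
    by (intro continuous_diff) auto
  have "\<exists>x\<ge>b/2. x \<le> c \<and> rate_v \<alpha> x = y"
    using b b(2)[of "b/2"] c by (intro IVT allI impI cont less_imp_le[of _ y]) auto
  then obtain x where "b/2 \<le> x" "rate_v \<alpha> x = y" by auto
  then show ?thesis using that[of x] b by auto
qed

section \<open>Comparison with the averaged rate function\<close>

lemma exp_Digamma_strict_convex:
  assumes "l > 0"
  shows "(\<alpha> + \<beta>) * exp (Digamma (\<alpha> + l)) < \<alpha> * exp (Digamma (\<alpha> + \<beta> + l)) + \<beta> * exp (Digamma l)"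
proof -
  let ?E = "\<lambda>x::real. exp (Digamma x)" and ?D = "\<lambda>x::real. exp (Digamma x) * Polygamma 1 x"
  have dE: "(?E has_real_derivative ?D x) (at x)" if "x > 0" for x
    using has_real_derivative_Polygamma_pos[of x 0] that by (auto intro!: derivative_eq_intros simp: One_nat_def)
  have D: "?D x < ?D y" if "0 < x" "x < y" for x y
  proof (rule DERIV_pos_imp_increasing[OF that(2)])
    fix t assume "x \<le> t" "t \<le> y"
    then have t: "t > 0" using that by simp
    have "(?D has_real_derivative ?D t * Polygamma 1 t + Polygamma 2 t * ?E t) (at t)"
      using DERIV_mult[OF dE[OF t] has_real_derivative_Polygamma_pos[OF t, of 1]] by (simp add: numeral_2_eq_2 One_nat_def)
    moreover have "?D t * Polygamma 1 t + Polygamma 2 t * ?E t = ?E t * ((Polygamma 1 t)\<^sup>2 + Polygamma 2 t)"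
      by (simp add: power2_eq_square algebra_simps)
    ultimately show "\<exists>z. (?D has_real_derivative z) (at t) \<and> 0 < z"
      using Trigamma_square_gt[OF t] by auto
  qed
  \<comment> \<open>The point \<alpha> + l is the average of \<alpha> + \<beta> + l and l with
    weights proportional to \<alpha> and \<beta>. Mean values of the increasing derivative on its
    two sides give the chord inequality.\<close>
  have "\<exists>s. \<alpha> + l < s \<and> s < \<alpha> + \<beta> + l \<and> ?E (\<alpha> + \<beta> + l) - ?E (\<alpha> + l) = (\<alpha> + \<beta> + l - (\<alpha> + l)) * ?D s"
    using assms pos by (intro MVT2 dE) auto
  then obtain s where s: "\<alpha> + l < s" "?E (\<alpha> + \<beta> + l) - ?E (\<alpha> + l) = \<beta> * ?D s" by auto
  have "\<exists>t. l < t \<and> t < \<alpha> + l \<and> ?E (\<alpha> + l) - ?E l = (\<alpha> + l - l) * ?D t"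
    using assms pos by (intro MVT2 dE) auto
  then obtain t where t: "l < t" "t < \<alpha> + l" "?E (\<alpha> + l) - ?E l = \<alpha> * ?D t" by auto
  have "\<alpha> * \<beta> * ?D t < \<alpha> * \<beta> * ?D s"
    using D[of t s] s t assms pos by (intro mult_strict_left_mono) auto
  then have "\<beta> * (?E (\<alpha> + l) - ?E l) < \<alpha> * (?E (\<alpha> + \<beta> + l) - ?E (\<alpha> + l))"
    unfolding s t by (simp add: mult_ac)
  then show ?thesis by (simp add: algebra_simps)
qed

text \<open>
  Since \<open>I\<^sub>a(\<xi>)\<close> is the maximum of \<open>\<xi>\<^sub>1 u + \<xi>\<^sub>2 v\<close> subject to \<open>\<alpha> e\<^sup>u + \<beta> e\<^sup>v = \<alpha> + \<beta>\<close>, this is what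
  separates the two rate functions.
\<close>

lemma exp_rates_gt:
  assumes "l > 0"
  shows "\<alpha> + \<beta> < \<alpha> * exp (rate_h \<alpha> \<beta> l) + \<beta> * exp (rate_v \<alpha> l)"
proof -
  have "\<alpha> * exp (rate_h \<alpha> \<beta> l) + \<beta> * exp (rate_v \<alpha> l) =
    (\<alpha> * exp (Digamma (\<alpha> + \<beta> + l)) + \<beta> * exp (Digamma l)) / exp (Digamma (\<alpha> + l))"
    by (simp add: rate_h_def rate_v_def exp_diff add_divide_distrib)
  with exp_Digamma_strict_convex[OF assms] show ?thesis by (simp add: pos_less_divide_eq)
qed

text \<open>The parameter need not be the maximiser of the linear rate. It is chosen so that the
  vertical rate equals the vertical logarithm in the averaged rate; \<open>exp_rates_gt\<close> then
  forces the horizontal rate above the horizontal logarithm.\<close>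

lemma averaged_less_lin_rate:
  assumes "\<alpha> / (\<alpha> + \<beta>) < a" "a < 1"
  obtains l where "l > 0" "averaged_rate \<alpha> \<beta> (a, 1 - a) < lin_rate \<alpha> \<beta> a (1 - a) l"
proof -
  define q where "q = (1 - a) / (\<beta> / (\<alpha> + \<beta>))"
  have "(\<alpha> + \<beta>) * a < (\<alpha> + \<beta>) * 1" using assms pos by (intro mult_strict_left_mono) auto
  then have "0 < q" "q < 1" unfolding q_def using assms pos by (simp_all add: field_simps)
  then obtain l where l: "l > 0" "rate_v \<alpha> l = ln q" using rate_v_surj[of "ln q"] by auto
  have "\<beta> * exp (rate_v \<alpha> l) = (1 - a) * (\<alpha> + \<beta>)"
    unfolding l using \<open>q > 0\<close> pos by (simp add: q_def)
  with exp_rates_gt[OF l(1)] have "a * (\<alpha> + \<beta>) < \<alpha> * exp (rate_h \<alpha> \<beta> l)" by (simp add: algebra_simps)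
  then have "a / (\<alpha> / (\<alpha> + \<beta>)) < exp (rate_h \<alpha> \<beta> l)" using pos by (simp add: field_simps)
  moreover have a: "a > 0" using assms pos by (intro less_trans[OF _ assms(1)]) auto
  ultimately have "ln (a / (\<alpha> / (\<alpha> + \<beta>))) < ln (exp (rate_h \<alpha> \<beta> l))"
    using pos by (intro ln_less_cancel_iff[THEN iffD2]) auto
  then have "ln (a / (\<alpha> / (\<alpha> + \<beta>))) < rate_h \<alpha> \<beta> l" by simp
  then have "averaged_rate \<alpha> \<beta> (a, 1 - a) < lin_rate \<alpha> \<beta> a (1 - a) l"
    unfolding averaged_rate_def lin_rate_def l xi_star_def q_def using a by simp
  with l that show ?thesis by blast
qed

text \<open>At e1 the averaged rate is ln (\<alpha> + \<beta>) - ln \<alpha>, and Digamma - ln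
  increases because Trigamma exceeds 1 / x.\<close>

lemma averaged_less_rate_h: "averaged_rate \<alpha> \<beta> (1, 0) < rate_h \<alpha> \<beta> 0"
proof -
  have "Digamma \<alpha> - ln \<alpha> < Digamma (\<alpha> + \<beta>) - ln (\<alpha> + \<beta>)"
  proof (rule DERIV_pos_imp_increasing[of \<alpha> "\<alpha> + \<beta>" "\<lambda>x. Digamma x - ln x"])
    fix x assume "\<alpha> \<le> x"
    then have x: "x > 0" using pos by simp
    have "((\<lambda>x. Digamma x - ln x) has_real_derivative Polygamma (Suc 0) x - 1 / x) (at x)"
      using has_real_derivative_Polygamma_pos[OF x, of 0] x by (auto intro!: derivative_eq_intros)
    moreover have "Polygamma (Suc 0) x - 1 / x > 0"
      using Trigamma_gt_inverse[OF x] by (simp add: One_nat_def)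
    ultimately show "\<exists>z. ((\<lambda>x. Digamma x - ln x) has_real_derivative z) (at x) \<and> 0 < z" by blast
  qed (use pos in simp)
  moreover have "averaged_rate \<alpha> \<beta> (1, 0) = ln (\<alpha> + \<beta>) - ln \<alpha>"
    using pos by (simp add: averaged_rate_def xi_star_def ln_div)
  ultimately show ?thesis by (simp add: rate_h_def)
qed

end

end

section \<open>The parameter and the rate function\<close>

lemma extend_by_limits_right_ratio:
  assumes "\<alpha> > 0" "\<beta> > 0"
  shows "extend_by_limits (right_ratio \<alpha> \<beta>) 0 = 1"
    "extend_by_limits (right_ratio \<alpha> \<beta>) \<infinity> = \<alpha> / (\<alpha> + \<beta>)"
    "l \<noteq> 0 \<Longrightarrow> l \<noteq> \<infinity> \<Longrightarrow> extend_by_limits (right_ratio \<alpha> \<beta>) l = right_ratio \<alpha> \<beta> (enn2real l)"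
  using tendsto_Lim[OF _ right_ratio_tendsto_at_0[OF assms]]
    tendsto_Lim[OF _ right_ratio_tendsto_at_top[OF assms]]
  by (auto simp: extend_by_limits_def)

lemma left_ratio_eq: "left_ratio \<alpha> \<beta> l = 1 - right_ratio \<beta> \<alpha> l"
  by (simp add: left_ratio_def right_ratio_def add.commute)

lemma extend_by_limits_left_ratio:
  assumes "\<alpha> > 0" "\<beta> > 0"
  shows "extend_by_limits (left_ratio \<alpha> \<beta>) l = 1 - extend_by_limits (right_ratio \<beta> \<alpha>) l"
proof -
  have eq: "left_ratio \<alpha> \<beta> = (\<lambda>l. 1 - right_ratio \<beta> \<alpha> l)"
    by (simp add: fun_eq_iff left_ratio_eq)
  have "Lim F (left_ratio \<alpha> \<beta>) = 1 - Lim F (right_ratio \<beta> \<alpha>)"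
    if "(right_ratio \<beta> \<alpha> \<longlongrightarrow> c) F" "F \<noteq> bot" for F and c :: real
    using tendsto_Lim[OF that(2,1)] tendsto_Lim[OF that(2) tendsto_diff[OF tendsto_const that(1)], of 1]
    by (simp add: eq)
  from this[OF right_ratio_tendsto_at_0[OF assms(2,1)]] this[OF right_ratio_tendsto_at_top[OF assms(2,1)]]
  show ?thesis by (auto simp: extend_by_limits_def left_ratio_eq)
qed

lemma lambda_param_right:
  assumes "\<alpha> / (\<alpha> + \<beta>) < a"
  shows "lambda_param \<alpha> \<beta> (a, b) = (THE l. a = extend_by_limits (right_ratio \<alpha> \<beta>) l)"
  using assms by (simp add: lambda_param_def xi_star_def)

text \<open>Exchanging the coordinates turns the left equation into the right one with \<alpha> and
  \<beta> swapped. The second components b and b' are arbitrary because \<open>lambda_param\<close>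
  reads only the first one.\<close>

lemma lambda_real_left:
  assumes "\<alpha> > 0" "\<beta> > 0" "a < \<alpha> / (\<alpha> + \<beta>)"
  shows "lambda_real \<alpha> \<beta> (a, b) = lambda_real \<beta> \<alpha> (1 - a, b')"
proof -
  have "\<beta> / (\<beta> + \<alpha>) < 1 - a"
    using assms by (simp add: field_simps)
  then have "lambda_param \<beta> \<alpha> (1 - a, b') = (THE l. 1 - a = extend_by_limits (right_ratio \<beta> \<alpha>) l)"
    by (rule lambda_param_right)
  moreover have "lambda_param \<alpha> \<beta> (a, b) = (THE l. a = extend_by_limits (left_ratio \<alpha> \<beta>) l)"
    using assms by (simp add: lambda_param_def xi_star_def)
  moreover have "(a = 1 - e) \<longleftrightarrow> (1 - a = e)" for e :: real by auto
  ultimately show ?thesis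
    by (simp add: lambda_real_def extend_by_limits_left_ratio[OF assms(1,2)])
qed

lemma lambda_real_right:
  assumes "\<alpha> > 0" "\<beta> > 0" "l > 0" "right_ratio \<alpha> \<beta> l = a"
  shows "lambda_real \<alpha> \<beta> (a, b) = l"
proof -
  have a: "\<alpha> / (\<alpha> + \<beta>) < a" "a < 1"
    using right_ratio_gt[OF assms(1-3)] right_ratio_less_1[OF assms(1-3)] assms(4) by auto
  have "(THE l. a = extend_by_limits (right_ratio \<alpha> \<beta>) l) = ennreal l"
  proof (rule the_equality)
    show "a = extend_by_limits (right_ratio \<alpha> \<beta>) (ennreal l)"
      using assms by (simp add: extend_by_limits_right_ratio)
  next
    fix k assume k: "a = extend_by_limits (right_ratio \<alpha> \<beta>) k"
    then have k0: "k \<noteq> 0" "k \<noteq> \<infinity>" using a extend_by_limits_right_ratio[OF assms(1,2)] by auto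
    then have "enn2real k > 0" by (simp add: enn2real_positive_iff top.not_eq_extremum zero_less_iff_neq_zero)
    then have "enn2real k = l"
      using right_ratio_inj[OF assms(1,2), of "enn2real k" l] k k0 assms extend_by_limits_right_ratio(3)[OF assms(1,2) k0] by simp
    then show "k = ennreal l" using k0 ennreal_enn2real[of k] by (simp add: top.not_eq_extremum)
  qed
  then show ?thesis using assms by (simp add: lambda_real_def lambda_param_right[OF a(1)])
qed

lemma lambda_real_e1:
  assumes "\<alpha> > 0" "\<beta> > 0"
  shows "lambda_real \<alpha> \<beta> (1, b) = 0"
proof -
  have a: "\<alpha> / (\<alpha> + \<beta>) < 1" using assms by simp
  have "(THE l. 1 = extend_by_limits (right_ratio \<alpha> \<beta>) l) = 0"
  proof (rule the_equality)
    show "1 = extend_by_limits (right_ratio \<alpha> \<beta>) 0"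
      using assms by (simp add: extend_by_limits_right_ratio)
  next
    fix k assume k: "1 = extend_by_limits (right_ratio \<alpha> \<beta>) k"
    show "k = 0"
    proof (rule ccontr)
      assume k0: "k \<noteq> 0"
      moreover have k1: "k \<noteq> \<infinity>" using k a extend_by_limits_right_ratio[OF assms] by auto
      ultimately have "enn2real k > 0" by (simp add: enn2real_positive_iff top.not_eq_extremum zero_less_iff_neq_zero)
      then show False
        using right_ratio_less_1[OF assms, of "enn2real k"] k extend_by_limits_right_ratio(3)[OF assms k0 k1] by simp
    qed
  qed
  then show ?thesis by (simp add: lambda_real_def lambda_param_right[OF a])
qed

text \<open>The claimed formula to the right of \<open>xi_star\<close>. The formula on the left is
  this one with \<alpha> and \<beta> and the two coordinates exchanged.\<close>

definition right_rate :: "real \<Rightarrow> real \<Rightarrow> real \<Rightarrow> real" where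
  "right_rate \<alpha> \<beta> a = (let l = lambda_real \<alpha> \<beta> (a, 1 - a) in
     a * Digamma (\<alpha> + \<beta> + l) + (1 - a) * Digamma l - Digamma (\<alpha> + l))"

lemma right_rate_eq_lin_rate:
  assumes "\<alpha> > 0" "\<beta> > 0" "l > 0" "right_ratio \<alpha> \<beta> l = a"
  shows "right_rate \<alpha> \<beta> a = lin_rate \<alpha> \<beta> a (1 - a) l"
  by (simp add: right_rate_def lambda_real_right[OF assms] lin_rate_def rate_h_def rate_v_def Let_def algebra_simps)

lemma right_rate_e1:
  assumes "\<alpha> > 0" "\<beta> > 0"
  shows "right_rate \<alpha> \<beta> 1 = rate_h \<alpha> \<beta> 0"
  by (simp add: right_rate_def lambda_real_e1[OF assms] rate_h_def)

text \<open>For t < 1 this is strictness of the maximum over l. At t = 1 the value is the limit l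
  \<rightarrow> 0 of a strictly decreasing function of l and is not attained.\<close>

lemma lin_rate_less_right_rate:
  assumes "\<alpha> > 0" "\<beta> > 0" "\<alpha> / (\<alpha> + \<beta>) < t" "t \<le> 1" "l > 0" "right_ratio \<alpha> \<beta> l \<noteq> t"
  shows "lin_rate \<alpha> \<beta> t (1 - t) l < right_rate \<alpha> \<beta> t"
proof (cases "t = 1")
  case True
  then show ?thesis
    using rate_h_antimono[OF assms(1,2), of 0 l] assms by (simp add: right_rate_e1 lin_rate_def)
next
  case False
  obtain k where k: "k > 0" "right_ratio \<alpha> \<beta> k = t"
    using right_ratio_surj[OF assms(1,2), of t] assms False by auto
  then show ?thesis
    using lin_rate_strict_max[OF assms(1,2,5) k] assms right_rate_eq_lin_rate[OF assms(1,2) k] by auto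
qed

lemma right_rate_pos:
  assumes "\<alpha> > 0" "\<beta> > 0" "\<alpha> / (\<alpha> + \<beta>) < t" "t \<le> 1"
  shows "right_rate \<alpha> \<beta> t > 0"
proof (cases "t = 1")
  case True
  then show ?thesis using rate_h_pos[OF assms(1,2), of 0] assms by (simp add: right_rate_e1)
next
  case False
  then obtain k where k: "k > 0" "right_ratio \<alpha> \<beta> k = t"
    using right_ratio_surj[OF assms(1,2), of t] assms by auto
  then show ?thesis
    using lin_rate_pos[OF assms(1,2) k] right_rate_eq_lin_rate[OF assms(1,2) k] by simp
qed

lemma averaged_less_right_rate:
  assumes "\<alpha> > 0" "\<beta> > 0" "\<alpha> / (\<alpha> + \<beta>) < t" "t \<le> 1"
  shows "averaged_rate \<alpha> \<beta> (t, 1 - t) < right_rate \<alpha> \<beta> t"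
proof (cases "t = 1")
  case True
  then show ?thesis using averaged_less_rate_h[OF assms(1,2)] assms by (simp add: right_rate_e1)
next
  case False
  then obtain l where l: "l > 0" "averaged_rate \<alpha> \<beta> (t, 1 - t) < lin_rate \<alpha> \<beta> t (1 - t) l"
    using averaged_less_lin_rate[OF assms(1-3)] assms by auto
  show ?thesis
  proof (cases "right_ratio \<alpha> \<beta> l = t")
    case True then show ?thesis using l right_rate_eq_lin_rate[OF assms(1,2) l(1) True] by simp
  next
    case False then show ?thesis using l lin_rate_less_right_rate[OF assms l(1) False] by simp
  qed
qed

lemma averaged_rate_swap: "averaged_rate \<alpha> \<beta> (a, b) = averaged_rate \<beta> \<alpha> (b, a)"
  by (simp add: averaged_rate_def xi_star_def add.commute)

text \<open>A line that touches the graph only at z and lies below it elsewhere keeps F z strictly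
  under every chord across z. Interior points suffice, since a proper combination of two distinct
  points of [0, 1] is interior.\<close>

lemma strictly_convex_on_supporting_lines:
  assumes "\<And>x. 0 < x \<Longrightarrow> x < 1 \<Longrightarrow> \<exists>p q. F x = p * x + q \<and> (\<forall>t\<in>{0..1}. t \<noteq> x \<longrightarrow> p * t + q < F t)"
  shows "strictly_convex_on {0..1::real} F"
  unfolding strictly_convex_on_def
proof (intro conjI ballI allI impI)
  fix x y u :: real assume A: "x \<in> {0..1}" "y \<in> {0..1}" "x \<noteq> y" "0 < u \<and> u < 1"
  define z where "z = (1 - u) * x + u * y"
  have zx: "z - x = u * (y - x)" and zy: "y - z = (1 - u) * (y - x)"
    by (simp_all add: z_def algebra_simps)
  have neq: "x \<noteq> z" "y \<noteq> z" using zx zy A by auto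
  have "0 < z \<and> z < 1"
  proof (cases "x < y")
    case True
    then have "z - x > 0" "y - z > 0" unfolding zx zy using A by simp_all
    then have "x < z" "z < y" by simp_all
    with A show ?thesis by auto
  next
    case False
    then have "z - x < 0" "y - z < 0" unfolding zx zy using A by (simp_all add: mult_less_0_iff)
    then have "y < z" "z < x" by simp_all
    with A show ?thesis by auto
  qed
  then obtain p q where pq: "F z = p * z + q" "\<And>t. t \<in> {0..1} \<Longrightarrow> t \<noteq> z \<Longrightarrow> p * t + q < F t"
    using assms[of z] by auto
  have "F z = (1 - u) * (p * x + q) + u * (p * y + q)"
    using pq(1) by (simp add: z_def algebra_simps)
  also have "\<dots> < (1 - u) * F x + u * F y"
    using pq(2)[of x] pq(2)[of y] neq A by (intro add_strict_mono mult_strict_left_mono) auto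
  finally show "F ((1 - u) * x + u * y) < (1 - u) * F x + u * F y" by (simp add: z_def)
qed simp

text \<open>At the parameter l belonging to x, \<open>lin_rate\<close> is affine in t and touches F
  at x. To the right of \<open>xi_star\<close> it stays below F by strict maximality, to the left
  because it is negative while F is nonnegative. At \<open>xi_star\<close> the zero line
  serves.\<close>

lemma rate_function_supporting_line:
  fixes F :: "real \<Rightarrow> real"
  assumes "\<alpha> > 0" "\<beta> > 0"
    and star: "F (\<alpha> / (\<alpha> + \<beta>)) = 0"
    and right: "\<And>t. \<alpha> / (\<alpha> + \<beta>) < t \<Longrightarrow> t \<le> 1 \<Longrightarrow> F t = right_rate \<alpha> \<beta> t"
    and left: "\<And>t. 0 \<le> t \<Longrightarrow> t < \<alpha> / (\<alpha> + \<beta>) \<Longrightarrow> F t = right_rate \<beta> \<alpha> (1 - t)"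
    and x: "\<alpha> / (\<alpha> + \<beta>) \<le> x" "x < 1"
  shows "\<exists>p q. F x = p * x + q \<and> (\<forall>t\<in>{0..1}. t \<noteq> x \<longrightarrow> p * t + q < F t)"
proof -
  have left_pos: "F t > 0" if "0 \<le> t" "t < \<alpha> / (\<alpha> + \<beta>)" for t
    unfolding left[OF that] using that assms(1,2)
    by (intro right_rate_pos) (auto simp: field_simps)
  show ?thesis
  proof (cases "x = \<alpha> / (\<alpha> + \<beta>)")
    case True
    then show ?thesis using star left_pos right right_rate_pos[OF assms(1,2)]
      by (intro exI[of _ 0] exI[of _ 0]) (auto simp: neq_iff)
  next
    case False
    then obtain l where l: "l > 0" "right_ratio \<alpha> \<beta> l = x"
      using right_ratio_surj[OF assms(1,2), of x] x by auto
    define p where "p = rate_h \<alpha> \<beta> l - rate_v \<alpha> l"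
    define q where "q = rate_v \<alpha> l"
    have pq: "p * t + q = lin_rate \<alpha> \<beta> t (1 - t) l" for t
      by (simp add: p_def q_def lin_rate_def algebra_simps)
    have "p * t + q < F t" if "t \<in> {0..1}" "t \<noteq> x" for t
    proof (cases "t \<le> \<alpha> / (\<alpha> + \<beta>)")
      case True
      then have "F t \<ge> 0" using star left_pos[of t] that by (cases "t = \<alpha> / (\<alpha> + \<beta>)") auto
      then show ?thesis unfolding pq using lin_rate_neg[OF assms(1,2) l(1) True] by simp
    next
      case False
      then show ?thesis unfolding pq using right[of t] lin_rate_less_right_rate[OF assms(1,2), of t l] l that by auto
    qed
    moreover have "F x = p * x + q"
      unfolding pq using right[of x] right_rate_eq_lin_rate[OF assms(1,2) l] x False by simp
    ultimately show ?thesis by blast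
  qed
qed

lemma rate_function_strictly_convex:
  fixes F :: "real \<Rightarrow> real"
  assumes "\<alpha> > 0" "\<beta> > 0"
    and star: "F (\<alpha> / (\<alpha> + \<beta>)) = 0"
    and right: "\<And>t. \<alpha> / (\<alpha> + \<beta>) < t \<Longrightarrow> t \<le> 1 \<Longrightarrow> F t = right_rate \<alpha> \<beta> t"
    and left: "\<And>t. 0 \<le> t \<Longrightarrow> t < \<alpha> / (\<alpha> + \<beta>) \<Longrightarrow> F t = right_rate \<beta> \<alpha> (1 - t)"
  shows "strictly_convex_on {0..1} F"
proof (rule strictly_convex_on_supporting_lines)
  fix x :: real assume x: "0 < x" "x < 1"
  have sw: "1 - \<beta> / (\<beta> + \<alpha>) = \<alpha> / (\<alpha> + \<beta>)" using assms by (simp add: field_simps)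
  show "\<exists>p q. F x = p * x + q \<and> (\<forall>t\<in>{0..1}. t \<noteq> x \<longrightarrow> p * t + q < F t)"
  proof (cases "\<alpha> / (\<alpha> + \<beta>) \<le> x")
    case True
    then show ?thesis using x by (intro rate_function_supporting_line[OF assms]) auto
  next
    case False
    \<comment> \<open>The reflection of [0, 1] exchanges \<alpha> and \<beta> and leads back to a
      point to the right of \<open>xi_star\<close>.\<close>
    have "\<exists>p q. F (1 - (1 - x)) = p * (1 - x) + q \<and> (\<forall>t\<in>{0..1}. t \<noteq> 1 - x \<longrightarrow> p * t + q < F (1 - t))"
      using False x sw star right left
      by (intro rate_function_supporting_line[where F = "\<lambda>t. F (1 - t)", OF assms(2,1)]) auto
    then obtain p q where pq: "F x = p * (1 - x) + q"
       "\<And>t. t \<in> {0..1} \<Longrightarrow> t \<noteq> 1 - x \<Longrightarrow> p * t + q < F (1 - t)" by auto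
    show ?thesis
    proof (rule exI[of _ "-p"], rule exI[of _ "p + q"], intro conjI ballI impI)
      show "F x = - p * x + (p + q)" using pq(1) by (simp add: algebra_simps)
      fix t assume "t \<in> {0..1}" "t \<noteq> x"
      then show "- p * t + (p + q) < F t" using pq(2)[of "1 - t"] by (auto simp: algebra_simps)
    qed
  qed
qed

section \<open>Beta distributions\<close>

definition beta_measure :: "real \<Rightarrow> real \<Rightarrow> real measure" where
  "beta_measure a b = density lborel (\<lambda>t. ennreal (beta_density a b t))"

lemma sets_beta_measure [simp, measurable_cong]: "sets (beta_measure a b) = sets borel"
  by (simp add: beta_measure_def)

lemma space_beta_measure [simp]: "space (beta_measure a b) = UNIV"
  by (simp add: beta_measure_def)

lemma beta_density_measurable [measurable]: "beta_density a b \<in> borel_measurable borel"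
  unfolding beta_density_def[abs_def] by measurable

lemma Beta_pos: "a > 0 \<Longrightarrow> b > 0 \<Longrightarrow> Beta a b > (0::real)"
  by (simp add: Beta_def Gamma_real_pos)

lemma nn_integral_beta_measure:
  assumes [measurable]: "f \<in> borel_measurable borel"
  shows "(\<integral>\<^sup>+x. f x \<partial>beta_measure a b) = (\<integral>\<^sup>+x. ennreal (beta_density a b x) * f x \<partial>lborel)"
  unfolding beta_measure_def by (subst nn_integral_density) auto

lemma nn_integral_Beta:
  assumes "a > 0" "b > (0::real)"
  shows "(\<integral>\<^sup>+t. ennreal (indicator {0<..<1} t * (t powr (a - 1) * (1 - t) powr (b - 1))) \<partial>lborel) = ennreal (Beta a b)"
proof -
  have "((\<lambda>t. t powr (a - 1) * (1 - t) powr (b - 1)) has_integral Beta a b) {0<..<1}"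
    using has_integral_Beta_real[OF assms] by (simp add: has_integral_Icc_iff_Ioo)
  from nn_integral_has_integral_lebesgue[OF _ this] show ?thesis
    by simp
qed

lemma beta_measure_moment:
  assumes "a > 0" "b > (0::real)" "a + s > 0" "b + u > 0"
  shows "(\<integral>\<^sup>+t. ennreal (t powr s * (1 - t) powr u) \<partial>beta_measure a b) = ennreal (Beta (a + s) (b + u) / Beta a b)"
proof -
  have B: "Beta a b > 0" using assms by (simp add: Beta_pos)
  have "(\<integral>\<^sup>+t. ennreal (t powr s * (1 - t) powr u) \<partial>beta_measure a b)
     = (\<integral>\<^sup>+t. ennreal (1 / Beta a b) * ennreal (indicator {0<..<1} t * (t powr (a + s - 1) * (1 - t) powr (b + u - 1))) \<partial>lborel)"
    by (subst nn_integral_beta_measure, measurable, intro nn_integral_cong)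
      (use B in \<open>auto simp: beta_density_def indicator_def ennreal_mult[symmetric] powr_diff powr_add field_simps\<close>)
  also have "\<dots> = ennreal (1 / Beta a b) * ennreal (Beta (a + s) (b + u))"
    by (subst nn_integral_cmult, measurable, subst nn_integral_Beta) (use assms in auto)
  also have "\<dots> = ennreal (Beta (a + s) (b + u) / Beta a b)"
    using B by (subst ennreal_mult'[symmetric]) (auto simp: field_simps)
  finally show ?thesis .
qed

lemma prob_space_beta_measure:
  assumes "a > 0" "b > (0::real)"
  shows "prob_space (beta_measure a b)"
proof (rule prob_spaceI)
  have "emeasure (beta_measure a b) (space (beta_measure a b)) = (\<integral>\<^sup>+t. 1 \<partial>beta_measure a b)" by simp
  also have "\<dots> = (\<integral>\<^sup>+t. ennreal (beta_density a b t) \<partial>lborel)"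
    by (subst nn_integral_beta_measure) auto
  also have "\<dots> = (\<integral>\<^sup>+t. ennreal (1 / Beta a b) * ennreal (indicator {0<..<1} t * (t powr (a - 1) * (1 - t) powr (b - 1))) \<partial>lborel)"
    by (intro nn_integral_cong)
      (use Beta_pos[OF assms] in \<open>auto simp: beta_density_def indicator_def ennreal_mult[symmetric] field_simps\<close>)
  also have "\<dots> = ennreal (1 / Beta a b) * ennreal (Beta a b)"
    by (subst nn_integral_cmult, measurable, subst nn_integral_Beta) (use assms in auto)
  also have "\<dots> = 1"
    using Beta_pos[OF assms] by (subst ennreal_mult'[symmetric]) auto
  finally show "emeasure (beta_measure a b) (space (beta_measure a b)) = 1" .
qed

lemma AE_beta_measure: "AE t in beta_measure a b. 0 < t \<and> t < 1"
  unfolding beta_measure_def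
  by (subst AE_density) (auto simp: beta_density_def indicator_def)

text \<open>Both sides integrate over the Dirichlet law with parameters (l, a, b) of the triple (r,
  i - r, 1 - i). On the left i is drawn first and r = i x; on the right r is drawn first and i = r +
  (1 - r) w. After these substitutions the two integrals differ only in the order of
  integration.\<close>

lemma dirichlet_decomposition:
  fixes g :: "real \<Rightarrow> real \<Rightarrow> ennreal"
  assumes l: "l > 0" and a: "a > 0" and b: "b > 0"
    and g[measurable]: "(\<lambda>(i, x). g i x) \<in> borel_measurable (borel \<Otimes>\<^sub>M borel)"
  shows "(\<integral>\<^sup>+i. \<integral>\<^sup>+x. g i x \<partial>beta_measure l a \<partial>beta_measure (a + l) b) =
         (\<integral>\<^sup>+r. \<integral>\<^sup>+w. g (w + (1 - w) * r) (r / (w + (1 - w) * r)) \<partial>beta_measure a b \<partial>beta_measure l (a + b))"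
proof -
  have [measurable]: "(\<lambda>z. g (fst z) (snd z)) \<in> borel_measurable (borel \<Otimes>\<^sub>M borel)"
    using g by (simp add: case_prod_beta')
  have [measurable]: "(\<lambda>x. g (f x) (h x)) \<in> borel_measurable N"
    if [measurable]: "f \<in> borel_measurable N" "h \<in> borel_measurable N" for f h and N :: "'z measure"
    using measurable_compose[of "\<lambda>x. (f x, h x)" N "borel \<Otimes>\<^sub>M borel" "\<lambda>z. g (fst z) (snd z)" borel] by simp
  \<comment> \<open>The unnormalised Dirichlet density in the variables r and i. The normalising
    constant C factors in two ways into Beta functions, one for each order of drawing.\<close>
  define K where "K = (\<lambda>r i::real. if 0 < r \<and> r < i \<and> i < 1
     then r powr (l - 1) * (i - r) powr (a - 1) * (1 - i) powr (b - 1) else 0)"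
  have [measurable]: "(\<lambda>(i, r). ennreal (K r i)) \<in> borel_measurable (borel \<Otimes>\<^sub>M borel)"
    unfolding K_def by measurable
  have K1[measurable]: "(\<lambda>r. ennreal (K r i)) \<in> borel_measurable borel" for i unfolding K_def by measurable
  have K2[measurable]: "(\<lambda>i. ennreal (K r i)) \<in> borel_measurable borel" for r unfolding K_def by measurable
  define C where "C = Beta (a + l) b * Beta l a"
  have C0: "C > 0" using l a b by (simp add: C_def Beta_pos)
  have "Gamma (a + b) > 0" "Gamma (a + l) > 0"
    using l a b by (auto intro!: Gamma_real_pos)
  then have C': "C = Beta l (a + b) * Beta a b"
    by (simp add: C_def Beta_def add_ac)
  have K0: "K r i \<ge> 0" for r i by (simp add: K_def)
  have em: "ennreal (x * (y * z)) = ennreal x * (ennreal y * ennreal z)" if "x \<ge> 0" "y \<ge> 0" "z \<ge> 0" for x y z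
    using that by (simp add: ennreal_mult)
  have bd0: "beta_density u v t \<ge> 0" if "u > 0" "v > 0" for u v t
    using Beta_pos[OF that] by (simp add: beta_density_def)
  have L: "(\<integral>\<^sup>+i. \<integral>\<^sup>+x. g i x \<partial>beta_measure l a \<partial>beta_measure (a + l) b) =
       (\<integral>\<^sup>+i. \<integral>\<^sup>+r. ennreal (1 / C) * (ennreal (K r i) * g i (r / i)) \<partial>lborel \<partial>lborel)"
  proof -
    have "(\<integral>\<^sup>+i. \<integral>\<^sup>+x. g i x \<partial>beta_measure l a \<partial>beta_measure (a + l) b) =
       (\<integral>\<^sup>+i. ennreal (beta_density (a + l) b i) * (\<integral>\<^sup>+x. ennreal (beta_density l a x) * g i x \<partial>lborel) \<partial>lborel)"
      by (simp add: nn_integral_beta_measure)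
    also have "\<dots> = (\<integral>\<^sup>+i. \<integral>\<^sup>+r. ennreal (1 / C) * (ennreal (K r i) * g i (r / i)) \<partial>lborel \<partial>lborel)"
    proof (rule nn_integral_cong)
      fix i :: real
      show "ennreal (beta_density (a + l) b i) * (\<integral>\<^sup>+x. ennreal (beta_density l a x) * g i x \<partial>lborel) =
         (\<integral>\<^sup>+r. ennreal (1 / C) * (ennreal (K r i) * g i (r / i)) \<partial>lborel)"
      proof (cases "0 < i \<and> i < 1")
        case False
        then have "beta_density (a + l) b i = 0" "\<And>r. K r i = 0" by (auto simp: beta_density_def K_def indicator_def)
        then show ?thesis by simp
      next
        case True
        have pw: "beta_density (a + l) b i * beta_density l a x = i * (1 / C * K (i * x) i)" for x
        proof (cases "0 < x \<and> x < 1")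
          case x: True
          have "i - i * x = i * (1 - x)" by (simp add: algebra_simps)
          moreover have "i * x < 1" "i * x < i" using True x mult_strict_mono[of i 1 x 1] mult_strict_left_mono[of x 1 i] by auto
          moreover have "i powr (a + l - 1) = i * (i powr (l - 1) * i powr (a - 1))"
            using True by (simp add: powr_add powr_diff field_simps)
          ultimately show ?thesis
            using True x by (simp add: K_def beta_density_def C_def powr_mult indicator_def)
        next
          case x: False
          then have "x \<le> 0 \<or> x \<ge> 1" by auto
          then have "i * x \<le> 0 \<or> i * x \<ge> i" using True by (auto simp: mult_le_0_iff)
          then have "\<not> (0 < i * x \<and> i * x < i \<and> i < 1)" by linarith
          then have "K (i * x) i = 0" by (simp only: K_def if_False)
          then show ?thesis using x by (auto simp: beta_density_def)
        qed
        \<comment> \<open>Substitution r = i x with Jacobian i.\<close>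
        have "(\<integral>\<^sup>+r. ennreal (1 / C) * (ennreal (K r i) * g i (r / i)) \<partial>lborel) =
          ennreal \<bar>i\<bar> * (\<integral>\<^sup>+x. ennreal (1 / C) * (ennreal (K (0 + i * x) i) * g i ((0 + i * x) / i)) \<partial>lborel)"
          using True by (intro nn_integral_real_affine) auto
        also have "\<dots> = (\<integral>\<^sup>+x. ennreal \<bar>i\<bar> * (ennreal (1 / C) * (ennreal (K (0 + i * x) i) * g i ((0 + i * x) / i))) \<partial>lborel)"
          by (subst nn_integral_cmult) auto
        also have "\<dots> = (\<integral>\<^sup>+x. ennreal (beta_density (a + l) b i) * (ennreal (beta_density l a x) * g i x) \<partial>lborel)"
        proof (rule nn_integral_cong)
          fix x
          have "ennreal \<bar>i\<bar> * (ennreal (1 / C) * (ennreal (K (i * x) i) * g i x)) = 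
             ennreal (i * (1 / C * K (i * x) i)) * g i x"
            using True C0 em[of i "1 / C" "K (i * x) i"] K0 by (simp add: mult.assoc)
          also have "\<dots> = ennreal (beta_density (a + l) b i) * (ennreal (beta_density l a x) * g i x)"
            unfolding pw[symmetric] using bd0[of l a] bd0[of "a + l" b] l a b
            by (simp add: ennreal_mult mult.assoc)
          finally show "ennreal \<bar>i\<bar> * (ennreal (1 / C) * (ennreal (K (0 + i * x) i) * g i ((0 + i * x) / i))) = 
            ennreal (beta_density (a + l) b i) * (ennreal (beta_density l a x) * g i x)" using True by simp
        qed
        also have "\<dots> = ennreal (beta_density (a + l) b i) * (\<integral>\<^sup>+x. ennreal (beta_density l a x) * g i x \<partial>lborel)"
          by (subst nn_integral_cmult) auto
        finally show ?thesis ..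
      qed
    qed
    finally show ?thesis .
  qed
  have R: "(\<integral>\<^sup>+r. \<integral>\<^sup>+w. g (w + (1 - w) * r) (r / (w + (1 - w) * r)) \<partial>beta_measure a b \<partial>beta_measure l (a + b))
     = (\<integral>\<^sup>+r. \<integral>\<^sup>+i. ennreal (1 / C) * (ennreal (K r i) * g i (r / i)) \<partial>lborel \<partial>lborel)"
  proof -
    have "(\<integral>\<^sup>+r. \<integral>\<^sup>+w. g (w + (1 - w) * r) (r / (w + (1 - w) * r)) \<partial>beta_measure a b \<partial>beta_measure l (a + b)) =
      (\<integral>\<^sup>+r. ennreal (beta_density l (a + b) r) * (\<integral>\<^sup>+w. ennreal (beta_density a b w) * g (w + (1 - w) * r) (r / (w + (1 - w) * r)) \<partial>lborel) \<partial>lborel)"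
      by (simp add: nn_integral_beta_measure)
    also have "\<dots> = (\<integral>\<^sup>+r. \<integral>\<^sup>+i. ennreal (1 / C) * (ennreal (K r i) * g i (r / i)) \<partial>lborel \<partial>lborel)"
    proof (rule nn_integral_cong)
      fix r :: real
      show "ennreal (beta_density l (a + b) r) * (\<integral>\<^sup>+w. ennreal (beta_density a b w) * g (w + (1 - w) * r) (r / (w + (1 - w) * r)) \<partial>lborel)
        = (\<integral>\<^sup>+i. ennreal (1 / C) * (ennreal (K r i) * g i (r / i)) \<partial>lborel)"
      proof (cases "0 < r \<and> r < 1")
        case False
        then have "beta_density l (a + b) r = 0" "\<And>i. K r i = 0" by (auto simp: beta_density_def K_def indicator_def)
        then show ?thesis by simp
      next
        case True
        have conv: "w + (1 - w) * r = r + (1 - r) * w" for w by (simp add: algebra_simps)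
        have pw: "beta_density l (a + b) r * beta_density a b w = (1 - r) * (1 / C * K r (r + (1 - r) * w))" for w
        proof (cases "0 < w \<and> w < 1")
          case w: True
          have "1 - (r + (1 - r) * w) = (1 - r) * (1 - w)" by (simp add: algebra_simps)
          moreover have "(1 - r) * w > 0" "(1 - r) * (1 - w) > 0" using True w by auto
          moreover have "(1 - r) powr (1 + ((a - 1) + (b - 1))) = (1 - r) * ((1 - r) powr (a - 1) * (1 - r) powr (b - 1))"
            using True by (simp only: powr_add) simp
          then have "(1 - r) powr (a + b - 1) = (1 - r) * ((1 - r) powr (a - 1) * (1 - r) powr (b - 1))"
            by (simp add: algebra_simps)
          ultimately have *: "r < r + (1 - r) * w" "r + (1 - r) * w < 1" "0 < r + (1 - r) * w" using True by linarith+
          show ?thesis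
            using True w * \<open>1 - (r + (1 - r) * w) = (1 - r) * (1 - w)\<close> \<open>(1 - r) powr (a + b - 1) = _\<close>
            by (simp add: K_def beta_density_def C' powr_mult indicator_def)
        next
          case w: False
          then have "w \<le> 0 \<or> w \<ge> 1" by auto
          then have "(1 - r) * w \<le> 0 \<or> (1 - r) * w \<ge> 1 - r" using True by (auto simp: mult_le_0_iff)
          then have "\<not> (r < r + (1 - r) * w \<and> r + (1 - r) * w < 1)" by linarith
          then have "K r (r + (1 - r) * w) = 0" by (simp only: K_def if_False simp_thms)
          then show ?thesis using w by (auto simp: beta_density_def)
        qed
        \<comment> \<open>Substitution i = r + (1 - r) w with Jacobian 1 - r.\<close>
        have "(\<integral>\<^sup>+i. ennreal (1 / C) * (ennreal (K r i) * g i (r / i)) \<partial>lborel) =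
          ennreal \<bar>1 - r\<bar> * (\<integral>\<^sup>+w. ennreal (1 / C) * (ennreal (K r (r + (1 - r) * w)) * g (r + (1 - r) * w) (r / (r + (1 - r) * w))) \<partial>lborel)"
          using True by (intro nn_integral_real_affine) auto
        also have "\<dots> = (\<integral>\<^sup>+w. ennreal \<bar>1 - r\<bar> * (ennreal (1 / C) * (ennreal (K r (r + (1 - r) * w)) * g (r + (1 - r) * w) (r / (r + (1 - r) * w)))) \<partial>lborel)"
          by (subst nn_integral_cmult) auto
        also have "\<dots> = (\<integral>\<^sup>+w. ennreal (beta_density l (a + b) r) * (ennreal (beta_density a b w) * g (r + (1 - r) * w) (r / (r + (1 - r) * w))) \<partial>lborel)"
        proof (rule nn_integral_cong)
          fix w
          let ?G = "g (r + (1 - r) * w) (r / (r + (1 - r) * w))"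
          have "ennreal \<bar>1 - r\<bar> * (ennreal (1 / C) * (ennreal (K r (r + (1 - r) * w)) * ?G)) = 
             ennreal ((1 - r) * (1 / C * K r (r + (1 - r) * w))) * ?G"
            using True C0 em[of "1 - r" "1 / C" "K r (r + (1 - r) * w)"] K0 by (simp add: mult.assoc)
          also have "\<dots> = ennreal (beta_density l (a + b) r) * (ennreal (beta_density a b w) * ?G)"
            unfolding pw[symmetric] using bd0[of l "a + b"] bd0[of a b] l a b
            by (simp add: ennreal_mult mult.assoc)
          finally show "ennreal \<bar>1 - r\<bar> * (ennreal (1 / C) * (ennreal (K r (r + (1 - r) * w)) * ?G)) = 
            ennreal (beta_density l (a + b) r) * (ennreal (beta_density a b w) * ?G)" .
        qed
        also have "\<dots> = ennreal (beta_density l (a + b) r) * (\<integral>\<^sup>+w. ennreal (beta_density a b w) * g (r + (1 - r) * w) (r / (r + (1 - r) * w)) \<partial>lborel)"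
          by (subst nn_integral_cmult) auto
        finally show ?thesis unfolding conv ..
      qed
    qed
    finally show ?thesis .
  qed
  have [measurable]: "(\<lambda>(r, i). ennreal (K r i)) \<in> borel_measurable (borel \<Otimes>\<^sub>M borel)"
    unfolding K_def by measurable
  have "(\<integral>\<^sup>+r. \<integral>\<^sup>+i. ennreal (1 / C) * (ennreal (K r i) * g i (r / i)) \<partial>lborel \<partial>lborel)
    = (\<integral>\<^sup>+i. \<integral>\<^sup>+r. ennreal (1 / C) * (ennreal (K r i) * g i (r / i)) \<partial>lborel \<partial>lborel)"
    by (rule lborel_pair.Fubini') auto
  with L R show ?thesis by simp
qed

text \<open>Read from left to right, the Dirichlet identity shows that r = i x has law Beta(l, a +
  b). Read backwards, it rebuilds from r and the fresh weight w a pair with the original law. This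
  is the Burke property of a single cell.\<close>

lemma burke_identity:
  fixes g :: "real \<Rightarrow> real \<Rightarrow> ennreal"
  assumes l: "l > 0" and a: "a > 0" and b: "b > 0"
    and g[measurable]: "(\<lambda>(i, x). g i x) \<in> borel_measurable (borel \<Otimes>\<^sub>M borel)"
  shows "(\<integral>\<^sup>+i. \<integral>\<^sup>+x. \<integral>\<^sup>+w. g (w + (1 - w) * (i * x)) (i * x / (w + (1 - w) * (i * x)))
      \<partial>beta_measure a b \<partial>beta_measure l a \<partial>beta_measure (a + l) b) =
    (\<integral>\<^sup>+i. \<integral>\<^sup>+x. g i x \<partial>beta_measure l a \<partial>beta_measure (a + l) b)"
proof -
  interpret B: prob_space "beta_measure a b" by (rule prob_space_beta_measure[OF a b])
  have [measurable]: "(\<lambda>z. g (fst z) (snd z)) \<in> borel_measurable (borel \<Otimes>\<^sub>M borel)"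
    using g by (simp add: case_prod_beta')
  have gm[measurable]: "(\<lambda>x. g (f x) (h x)) \<in> borel_measurable N"
    if [measurable]: "f \<in> borel_measurable N" "h \<in> borel_measurable N" for f h and N :: "'z measure"
    using measurable_compose[of "\<lambda>x. (f x, h x)" N "borel \<Otimes>\<^sub>M borel" "\<lambda>z. g (fst z) (snd z)" borel] by simp
  define k where "k r = (\<integral>\<^sup>+w. g (w + (1 - w) * r) (r / (w + (1 - w) * r)) \<partial>beta_measure a b)" for r
  have [measurable]: "k \<in> borel_measurable borel"
    unfolding k_def by (rule B.borel_measurable_nn_integral) (simp add: case_prod_beta')
  \<comment> \<open>The integrand k depends on the pair only through its product, which on the
    right-hand side is just r.\<close>
  have "(\<integral>\<^sup>+i. \<integral>\<^sup>+x. k (i * x) \<partial>beta_measure l a \<partial>beta_measure (a + l) b) =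
     (\<integral>\<^sup>+r. \<integral>\<^sup>+w. k ((w + (1 - w) * r) * (r / (w + (1 - w) * r))) \<partial>beta_measure a b \<partial>beta_measure l (a + b))"
    by (rule dirichlet_decomposition[OF l a b]) measurable
  also have "\<dots> = (\<integral>\<^sup>+r. \<integral>\<^sup>+w. k r \<partial>beta_measure a b \<partial>beta_measure l (a + b))"
  proof (rule nn_integral_cong_AE, use AE_beta_measure in eventually_elim)
    fix r :: real assume r: "0 < r \<and> r < 1"
    show "(\<integral>\<^sup>+w. k ((w + (1 - w) * r) * (r / (w + (1 - w) * r))) \<partial>beta_measure a b) = (\<integral>\<^sup>+w. k r \<partial>beta_measure a b)"
    proof (rule nn_integral_cong_AE, use AE_beta_measure in eventually_elim)
      fix w :: real assume w: "0 < w \<and> w < 1"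
      have "w + (1 - w) * r > 0" using w r by (intro add_pos_pos mult_pos_pos) auto
      then show "k ((w + (1 - w) * r) * (r / (w + (1 - w) * r))) = k r" by simp
    qed
  qed
  also have "\<dots> = (\<integral>\<^sup>+r. k r \<partial>beta_measure l (a + b))"
    using B.emeasure_space_1 by simp
  also have "\<dots> = (\<integral>\<^sup>+i. \<integral>\<^sup>+x. g i x \<partial>beta_measure l a \<partial>beta_measure (a + l) b)"
    unfolding k_def by (rule dirichlet_decomposition[OF l a b g, symmetric])
  finally show ?thesis unfolding k_def .
qed

section \<open>Stationary ratios\<close>

definition bulk :: "nat \<Rightarrow> nat \<Rightarrow> (nat \<times> nat) set" where
  "bulk m n = {..<m} \<times> {..<n}"

definition boundary :: "nat \<Rightarrow> nat \<Rightarrow> (nat \<times> nat) set" where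
  "boundary m n = {..<m} \<times> {n} \<union> {m} \<times> {..<n}"

definition grid :: "nat \<Rightarrow> nat \<Rightarrow> (nat \<times> nat) set" where
  "grid m n = bulk m n \<union> boundary m n"

text \<open>
  Bulk coordinates are weights of horizontal edges. A coordinate \<open>(c, n)\<close> on the top side is the ratio
  of the harmonic function along the edge from \<open>(c, n)\<close> to \<open>(c + 1, n)\<close>; a coordinate \<open>(m, r)\<close> on the
  right side is the inverse ratio along the edge from \<open>(m, r)\<close> to \<open>(m, r + 1)\<close>.
\<close>

definition site_law :: "real \<Rightarrow> real \<Rightarrow> real \<Rightarrow> nat \<Rightarrow> nat \<Rightarrow> nat \<times> nat \<Rightarrow> real measure" where
  "site_law \<alpha> \<beta> l m n k =
     (if fst k = m then beta_measure l \<alpha>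
      else if snd k = n then beta_measure (\<alpha> + l) \<beta>
      else beta_measure \<alpha> \<beta>)"

definition grid_measure :: "real \<Rightarrow> real \<Rightarrow> real \<Rightarrow> nat \<Rightarrow> nat \<Rightarrow> (nat \<times> nat \<Rightarrow> real) measure" where
  "grid_measure \<alpha> \<beta> l m n = PiM (grid m n) (site_law \<alpha> \<beta> l m n)"

definition bulk_measure :: "real \<Rightarrow> real \<Rightarrow> nat \<Rightarrow> nat \<Rightarrow> (nat \<times> nat \<Rightarrow> real) measure" where
  "bulk_measure \<alpha> \<beta> m n = PiM (bulk m n) (\<lambda>_. beta_measure \<alpha> \<beta>)"

text \<open>
  The state of a sweep through the rectangle is stored in the boundary coordinates: \<open>x (c, n)\<close> is the
  ratio of the harmonic function along the horizontal edge of the current down-right path in column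
  \<open>c\<close>, and \<open>x (m, r)\<close> the inverse ratio along its vertical edge in row \<open>r\<close>. Flipping the cell \<open>k\<close>
  moves the path across \<open>k\<close>; the product \<open>R\<close> of the two coordinates is unchanged by the move.
\<close>

definition flip :: "nat \<Rightarrow> nat \<Rightarrow> nat \<times> nat \<Rightarrow> (nat \<times> nat \<Rightarrow> real) \<Rightarrow> nat \<times> nat \<Rightarrow> real" where
  "flip m n k x = (let R = x (fst k, n) * x (m, snd k); I = x k + (1 - x k) * R
     in x((fst k, n) := I, (m, snd k) := R / I))"

lemma finite_grid [simp]: "finite (bulk m n)" "finite (boundary m n)" "finite (grid m n)"
  by (simp_all add: bulk_def boundary_def grid_def)

lemma sets_site_law [simp, measurable_cong]: "sets (site_law \<alpha> \<beta> l m n k) = sets borel"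
  by (simp add: site_law_def)

lemma sets_grid_measure [measurable_cong]:
  "sets (grid_measure \<alpha> \<beta> l m n) = sets (PiM (grid m n) (\<lambda>_. borel))"
  unfolding grid_measure_def by (intro sets_PiM_cong) auto

lemma sets_bulk_measure [measurable_cong]:
  "sets (bulk_measure \<alpha> \<beta> m n) = sets (PiM (bulk m n) (\<lambda>_. borel))"
  unfolding bulk_measure_def by (intro sets_PiM_cong) auto

lemma measurable_PiM_coordinate [measurable]:
  "(\<lambda>x. x k) \<in> borel_measurable (PiM K (\<lambda>_. borel :: real measure))"
proof (cases "k \<in> K")
  case False
  then have "(\<lambda>x. x k) \<in> borel_measurable (PiM K (\<lambda>_. borel :: real measure)) \<longleftrightarrow>
      (\<lambda>x. undefined :: real) \<in> borel_measurable (PiM K (\<lambda>_. borel :: real measure))"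
    by (intro measurable_cong) (auto simp: space_PiM PiE_def extensional_def)
  then show ?thesis by simp
qed simp

lemma flip_measurable [measurable]:
  assumes "k \<in> bulk m n"
  shows "flip m n k \<in> measurable (PiM (grid m n) (\<lambda>_. borel)) (PiM (grid m n) (\<lambda>_. borel))"
proof (rule measurable_PiM_single')
  fix j
  show "(\<lambda>x. flip m n k x j) \<in> borel_measurable (PiM (grid m n) (\<lambda>_. borel))"
    unfolding flip_def Let_def by (simp add: fun_upd_def) measurable
next
  show "flip m n k \<in> space (PiM (grid m n) (\<lambda>_. borel)) \<rightarrow> (\<Pi>\<^sub>E i\<in>grid m n. space borel)"
    using assms by (auto simp: flip_def Let_def space_PiM PiE_def extensional_def grid_def bulk_def boundary_def)
qed

lemma fold_flip_measurable:
  assumes "set ks \<subseteq> bulk m n"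
  shows "fold (flip m n) ks \<in> measurable (PiM (grid m n) (\<lambda>_. borel)) (PiM (grid m n) (\<lambda>_. borel))"
  using assms
proof (induction ks)
  case (Cons k ks)
  then show ?case using measurable_comp[OF flip_measurable, of k m n "fold (flip m n) ks"] by (auto simp: comp_def)
qed (simp add: id_def)

text \<open>The only bulk weight that a flip reads is that of its own cell.\<close>

lemma flip_upd:
  assumes "k \<in> bulk m n" "k' \<in> bulk m n" "k \<noteq> k'"
  shows "flip m n k (x(k' := t)) = (flip m n k x)(k' := t)"
proof -
  have "k' \<noteq> (fst k, n)" "k' \<noteq> (m, snd k)" using assms by (auto simp: bulk_def)
  then show ?thesis using assms by (auto simp: flip_def Let_def fun_upd_twist)
qed

context
  fixes \<alpha> \<beta> l :: real
  assumes pos: "\<alpha> > 0" "\<beta> > 0" "l > 0"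
begin

lemma prob_space_site_law: "prob_space (site_law \<alpha> \<beta> l m n k)"
  using pos by (auto simp: site_law_def intro!: prob_space_beta_measure)

lemma product_sigma_finite_site_law: "product_sigma_finite (site_law \<alpha> \<beta> l m n)"
  by (simp add: product_sigma_finite_def prob_space.axioms(1)[OF prob_space_site_law] prob_space_imp_sigma_finite prob_space_site_law)

lemma prob_space_bulk_measure: "prob_space (bulk_measure \<alpha> \<beta> m n)"
  unfolding bulk_measure_def using pos by (intro prob_space_PiM prob_space_beta_measure)

lemma AE_site_law: "AE x in site_law \<alpha> \<beta> l m n k. 0 < x \<and> x < 1"
  by (cases "fst k = m"; cases "snd k = n") (simp_all only: site_law_def if_True if_False simp_thms AE_beta_measure)

lemma AE_grid_measure: "AE x in grid_measure \<alpha> \<beta> l m n. \<forall>k\<in>grid m n. 0 < x k \<and> x k < 1"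
  unfolding grid_measure_def
  by (intro AE_finite_allI finite_grid AE_PiM_component[where P = "\<lambda>t. 0 < t \<and> t < 1"]
      prob_space_site_law AE_site_law)

text \<open>Three coordinates enter the flip and only the law of the pair on the boundary is
  restored. Therefore f has to ignore the weight at k, which the move has used up.\<close>

lemma nn_integral_flip:
  assumes k: "k \<in> bulk m n"
    and f[measurable]: "f \<in> borel_measurable (PiM (grid m n) (\<lambda>_. borel))"
    and indep: "\<And>x t. f (x(k := t)) = f x"
  shows "(\<integral>\<^sup>+x. f (flip m n k x) \<partial>grid_measure \<alpha> \<beta> l m n) = (\<integral>\<^sup>+x. f x \<partial>grid_measure \<alpha> \<beta> l m n)"
proof -
  interpret product_sigma_finite "site_law \<alpha> \<beta> l m n" by (rule product_sigma_finite_site_law)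
  interpret W: prob_space "beta_measure \<alpha> \<beta>" using pos by (intro prob_space_beta_measure)
  let ?M = "site_law \<alpha> \<beta> l m n"
  define H where "H = (fst k, n)"
  define V where "V = (m, snd k)"
  define G where "G = grid m n - {k, H, V}"
  have kb: "fst k < m" "snd k < n" using k by (auto simp: bulk_def)
  have dist: "H \<notin> G" "V \<notin> insert H G" "k \<notin> insert V (insert H G)" "H \<noteq> V" "k \<noteq> H" "k \<noteq> V"
    using kb by (cases k; auto simp: G_def H_def V_def)+
  have fin: "finite G" by (simp add: G_def)
  have grid: "grid m n = insert k (insert V (insert H G))"
    using kb k by (auto simp: G_def H_def V_def grid_def boundary_def)
  have laws: "?M k = beta_measure \<alpha> \<beta>" "?M H = beta_measure (\<alpha> + l) \<beta>" "?M V = beta_measure l \<alpha>"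
    using kb by (auto simp: site_law_def H_def V_def)
  have unfold: "(\<integral>\<^sup>+x. F x \<partial>grid_measure \<alpha> \<beta> l m n) =
     (\<integral>\<^sup>+x. \<integral>\<^sup>+i. \<integral>\<^sup>+y. \<integral>\<^sup>+w. F (x(H := i, V := y, k := w)) \<partial>beta_measure \<alpha> \<beta> \<partial>beta_measure l \<alpha>
        \<partial>beta_measure (\<alpha> + l) \<beta> \<partial>PiM G ?M)"
    if F[measurable]: "F \<in> borel_measurable (PiM (grid m n) (\<lambda>_. borel))" for F :: "_ \<Rightarrow> ennreal"
  proof -
    have cong: "borel_measurable (PiM K ?M) = borel_measurable (PiM K (\<lambda>_. borel))" for K
      by (intro measurable_cong_sets sets_PiM_cong) auto
    have F1: "F \<in> borel_measurable (PiM (insert k (insert V (insert H G))) ?M)"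
      using F unfolding cong grid[symmetric] .
    have F2: "(\<lambda>x. \<integral>\<^sup>+w. F (x(k := w)) \<partial>?M k) \<in> borel_measurable (PiM (insert V (insert H G)) ?M)"
      by (rule sigma_finite_measure.borel_measurable_nn_integral[OF sigma_finite_measures])
        (use measurable_compose[OF measurable_add_dim F1] in \<open>simp add: case_prod_beta'\<close>)
    have F3: "(\<lambda>x. \<integral>\<^sup>+y. \<integral>\<^sup>+w. F (x(V := y, k := w)) \<partial>?M k \<partial>?M V) \<in> borel_measurable (PiM (insert H G) ?M)"
      by (rule sigma_finite_measure.borel_measurable_nn_integral[OF sigma_finite_measures])
        (use measurable_compose[OF measurable_add_dim F2] in \<open>simp add: case_prod_beta'\<close>)
    have "(\<integral>\<^sup>+x. F x \<partial>grid_measure \<alpha> \<beta> l m n) =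
        (\<integral>\<^sup>+x. \<integral>\<^sup>+w. F (x(k := w)) \<partial>?M k \<partial>PiM (insert V (insert H G)) ?M)"
      unfolding grid_measure_def grid using fin dist by (intro product_nn_integral_insert F1) auto
    also have "\<dots> = (\<integral>\<^sup>+x. \<integral>\<^sup>+y. \<integral>\<^sup>+w. F (x(V := y, k := w)) \<partial>?M k \<partial>?M V \<partial>PiM (insert H G) ?M)"
      using fin dist by (intro product_nn_integral_insert F2) auto
    also have "\<dots> = (\<integral>\<^sup>+x. \<integral>\<^sup>+i. \<integral>\<^sup>+y. \<integral>\<^sup>+w. F (x(H := i, V := y, k := w)) \<partial>?M k \<partial>?M V \<partial>?M H \<partial>PiM G ?M)"
      using fin dist by (intro product_nn_integral_insert F3) auto
    finally show ?thesis unfolding laws .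
  qed
  have "(\<integral>\<^sup>+x. f (flip m n k x) \<partial>grid_measure \<alpha> \<beta> l m n) =
     (\<integral>\<^sup>+x. \<integral>\<^sup>+i. \<integral>\<^sup>+y. \<integral>\<^sup>+w. f (flip m n k (x(H := i, V := y, k := w))) \<partial>beta_measure \<alpha> \<beta> \<partial>beta_measure l \<alpha>
        \<partial>beta_measure (\<alpha> + l) \<beta> \<partial>PiM G ?M)"
    using k by (intro unfold) measurable
  also have "\<dots> = (\<integral>\<^sup>+x. \<integral>\<^sup>+i. \<integral>\<^sup>+y. \<integral>\<^sup>+w. f (x(H := i, V := y, k := w)) \<partial>beta_measure \<alpha> \<beta> \<partial>beta_measure l \<alpha>
        \<partial>beta_measure (\<alpha> + l) \<beta> \<partial>PiM G ?M)"
  proof (rule nn_integral_cong)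
    fix x assume x: "x \<in> space (PiM G ?M)"
    define g where "g i y = f (x(H := i, V := y, k := 0))" for i y
    have g_eq: "f (x(H := i, V := y, k := w)) = g i y" for i y w
      unfolding g_def using indep[of "x(H := i, V := y, k := 0)" w] by simp
    have gm: "(\<lambda>(i, y). g i y) \<in> borel_measurable (borel \<Otimes>\<^sub>M borel)"
    proof -
      have "(\<lambda>z. x(H := fst z, V := snd z, k := 0)) \<in> measurable (borel \<Otimes>\<^sub>M borel) (PiM (grid m n) (\<lambda>_. borel :: real measure))"
      proof (rule measurable_PiM_single')
        fix j
        show "(\<lambda>z. (x(H := fst z, V := snd z, k := 0)) j) \<in> borel_measurable (borel \<Otimes>\<^sub>M borel)"
          by (simp add: fun_upd_def)
      next
        show "(\<lambda>z. x(H := fst z, V := snd z, k := 0)) \<in> space (borel \<Otimes>\<^sub>M borel) \<rightarrow> (\<Pi>\<^sub>E i\<in>grid m n. space borel)"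
          using x by (auto simp: grid space_PiM PiE_def extensional_def)
      qed
      from measurable_compose[OF this f] show ?thesis by (simp add: g_def case_prod_beta')
    qed
    have flip_eq: "flip m n k (x(H := i, V := y, k := w)) =
       x(H := w + (1 - w) * (i * y), V := i * y / (w + (1 - w) * (i * y)), k := w)" for i y w
      using dist unfolding flip_def H_def[symmetric] V_def[symmetric] Let_def
      by (auto simp: fun_eq_iff)
    show "(\<integral>\<^sup>+i. \<integral>\<^sup>+y. \<integral>\<^sup>+w. f (flip m n k (x(H := i, V := y, k := w))) \<partial>beta_measure \<alpha> \<beta> \<partial>beta_measure l \<alpha>
        \<partial>beta_measure (\<alpha> + l) \<beta>) = (\<integral>\<^sup>+i. \<integral>\<^sup>+y. \<integral>\<^sup>+w. f (x(H := i, V := y, k := w)) \<partial>beta_measure \<alpha> \<beta> \<partial>beta_measure l \<alpha>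
        \<partial>beta_measure (\<alpha> + l) \<beta>)"
      unfolding flip_eq g_eq
      using burke_identity[OF pos(3,1,2) gm] W.emeasure_space_1 by simp
  qed
  also have "\<dots> = (\<integral>\<^sup>+x. f x \<partial>grid_measure \<alpha> \<beta> l m n)"
    by (rule unfold[OF f, symmetric])
  finally show ?thesis .
qed

text \<open>The earliest flip is removed first. Its cell does not recur in the list, so the
  remaining sweep neither reads nor changes that weight, and the sweep followed by f still ignores
  it.\<close>

lemma nn_integral_fold_flip:
  assumes "distinct ks" "set ks \<subseteq> bulk m n"
    and "f \<in> borel_measurable (PiM (grid m n) (\<lambda>_. borel))"
    and "\<And>x k t. k \<in> set ks \<Longrightarrow> f (x(k := t)) = f x"
  shows "(\<integral>\<^sup>+x. f (fold (flip m n) ks x) \<partial>grid_measure \<alpha> \<beta> l m n) = (\<integral>\<^sup>+x. f x \<partial>grid_measure \<alpha> \<beta> l m n)"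
  using assms
proof (induction ks)
  case (Cons k ks)
  have upd: "fold (flip m n) ks (x(k := t)) = (fold (flip m n) ks x)(k := t)"
    if "set ks \<subseteq> bulk m n" "k \<notin> set ks" "k \<in> bulk m n" for x t ks k
    using that
  proof (induction ks arbitrary: x)
    case (Cons k' ks)
    then have *: "flip m n k' (x(k := t)) = (flip m n k' x)(k := t)"
      by (intro flip_upd) auto
    have "fold (flip m n) (k' # ks) (x(k := t)) = fold (flip m n) ks ((flip m n k' x)(k := t))"
      unfolding fold_simps * ..
    also have "\<dots> = (fold (flip m n) ks (flip m n k' x))(k := t)"
      using Cons.prems by (intro Cons.IH) auto
    finally show ?case by (simp only: fold_simps)
  qed simp
  have "(\<integral>\<^sup>+x. f (fold (flip m n) ks (flip m n k x)) \<partial>grid_measure \<alpha> \<beta> l m n) =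
        (\<integral>\<^sup>+x. f (fold (flip m n) ks x) \<partial>grid_measure \<alpha> \<beta> l m n)"
  proof (rule nn_integral_flip)
    show "k \<in> bulk m n" using Cons.prems by simp
    show "(\<lambda>x. f (fold (flip m n) ks x)) \<in> borel_measurable (PiM (grid m n) (\<lambda>_. borel))"
      using Cons.prems by (intro measurable_compose[OF fold_flip_measurable]) auto
    fix x t
    have "fold (flip m n) ks (x(k := t)) = (fold (flip m n) ks x)(k := t)"
      using Cons.prems by (intro upd) auto
    then show "f (fold (flip m n) ks (x(k := t))) = f (fold (flip m n) ks x)"
      using Cons.prems(4)[of k "fold (flip m n) ks x" t] by (simp only: list.set insert_iff simp_thms)
  qed
  with Cons show ?case by simp
qed simp

end

text \<open>Harmonic extension, normalised by \<open>1\<close> at the corner \<open>(m, n)\<close>, of the boundary ratios stored in \<open>x\<close>.\<close>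

function harm_ext :: "nat \<Rightarrow> nat \<Rightarrow> (nat \<times> nat \<Rightarrow> real) \<Rightarrow> nat \<Rightarrow> nat \<Rightarrow> real" where
  "harm_ext m n x c r =
     (if c < m \<and> r < n then x (c, r) * harm_ext m n x (Suc c) r + (1 - x (c, r)) * harm_ext m n x c (Suc r)
      else if c < m then x (c, n) * harm_ext m n x (Suc c) r
      else if r < n then harm_ext m n x c (Suc r) / x (m, r)
      else 1)"
  by auto
termination by (relation "Wellfounded.measure (\<lambda>(m, n, x, c, r). (m - c) + (n - r))") auto

declare harm_ext.simps [simp del]

lemma harm_ext_simps:
  "c < m \<Longrightarrow> r < n \<Longrightarrow> harm_ext m n x c r = x (c, r) * harm_ext m n x (Suc c) r + (1 - x (c, r)) * harm_ext m n x c (Suc r)"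
  "c < m \<Longrightarrow> harm_ext m n x c n = x (c, n) * harm_ext m n x (Suc c) n"
  "r < n \<Longrightarrow> harm_ext m n x m r = harm_ext m n x m (Suc r) / x (m, r)"
  "harm_ext m n x m n = 1"
  by (subst harm_ext.simps; simp)+

lemma harm_ext_top: "c \<le> m \<Longrightarrow> harm_ext m n x c n = (\<Prod>k\<in>{c..<m}. x (k, n))"
proof (induction c rule: inc_induct)
  case (step c)
  then show ?case by (simp add: harm_ext_simps prod.atLeast_Suc_lessThan)
qed (simp add: harm_ext_simps)

lemma harm_ext_right: "r \<le> n \<Longrightarrow> harm_ext m n x m r = (\<Prod>k\<in>{r..<n}. 1 / x (m, k))"
proof (induction r rule: inc_induct)
  case (step r)
  then show ?case by (simp add: harm_ext_simps prod.atLeast_Suc_lessThan)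
qed (simp add: harm_ext_simps)

lemma harm_ext_measurable [measurable]:
  "(\<lambda>x. harm_ext m n x c r) \<in> borel_measurable (PiM K (\<lambda>_. borel))"
proof (induction "(m - c) + (n - r)" arbitrary: c r rule: less_induct)
  case less
  consider "c < m" "r < n" | "c < m" "\<not> r < n" | "\<not> c < m" "r < n" | "\<not> c < m" "\<not> r < n" by blast
  then show ?case
  proof cases
    case 1
    then have [measurable]: "(\<lambda>x. harm_ext m n x (Suc c) r) \<in> borel_measurable (PiM K (\<lambda>_. borel))"
      "(\<lambda>x. harm_ext m n x c (Suc r)) \<in> borel_measurable (PiM K (\<lambda>_. borel))"
      by (intro less; simp)+
    show ?thesis using 1 by (subst harm_ext.simps) simp
  next
    case 2
    then have [measurable]: "(\<lambda>x. harm_ext m n x (Suc c) r) \<in> borel_measurable (PiM K (\<lambda>_. borel))"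
      by (intro less; simp)
    show ?thesis using 2 by (subst harm_ext.simps) simp
  next
    case 3
    then have [measurable]: "(\<lambda>x. harm_ext m n x c (Suc r)) \<in> borel_measurable (PiM K (\<lambda>_. borel))"
      by (intro less; simp)
    show ?thesis using 3 by (subst harm_ext.simps) simp
  next
    case 4
    then show ?thesis by (subst harm_ext.simps) simp
  qed
qed

lemma harm_ext_pos:
  assumes "\<forall>k\<in>grid m n. 0 < x k \<and> x k < 1" "c \<le> m" "r \<le> n"
  shows "harm_ext m n x c r > 0"
  using assms(2,3)
proof (induction "(m - c) + (n - r)" arbitrary: c r rule: less_induct)
  case less
  consider "c < m" "r < n" | "c < m" "r = n" | "c = m" "r < n" | "c = m" "r = n" using less by linarith
  then show ?case
  proof cases
    case 1
    have "harm_ext m n x (Suc c) r > 0" "harm_ext m n x c (Suc r) > 0"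
      using 1 by (intro less; simp)+
    moreover have "0 < x (c, r)" "x (c, r) < 1" using assms(1) 1 by (auto simp: grid_def bulk_def)
    ultimately show ?thesis using 1 by (simp add: harm_ext_simps add_pos_pos)
  next
    case 2
    have "harm_ext m n x (Suc c) r > 0" using 2 by (intro less; simp)
    moreover have "0 < x (c, n)" using assms(1) 2 by (auto simp: grid_def boundary_def)
    ultimately show ?thesis using 2 by (simp add: harm_ext_simps)
  next
    case 3
    have "harm_ext m n x c (Suc r) > 0" using 3 by (intro less; simp)
    moreover have "0 < x (m, r)" using assms(1) 3 by (auto simp: grid_def boundary_def)
    ultimately show ?thesis using 3 by (simp add: harm_ext_simps)
  next
    case 4
    then show ?thesis by (simp add: harm_ext_simps)
  qed
qed

section \<open>Sweeping the rectangle cell by cell\<close>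

definition row_cells :: "nat \<Rightarrow> nat \<Rightarrow> (nat \<times> nat) list" where
  "row_cells k r = map (\<lambda>c. (c, r)) (rev [0..<k])"

text \<open>Rows run from the top down and each row from right to left, so that the top and the
  right edge of a cell lie on the current path when the cell is flipped.\<close>

definition cells :: "nat \<Rightarrow> nat \<Rightarrow> (nat \<times> nat) list" where
  "cells m k = concat (map (row_cells m) (rev [0..<k]))"

lemma row_cells_Suc: "row_cells (Suc k) r = (k, r) # row_cells k r"
  by (simp add: row_cells_def)

lemma cells_Suc: "cells m (Suc k) = row_cells m k @ cells m k"
  by (simp add: cells_def)

lemma set_cells: "set (cells m n) = bulk m n"
  by (auto simp: cells_def row_cells_def bulk_def)

lemma distinct_cells: "distinct (cells m n)"
proof (induction n)
  case (Suc n)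
  have "distinct (row_cells m n)"
    by (simp add: row_cells_def distinct_map inj_on_def)
  moreover have "set (row_cells m n) \<inter> set (cells m n) = {}"
    by (auto simp: set_cells row_cells_def bulk_def)
  ultimately show ?case using Suc by (simp add: cells_Suc)
qed (simp add: cells_def)

text \<open>When a cell is flipped, the stored coordinates belong to its top and right edges. Their
  product R is the ratio of the harmonic extension between the upper left and the lower right
  corner, and harmonicity at the lower left corner identifies I with the ratio along the bottom
  edge.\<close>

lemma fold_flip_row:
  assumes x: "\<forall>k\<in>grid m n. 0 < x k \<and> x k < 1" and "k \<le> m" "r < n"
    and "\<And>c. c < k \<Longrightarrow> y (c, n) = harm_ext m n x c (Suc r) / harm_ext m n x (Suc c) (Suc r)"
    and "y (m, r) = harm_ext m n x k (Suc r) / harm_ext m n x k r"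
    and "\<And>c. c < k \<Longrightarrow> y (c, r) = x (c, r)"
  defines "z \<equiv> fold (flip m n) (row_cells k r) y"
  shows "(\<forall>c<k. z (c, n) = harm_ext m n x c r / harm_ext m n x (Suc c) r) \<and>
     (\<forall>j. j \<noteq> (m, r) \<and> j \<notin> {..<k} \<times> {n} \<longrightarrow> z j = y j)"
  using assms(2-6) unfolding z_def
proof (induction k arbitrary: y)
  case 0
  then show ?case by (simp add: row_cells_def)
next
  case (Suc k)
  define y' where "y' = flip m n (k, r) y"
  have k: "k < m" "r < n" using Suc.prems by auto
  have ne: "harm_ext m n x a b \<noteq> 0" if "a \<le> m" "b \<le> n" for a b
    using harm_ext_pos[OF x that] by simp
  have R: "y (k, n) * y (m, r) = harm_ext m n x k (Suc r) / harm_ext m n x (Suc k) r"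
    using Suc.prems(3)[of k] Suc.prems(4) ne[of "Suc k" "Suc r"] k by simp
  have I: "y (k, r) + (1 - y (k, r)) * (y (k, n) * y (m, r)) = harm_ext m n x k r / harm_ext m n x (Suc k) r"
    unfolding R using Suc.prems(5)[of k] ne[of "Suc k" r] k
    by (simp add: harm_ext_simps(1)[of k m r n] field_simps)
  have y': "y' (k, n) = harm_ext m n x k r / harm_ext m n x (Suc k) r"
     "y' (m, r) = harm_ext m n x k (Suc r) / harm_ext m n x k r"
     "\<And>j. j \<noteq> (k, n) \<Longrightarrow> j \<noteq> (m, r) \<Longrightarrow> y' j = y j"
    using k ne[of "Suc k" r] ne[of k r] unfolding y'_def flip_def Let_def fst_conv snd_conv R I[unfolded R]
    by auto
  have IH: "(\<forall>c<k. fold (flip m n) (row_cells k r) y' (c, n) = harm_ext m n x c r / harm_ext m n x (Suc c) r) \<and>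
     (\<forall>j. j \<noteq> (m, r) \<and> j \<notin> {..<k} \<times> {n} \<longrightarrow> fold (flip m n) (row_cells k r) y' j = y' j)"
    using Suc.prems k y' by (intro Suc.IH) auto
  have z: "fold (flip m n) (row_cells (Suc k) r) y = fold (flip m n) (row_cells k r) y'"
    by (simp add: row_cells_Suc y'_def)
  show ?case unfolding z
  proof (intro conjI allI impI)
    fix c assume "c < Suc k"
    then show "fold (flip m n) (row_cells k r) y' (c, n) = harm_ext m n x c r / harm_ext m n x (Suc c) r"
      using IH y'(1) k by (cases "c = k") auto
  next
    fix j assume "j \<noteq> (m, r) \<and> j \<notin> {..<Suc k} \<times> {n}"
    then show "fold (flip m n) (row_cells k r) y' j = y j"
      using IH y'(3)[of j] by (cases j) auto
  qed
qed

lemma fold_flip_cells: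
  assumes x: "\<forall>k\<in>grid m n. 0 < x k \<and> x k < 1" and "k \<le> n"
    and "\<And>c. c < m \<Longrightarrow> y (c, n) = harm_ext m n x c k / harm_ext m n x (Suc c) k"
    and "\<And>j. j \<in> bulk m k \<union> {m} \<times> {..<k} \<Longrightarrow> y j = x j"
    and "c < m"
  shows "fold (flip m n) (cells m k) y (c, n) = harm_ext m n x c 0 / harm_ext m n x (Suc c) 0"
  using assms(2-4)
proof (induction k arbitrary: y)
  case 0
  then show ?case using assms(5) by (simp add: cells_def)
next
  case (Suc k)
  define z where "z = fold (flip m n) (row_cells m k) y"
  have k: "k < n" using Suc.prems by simp
  have "harm_ext m n x m (Suc k) \<noteq> 0" using harm_ext_pos[OF x, of m "Suc k"] k by simp
  then have "y (m, k) = harm_ext m n x m (Suc k) / harm_ext m n x m k"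
    using Suc.prems(3)[of "(m, k)"] k by (simp add: harm_ext_simps(3)[of k n m])
  then have z: "(\<forall>c<m. z (c, n) = harm_ext m n x c k / harm_ext m n x (Suc c) k) \<and>
     (\<forall>j. j \<noteq> (m, k) \<and> j \<notin> {..<m} \<times> {n} \<longrightarrow> z j = y j)"
    unfolding z_def using k Suc.prems by (intro fold_flip_row[OF x]) (auto simp: bulk_def)
  have "fold (flip m n) (cells m k) z (c, n) = harm_ext m n x c 0 / harm_ext m n x (Suc c) 0"
  proof (rule Suc.IH)
    fix j assume j: "j \<in> bulk m k \<union> {m} \<times> {..<k}"
    then have "z j = y j" using z k by (auto simp: bulk_def)
    also have "y j = x j" using j by (intro Suc.prems) (auto simp: bulk_def)
    finally show "z j = x j" .
  qed (use z k in auto)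
  then show ?case by (simp add: cells_Suc z_def)
qed

text \<open>The ratios telescope from (0, 0) along the bottom side to (m, 0); the right side leads
  on to the corner (m, n), where the value is 1.\<close>

lemma harm_ext_factorization:
  assumes x: "\<forall>k\<in>grid m n. 0 < x k \<and> x k < 1"
  shows "harm_ext m n x 0 0 =
     (\<Prod>c<m. fold (flip m n) (cells m n) x (c, n)) * (\<Prod>r<n. 1 / x (m, r))"
    and "c < m \<Longrightarrow> fold (flip m n) (cells m n) x (c, n) > 0"
proof -
  have ne: "harm_ext m n x a b \<noteq> 0" if "a \<le> m" "b \<le> n" for a b
    using harm_ext_pos[OF x that] by simp
  have eq: "fold (flip m n) (cells m n) x (c, n) = harm_ext m n x c 0 / harm_ext m n x (Suc c) 0" if "c < m" for c
    using that ne by (intro fold_flip_cells[OF x]) (auto simp: harm_ext_simps(2))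
  have "(\<Prod>c<k. harm_ext m n x c 0 / harm_ext m n x (Suc c) 0) = harm_ext m n x 0 0 / harm_ext m n x k 0" if "k \<le> m" for k
    using that by (induction k) (auto simp: ne)
  from this[of m] have "(\<Prod>c<m. fold (flip m n) (cells m n) x (c, n)) = harm_ext m n x 0 0 / harm_ext m n x m 0"
    by (simp add: eq)
  then show "harm_ext m n x 0 0 =
     (\<Prod>c<m. fold (flip m n) (cells m n) x (c, n)) * (\<Prod>r<n. 1 / x (m, r))"
    using ne[of m 0] harm_ext_right[of 0 n m x] by (simp add: atLeast0LessThan)
  show "c < m \<Longrightarrow> fold (flip m n) (cells m n) x (c, n) > 0"
    using eq harm_ext_pos[OF x] by simp
qed

text \<open>Moments of order \<open>s\<close> of the ratios along horizontal and vertical boundary edges.\<close>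

definition mom_h :: "real \<Rightarrow> real \<Rightarrow> real \<Rightarrow> real \<Rightarrow> real" where
  "mom_h \<alpha> \<beta> l s = Beta (\<alpha> + l + s) \<beta> / Beta (\<alpha> + l) \<beta>"

definition mom_v :: "real \<Rightarrow> real \<Rightarrow> real \<Rightarrow> real" where
  "mom_v \<alpha> l s = Beta (l - s) \<alpha> / Beta l \<alpha>"

context
  fixes \<alpha> \<beta> l :: real
  assumes pos: "\<alpha> > 0" "\<beta> > 0" "l > 0"
begin

lemma mom_h_pos: "- (\<alpha> + l) < s \<Longrightarrow> mom_h \<alpha> \<beta> l s > 0"
  using pos by (simp add: mom_h_def Beta_pos)

lemma mom_v_pos: "s < l \<Longrightarrow> mom_v \<alpha> l s > 0"
  using pos by (simp add: mom_v_def Beta_pos)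

lemma site_law_top_moment:
  assumes "c < m" "- (\<alpha> + l) < s"
  shows "(\<integral>\<^sup>+t. ennreal (t powr s) \<partial>site_law \<alpha> \<beta> l m n (c, n)) = ennreal (mom_h \<alpha> \<beta> l s)"
proof -
  have "(\<integral>\<^sup>+t. ennreal (t powr s) \<partial>beta_measure (\<alpha> + l) \<beta>) = (\<integral>\<^sup>+t. ennreal (t powr s * (1 - t) powr 0) \<partial>beta_measure (\<alpha> + l) \<beta>)"
    by (rule nn_integral_cong_AE, use AE_beta_measure in eventually_elim) simp
  then show ?thesis
    using beta_measure_moment[of "\<alpha> + l" \<beta> s 0] pos assms by (simp add: site_law_def mom_h_def)
qed

lemma site_law_right_moment:
  assumes "s < l"
  shows "(\<integral>\<^sup>+t. ennreal ((1 / t) powr s) \<partial>site_law \<alpha> \<beta> l m n (m, r)) = ennreal (mom_v \<alpha> l s)"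
proof -
  have "(\<integral>\<^sup>+t. ennreal ((1 / t) powr s) \<partial>beta_measure l \<alpha>) = (\<integral>\<^sup>+t. ennreal (t powr - s * (1 - t) powr 0) \<partial>beta_measure l \<alpha>)"
    by (rule nn_integral_cong_AE, use AE_beta_measure in eventually_elim) (simp add: powr_divide powr_minus_divide)
  then show ?thesis
    using beta_measure_moment[of l \<alpha> "-s" 0] pos assms by (simp add: site_law_def mom_v_def)
qed

text \<open>Fubini: boundary coordinates are independent of the bulk and of each other, and those
  outside S integrate to 1.\<close>

lemma nn_integral_grid_boundary:
  assumes S: "S \<subseteq> boundary m n"
    and \<Phi>[measurable]: "\<Phi> \<in> borel_measurable (PiM (bulk m n) (\<lambda>_. borel))"
    and dep: "\<And>x. \<Phi> (restrict x (bulk m n)) = \<Phi> x"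
    and f[measurable]: "\<And>k. f k \<in> borel_measurable borel"
  shows "(\<integral>\<^sup>+x. \<Phi> x * (\<Prod>k\<in>S. f k (x k)) \<partial>grid_measure \<alpha> \<beta> l m n) =
     (\<integral>\<^sup>+x. \<Phi> x \<partial>bulk_measure \<alpha> \<beta> m n) * (\<Prod>k\<in>S. \<integral>\<^sup>+t. f k t \<partial>site_law \<alpha> \<beta> l m n k)"
proof -
  let ?M = "site_law \<alpha> \<beta> l m n"
  interpret product_sigma_finite ?M by (rule product_sigma_finite_site_law[OF pos])
  have disj: "bulk m n \<inter> boundary m n = {}" by (auto simp: bulk_def boundary_def)
  have cong: "borel_measurable (PiM K ?M) = borel_measurable (PiM K (\<lambda>_. borel))" for K
    by (intro measurable_cong_sets sets_PiM_cong) auto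
  have bulk: "PiM (bulk m n) ?M = bulk_measure \<alpha> \<beta> m n"
    unfolding bulk_measure_def by (intro PiM_cong) (auto simp: site_law_def bulk_def)
  have fin: "finite S" using S finite_subset[OF S] by simp
  have r: "(\<lambda>x. restrict x (bulk m n)) \<in> measurable (PiM (grid m n) (\<lambda>_. borel)) (PiM (bulk m n) (\<lambda>_. borel :: real measure))"
    by (rule measurable_restrict_subset) (auto simp: grid_def)
  have \<Phi>g[measurable]: "\<Phi> \<in> borel_measurable (PiM (grid m n) (\<lambda>_. borel))"
    using measurable_compose[OF r \<Phi>] by (simp add: dep)
  have "(\<integral>\<^sup>+x. \<Phi> x * (\<Prod>k\<in>S. f k (x k)) \<partial>grid_measure \<alpha> \<beta> l m n) =
    (\<integral>\<^sup>+x. \<integral>\<^sup>+y. \<Phi> (merge (bulk m n) (boundary m n) (x, y)) * (\<Prod>k\<in>S. f k (merge (bulk m n) (boundary m n) (x, y) k))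
       \<partial>PiM (boundary m n) ?M \<partial>PiM (bulk m n) ?M)"
    unfolding grid_measure_def grid_def
    by (intro product_nn_integral_fold disj finite_grid) (simp only: cong grid_def[symmetric], measurable)
  also have "\<dots> = (\<integral>\<^sup>+x. \<Phi> x * (\<integral>\<^sup>+y. (\<Prod>k\<in>S. f k (y k)) \<partial>PiM (boundary m n) ?M) \<partial>PiM (bulk m n) ?M)"
  proof (rule nn_integral_cong)
    fix x assume x: "x \<in> space (PiM (bulk m n) ?M)"
    have "\<Phi> (merge (bulk m n) (boundary m n) (x, y)) = \<Phi> x" for y
    proof -
      have "restrict (merge (bulk m n) (boundary m n) (x, y)) (bulk m n) = restrict x (bulk m n)"
        by (auto simp: fun_eq_iff merge_def)
      then show ?thesis using dep by metis
    qed
    moreover have "(\<Prod>k\<in>S. f k (merge (bulk m n) (boundary m n) (x, y) k)) = (\<Prod>k\<in>S. f k (y k))" for y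
      using S disj by (intro prod.cong) (auto simp: merge_def)
    ultimately show "(\<integral>\<^sup>+y. \<Phi> (merge (bulk m n) (boundary m n) (x, y)) * (\<Prod>k\<in>S. f k (merge (bulk m n) (boundary m n) (x, y) k))
       \<partial>PiM (boundary m n) ?M) = \<Phi> x * (\<integral>\<^sup>+y. (\<Prod>k\<in>S. f k (y k)) \<partial>PiM (boundary m n) ?M)"
      by (simp, intro nn_integral_cmult) (simp only: cong, measurable)
  qed
  also have "\<dots> = (\<integral>\<^sup>+x. \<Phi> x \<partial>bulk_measure \<alpha> \<beta> m n) * (\<integral>\<^sup>+y. (\<Prod>k\<in>S. f k (y k)) \<partial>PiM (boundary m n) ?M)"
    unfolding bulk by (rule nn_integral_multc) measurable
  also have "(\<integral>\<^sup>+y. (\<Prod>k\<in>S. f k (y k)) \<partial>PiM (boundary m n) ?M) =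
     (\<integral>\<^sup>+y. (\<Prod>k\<in>boundary m n. (if k \<in> S then f k else (\<lambda>_. 1)) (y k)) \<partial>PiM (boundary m n) ?M)"
    using S by (intro nn_integral_cong prod.mono_neutral_cong_left) auto
  also have "\<dots> = (\<Prod>k\<in>boundary m n. \<integral>\<^sup>+t. (if k \<in> S then f k else (\<lambda>_. 1)) t \<partial>?M k)"
  proof (rule product_nn_integral_prod)
    fix k
    have "f k \<in> borel_measurable (?M k)" using f[of k] by (simp cong: measurable_cong_sets)
    then show "(if k \<in> S then f k else (\<lambda>_. 1)) \<in> borel_measurable (?M k)" by simp
  qed simp
  also have "\<dots> = (\<Prod>k\<in>S. \<integral>\<^sup>+t. f k t \<partial>?M k)"
    using S prob_space.emeasure_space_1[OF prob_space_site_law[OF pos]]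
    by (intro prod.mono_neutral_cong_right) auto
  finally show ?thesis .
qed

lemma nn_integral_grid_bulk:
  assumes "\<Phi> \<in> borel_measurable (PiM (bulk m n) (\<lambda>_. borel))" "\<And>x. \<Phi> (restrict x (bulk m n)) = \<Phi> x"
  shows "(\<integral>\<^sup>+x. \<Phi> x \<partial>grid_measure \<alpha> \<beta> l m n) = (\<integral>\<^sup>+x. \<Phi> x \<partial>bulk_measure \<alpha> \<beta> m n)"
  using nn_integral_grid_boundary[OF empty_subsetI assms, of "\<lambda>_ _. 1"] by simp

lemma nn_integral_grid_top:
  assumes "- (\<alpha> + l) < s"
  shows "(\<integral>\<^sup>+x. (\<Prod>c<m. ennreal (x (c, n) powr s)) \<partial>grid_measure \<alpha> \<beta> l m n) = ennreal (mom_h \<alpha> \<beta> l s) ^ m"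
proof -
  have "(\<integral>\<^sup>+x. 1 * (\<Prod>k\<in>{..<m}\<times>{n}. ennreal (x k powr s)) \<partial>grid_measure \<alpha> \<beta> l m n) =
     (\<integral>\<^sup>+x. 1 \<partial>bulk_measure \<alpha> \<beta> m n) * (\<Prod>k\<in>{..<m}\<times>{n}. \<integral>\<^sup>+t. ennreal (t powr s) \<partial>site_law \<alpha> \<beta> l m n k)"
    by (rule nn_integral_grid_boundary) (auto simp: boundary_def)
  also have "{..<m}\<times>{n} = (\<lambda>c. (c, n)) ` {..<m}" by auto
  finally show ?thesis
    using site_law_top_moment[OF _ assms] prob_space.emeasure_space_1[OF prob_space_bulk_measure[OF pos]]
    by (simp add: prod.reindex inj_on_def)
qed

lemma nn_integral_grid_right:
  assumes "s < l"
  shows "(\<integral>\<^sup>+x. (\<Prod>r<n. ennreal ((1 / x (m, r)) powr s)) \<partial>grid_measure \<alpha> \<beta> l m n) = ennreal (mom_v \<alpha> l s) ^ n"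
proof -
  have "(\<integral>\<^sup>+x. 1 * (\<Prod>k\<in>{m}\<times>{..<n}. ennreal ((1 / x k) powr s)) \<partial>grid_measure \<alpha> \<beta> l m n) =
     (\<integral>\<^sup>+x. 1 \<partial>bulk_measure \<alpha> \<beta> m n) * (\<Prod>k\<in>{m}\<times>{..<n}. \<integral>\<^sup>+t. ennreal ((1 / t) powr s) \<partial>site_law \<alpha> \<beta> l m n k)"
    by (rule nn_integral_grid_boundary) (auto simp: boundary_def)
  also have "{m}\<times>{..<n} = (\<lambda>r. (m, r)) ` {..<n}" by auto
  finally show ?thesis
    using site_law_right_moment[OF assms] prob_space.emeasure_space_1[OF prob_space_bulk_measure[OF pos]]
    by (simp add: prod.reindex inj_on_def)
qed

text \<open>
  Ratios along the bottom and along the right side are not independent of each other; the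
  Cauchy-Schwarz inequality decouples them at the price of doubling the exponent.
\<close>

definition harm_bound :: "nat \<Rightarrow> nat \<Rightarrow> real \<Rightarrow> real" where
  "harm_bound m n s = exp ((real m * ln (mom_h \<alpha> \<beta> l (2 * s)) + real n * ln (mom_v \<alpha> l (2 * s))) / 2)"

text \<open>The first factor becomes a product of independent variables by invariance under the
  sweep, the second one is so from the start; their squares have explicit moments. Both signs of s
  occur: positive orders control upper tails of the harmonic function, negative orders its lower
  tail.\<close>

lemma harm_ext_moment:
  assumes s: "- (\<alpha> + l) < 2 * s" "2 * s < l"
  shows "(\<integral>\<^sup>+x. ennreal (harm_ext m n x 0 0 powr s) \<partial>grid_measure \<alpha> \<beta> l m n) \<le> ennreal (harm_bound m n s)"
proof -
  let ?P = "grid_measure \<alpha> \<beta> l m n" and ?F = "fold (flip m n) (cells m n)"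
  have Fm[measurable]: "?F \<in> measurable (PiM (grid m n) (\<lambda>_. borel)) (PiM (grid m n) (\<lambda>_. borel))"
    by (rule fold_flip_measurable) (simp add: set_cells)
  define A where "A x = (\<Prod>c<m. ennreal (?F x (c, n) powr s))" for x
  define B where "B x = (\<Prod>r<n. ennreal ((1 / x (m, r)) powr s))" for x :: "nat \<times> nat \<Rightarrow> real"
  have Fc[measurable]: "(\<lambda>x. ?F x k) \<in> borel_measurable (PiM (grid m n) (\<lambda>_. borel))" for k
    by (rule measurable_compose[OF Fm measurable_PiM_coordinate])
  have [measurable]: "A \<in> borel_measurable ?P" "B \<in> borel_measurable ?P"
    unfolding A_def[abs_def] B_def[abs_def] by measurable
  have sq: "ennreal (t powr s) ^ 2 = ennreal (t powr (2 * s))" for t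
    by (simp add: power2_eq_square ennreal_mult[symmetric] powr_add[symmetric])
  have "(\<integral>\<^sup>+x. A x ^ 2 \<partial>?P) = (\<integral>\<^sup>+x. (\<Prod>c<m. ennreal (?F x (c, n) powr (2 * s))) \<partial>?P)"
    by (simp add: A_def prod_power_distrib sq)
  also have "\<dots> = (\<integral>\<^sup>+x. (\<Prod>c<m. ennreal (x (c, n) powr (2 * s))) \<partial>?P)"
    by (rule nn_integral_fold_flip[OF pos, where f = "\<lambda>x. \<Prod>c<m. ennreal (x (c, n) powr (2 * s))"])
      (auto simp: distinct_cells set_cells bulk_def intro!: prod.cong)
  also have "\<dots> = ennreal (mom_h \<alpha> \<beta> l (2 * s)) ^ m"
    using s by (intro nn_integral_grid_top) auto
  finally have A2: "(\<integral>\<^sup>+x. A x ^ 2 \<partial>?P) = ennreal (mom_h \<alpha> \<beta> l (2 * s) ^ m)"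
    using mom_h_pos[of "2 * s"] s by (simp add: ennreal_power)
  have "(\<integral>\<^sup>+x. B x ^ 2 \<partial>?P) = ennreal (mom_v \<alpha> l (2 * s)) ^ n"
    using nn_integral_grid_right[OF s(2), of m n] by (simp add: B_def prod_power_distrib sq)
  then have B2: "(\<integral>\<^sup>+x. B x ^ 2 \<partial>?P) = ennreal (mom_v \<alpha> l (2 * s) ^ n)"
    using mom_v_pos[of "2 * s"] s by (simp add: ennreal_power)
  have "(\<integral>\<^sup>+x. ennreal (harm_ext m n x 0 0 powr s) \<partial>?P) = (\<integral>\<^sup>+x. A x * B x \<partial>?P)"
  proof (rule nn_integral_cong_AE, use AE_grid_measure[OF pos, of m n] in eventually_elim)
    case (elim x)
    have "harm_ext m n x 0 0 powr s = (\<Prod>c<m. ?F x (c, n) powr s) * (\<Prod>r<n. (1 / x (m, r)) powr s)"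
      by (simp only: harm_ext_factorization(1)[OF elim] powr_mult prod_powr_distrib)
    then show "ennreal (harm_ext m n x 0 0 powr s) = A x * B x"
      unfolding A_def B_def by (simp add: ennreal_mult prod_ennreal prod_nonneg)
  qed
  moreover have "(\<integral>\<^sup>+x. A x * B x \<partial>?P)\<^sup>2 \<le> (\<integral>\<^sup>+x. A x ^ 2 \<partial>?P) * (\<integral>\<^sup>+x. B x ^ 2 \<partial>?P)"
    by (rule Cauchy_Schwarz_nn_integral) measurable
  moreover have "(\<integral>\<^sup>+x. A x ^ 2 \<partial>?P) * (\<integral>\<^sup>+x. B x ^ 2 \<partial>?P) = ennreal ((harm_bound m n s)\<^sup>2)"
  proof -
    have "(harm_bound m n s)\<^sup>2 = exp (real m * ln (mom_h \<alpha> \<beta> l (2 * s)) + real n * ln (mom_v \<alpha> l (2 * s)))"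
      unfolding harm_bound_def exp_double[symmetric] by simp
    then have "mom_h \<alpha> \<beta> l (2 * s) ^ m * mom_v \<alpha> l (2 * s) ^ n = (harm_bound m n s)\<^sup>2"
      using mom_h_pos[of "2 * s"] mom_v_pos[of "2 * s"] s by (simp add: exp_add exp_of_nat_mult)
    then show ?thesis
      unfolding A2 B2 using mom_h_pos[of "2 * s"] mom_v_pos[of "2 * s"] s by (simp add: ennreal_mult[symmetric])
  qed
  ultimately have "(\<integral>\<^sup>+x. ennreal (harm_ext m n x 0 0 powr s) \<partial>?P)\<^sup>2 \<le> (ennreal (harm_bound m n s))\<^sup>2"
    by (simp add: ennreal_power harm_bound_def)
  then show ?thesis
    by (cases "\<integral>\<^sup>+x. ennreal (harm_ext m n x 0 0 powr s) \<partial>?P" rule: ennreal_cases)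
      (auto simp: ennreal_power harm_bound_def ennreal_le_iff abs_le_square_iff[symmetric] ennreal_top_eq_mult_iff power2_eq_square[of \<top>] top_unique)
qed

end

section \<open>Exit points of the walk\<close>

text \<open>The quenched probability that the walk from the origin passes through (c, r), decomposed
  by its last step.\<close>

fun reach :: "(nat \<times> nat \<Rightarrow> real) \<Rightarrow> nat \<Rightarrow> nat \<Rightarrow> real" where
  "reach w 0 0 = 1"
| "reach w (Suc c) 0 = w (c, 0) * reach w c 0"
| "reach w 0 (Suc r) = (1 - w (0, r)) * reach w 0 r"
| "reach w (Suc c) (Suc r) = w (c, Suc r) * reach w c (Suc r) + (1 - w (Suc c, r)) * reach w (Suc c) r"

definition exit_right :: "(nat \<times> nat \<Rightarrow> real) \<Rightarrow> nat \<Rightarrow> nat \<Rightarrow> real" where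
  "exit_right w c r = w (c, r) * reach w c r"

definition exit_top :: "(nat \<times> nat \<Rightarrow> real) \<Rightarrow> nat \<Rightarrow> nat \<Rightarrow> real" where
  "exit_top w c r = (1 - w (c, r)) * reach w c r"

lemma reach_measurable_family:
  assumes "\<And>k. (\<lambda>s. X s k) \<in> borel_measurable N"
  shows "(\<lambda>s. reach (X s) c r) \<in> borel_measurable N"
proof -
  note assms[measurable]
  \<comment> \<open>The variable \<open>w\<close> only provides the first argument on which
    \<open>reach.induct\<close> runs.\<close>
  have "(\<lambda>s. reach (X s) c r) \<in> borel_measurable N" for w :: "nat \<times> nat \<Rightarrow> real"
    by (induction w c r rule: reach.induct) simp_all
  then show ?thesis .
qed

lemma reach_measurable [measurable]: "(\<lambda>w. reach w c r) \<in> borel_measurable (PiM K (\<lambda>_. borel))"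
  by (rule reach_measurable_family) measurable

lemma exit_measurable [measurable]:
  "(\<lambda>w. exit_right w c r) \<in> borel_measurable (PiM K (\<lambda>_. borel))"
  "(\<lambda>w. exit_top w c r) \<in> borel_measurable (PiM K (\<lambda>_. borel))"
  unfolding exit_right_def exit_top_def by measurable

lemma reach_restrict:
  "c < m \<Longrightarrow> r < n \<Longrightarrow> reach (restrict w (bulk m n)) c r = reach w c r"
  by (induction w c r rule: reach.induct) (auto simp: bulk_def)

lemma exit_restrict:
  assumes "c < m" "r < n"
  shows "exit_right (restrict w (bulk m n)) c r = exit_right w c r"
    "exit_top (restrict w (bulk m n)) c r = exit_top w c r"
proof -
  have "(c, r) \<in> bulk m n" using assms by (simp add: bulk_def)
  then show "exit_right (restrict w (bulk m n)) c r = exit_right w c r"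
    "exit_top (restrict w (bulk m n)) c r = exit_top w c r"
    by (simp_all add: exit_right_def exit_top_def reach_restrict[OF assms])
qed

lemma reach_pos:
  assumes "\<forall>k\<in>bulk m n. 0 < w k \<and> w k < 1" "c < m" "r < n"
  shows "reach w c r > 0"
  using assms
proof (induction w c r rule: reach.induct)
  case (4 w c r)
  then have "reach w c (Suc r) > 0" "reach w (Suc c) r > 0"
    "0 < w (c, Suc r)" "w (Suc c, r) < 1" by (auto simp: bulk_def)
  then show ?case by (simp add: add_pos_pos)
qed (auto simp: bulk_def)

lemma exit_pos:
  assumes "\<forall>k\<in>bulk m n. 0 < w k \<and> w k < 1" "c < m" "r < n"
  shows "exit_right w c r > 0" "exit_top w c r > 0"
  using reach_pos[OF assms(1), of c r] assms by (auto simp: exit_right_def exit_top_def bulk_def)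

text \<open>Row \<open>0\<close> counts as entered at column \<open>0\<close>, the starting point.\<close>

definition row_entry :: "(nat \<times> nat \<Rightarrow> real) \<Rightarrow> nat \<Rightarrow> nat \<Rightarrow> real" where
  "row_entry w r c = (case r of 0 \<Rightarrow> (if c = 0 then 1 else 0) | Suc q \<Rightarrow> exit_top w c q)"

lemma reach_eq_row_entry:
  "reach w c r = (case c of 0 \<Rightarrow> 0 | Suc b \<Rightarrow> exit_right w b r) + row_entry w r c"
  by (cases c; cases r) (simp_all add: exit_right_def exit_top_def row_entry_def)

text \<open>Conservation of the martingale h over one row: what enters row r in the first k columns
  leaves it through the right edge of the last of them or upwards into the next row.\<close>

lemma row_flow:
  assumes harm: "\<And>c. c < k \<Longrightarrow> h c r = w (c, r) * h (Suc c) r + (1 - w (c, r)) * h c (Suc r)"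
  shows "(\<Sum>c<k. row_entry w r c * h c r) =
     (case k of 0 \<Rightarrow> 0 | Suc b \<Rightarrow> exit_right w b r * h k r) + (\<Sum>c<k. row_entry w (Suc r) c * h c (Suc r))"
  using assms
proof (induction k)
  case (Suc k)
  have IH: "(\<Sum>c<k. row_entry w r c * h c r) =
     (case k of 0 \<Rightarrow> 0 | Suc b \<Rightarrow> exit_right w b r * h k r) + (\<Sum>c<k. row_entry w (Suc r) c * h c (Suc r))"
    by (rule Suc.IH) (rule Suc.prems, simp)
  have "(\<Sum>c<Suc k. row_entry w r c * h c r) =
     ((case k of 0 \<Rightarrow> 0 | Suc b \<Rightarrow> exit_right w b r) + row_entry w r k) * h k r
        + (\<Sum>c<k. row_entry w (Suc r) c * h c (Suc r))"
    unfolding sum.lessThan_Suc IH by (simp add: algebra_simps split: nat.splits)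
  also have "\<dots> = reach w k r * (w (k, r) * h (Suc k) r + (1 - w (k, r)) * h k (Suc r))
       + (\<Sum>c<k. row_entry w (Suc r) c * h c (Suc r))"
    using Suc.prems[of k] by (simp add: reach_eq_row_entry)
  finally show ?case by (simp add: exit_right_def exit_top_def row_entry_def algebra_simps)
qed simp

text \<open>Optional stopping for the harmonic function h at the first exit from the rectangle
  [0, m] \<times> [0, n].\<close>

lemma exit_decomposition:
  assumes harm: "\<And>c r. c \<le> m \<Longrightarrow> r \<le> n \<Longrightarrow> h c r = w (c, r) * h (Suc c) r + (1 - w (c, r)) * h c (Suc r)"
  shows "h 0 0 = (\<Sum>r\<le>n. exit_right w m r * h (Suc m) r) + (\<Sum>c\<le>m. exit_top w c n * h c (Suc n))"
proof -
  have "(\<Sum>c<Suc m. row_entry w 0 c * h c 0) =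
     (\<Sum>r<j. exit_right w m r * h (Suc m) r) + (\<Sum>c<Suc m. row_entry w j c * h c j)" if "j \<le> Suc n" for j
    using that
  proof (induction j)
    case (Suc j)
    have "(\<Sum>c<Suc m. row_entry w j c * h c j) =
      exit_right w m j * h (Suc m) j + (\<Sum>c<Suc m. row_entry w (Suc j) c * h c (Suc j))"
      using Suc.prems by (subst row_flow) (auto intro!: harm)
    with Suc show ?case by simp
  qed simp
  from this[of "Suc n"] have "(\<Sum>c<Suc m. row_entry w 0 c * h c 0) =
    (\<Sum>r\<le>n. exit_right w m r * h (Suc m) r) + (\<Sum>c\<le>m. exit_top w c n * h c (Suc n))"
    by (simp add: row_entry_def lessThan_Suc_atMost)
  moreover have "(\<Sum>c<Suc m. row_entry w 0 c * h c 0) = (\<Sum>c\<in>{0}. row_entry w 0 c * h c 0)"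
    by (rule sum.mono_neutral_right) (auto simp: row_entry_def)
  ultimately show ?thesis by (simp add: row_entry_def)
qed

lemma harm_ext_exit_decomposition:
  "harm_ext (Suc m) (Suc n) x 0 0 =
     (\<Sum>r\<le>n. exit_right x m r * (\<Prod>k\<in>{r..n}. 1 / x (Suc m, k))) +
     (\<Sum>c\<le>m. exit_top x c n * (\<Prod>k\<in>{c..m}. x (k, Suc n)))"
proof -
  have "harm_ext (Suc m) (Suc n) x 0 0 =
     (\<Sum>r\<le>n. exit_right x m r * harm_ext (Suc m) (Suc n) x (Suc m) r) +
     (\<Sum>c\<le>m. exit_top x c n * harm_ext (Suc m) (Suc n) x c (Suc n))"
    by (rule exit_decomposition) (simp add: harm_ext_simps(1))
  then show ?thesis
    by (simp add: harm_ext_top harm_ext_right atLeastLessThanSuc_atLeastAtMost)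
qed

lemma exit_term_nonneg:
  assumes "\<forall>k\<in>grid (Suc m) (Suc n). 0 < x k \<and> x k < 1"
  shows "r \<le> n \<Longrightarrow> 0 \<le> exit_right x m r * (\<Prod>k\<in>{r..n}. 1 / x (Suc m, k))"
    "c \<le> m \<Longrightarrow> 0 \<le> exit_top x c n * (\<Prod>k\<in>{c..m}. x (k, Suc n))"
proof -
  have b: "\<forall>k\<in>bulk (Suc m) (Suc n). 0 < x k \<and> x k < 1" using assms by (auto simp: grid_def)
  show "r \<le> n \<Longrightarrow> 0 \<le> exit_right x m r * (\<Prod>k\<in>{r..n}. 1 / x (Suc m, k))"
    using exit_pos(1)[OF b, of m r] assms
    by (auto intro!: mult_nonneg_nonneg prod_nonneg simp: less_imp_le grid_def boundary_def)
  show "c \<le> m \<Longrightarrow> 0 \<le> exit_top x c n * (\<Prod>k\<in>{c..m}. x (k, Suc n))"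
    using exit_pos(2)[OF b, of c n] assms
    by (auto intro!: mult_nonneg_nonneg prod_nonneg simp: less_imp_le grid_def boundary_def)
qed

lemma exit_term_le_harm_ext:
  assumes "\<forall>k\<in>grid (Suc m) (Suc n). 0 < x k \<and> x k < 1"
  shows "r \<le> n \<Longrightarrow> exit_right x m r * (\<Prod>k\<in>{r..n}. 1 / x (Suc m, k)) \<le> harm_ext (Suc m) (Suc n) x 0 0"
    "c \<le> m \<Longrightarrow> exit_top x c n * (\<Prod>k\<in>{c..m}. x (k, Suc n)) \<le> harm_ext (Suc m) (Suc n) x 0 0"
  unfolding harm_ext_exit_decomposition
  by (rule add_increasing2 add_increasing; (rule sum_nonneg exit_term_nonneg[OF assms] member_le_sum)?; auto intro!: exit_term_nonneg[OF assms])+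

section \<open>Moment bounds for exit probabilities\<close>

lemma powr_sum_le:
  fixes f :: "'a \<Rightarrow> real"
  assumes "finite A" "\<And>a. a \<in> A \<Longrightarrow> f a \<ge> 0" "0 < s" "s \<le> 1"
  shows "(\<Sum>a\<in>A. f a) powr s \<le> (\<Sum>a\<in>A. f a powr s)"
proof (cases "(\<Sum>a\<in>A. f a) = 0")
  case False
  define S where "S = (\<Sum>a\<in>A. f a)"
  have S: "S > 0" using False assms sum_nonneg[of A f] by (simp add: S_def order_less_le)
  \<comment> \<open>After division by the total every term lies in [0, 1], where u \<le> u powr
    s.\<close>
  have "1 = (\<Sum>a\<in>A. f a / S)" using S by (simp add: S_def sum_divide_distrib[symmetric])
  also have "\<dots> \<le> (\<Sum>a\<in>A. (f a / S) powr s)"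
  proof (rule sum_mono)
    fix a assume a: "a \<in> A"
    then have "f a \<le> S" using assms by (auto simp: S_def intro: member_le_sum)
    then have "0 \<le> f a / S" "f a / S \<le> 1" using S a assms by auto
    then show "f a / S \<le> (f a / S) powr s"
      using powr_mono'[of s 1 "f a / S"] assms(2)[OF a] assms(3,4) S by simp
  qed
  also have "\<dots> = (\<Sum>a\<in>A. f a powr s) / S powr s"
    using S assms by (simp add: powr_divide sum_divide_distrib)
  finally show ?thesis using S by (simp add: S_def[symmetric] pos_le_divide_eq)
qed (use assms in \<open>simp add: sum_nonneg\<close>)

text \<open>The event enters only through \<open>le\<close>, so the same lemma serves upper tails
  with a positive exponent and lower tails with a negative one.\<close>

lemma emeasure_powr_Markov:
  assumes [measurable]: "f \<in> borel_measurable M" "{x\<in>space M. P x} \<in> sets M"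
    and C: "C \<ge> 0" and le: "AE x in M. P x \<longrightarrow> 1 \<le> C * f x powr s"
    and I: "(\<integral>\<^sup>+x. ennreal (f x powr s) \<partial>M) \<le> ennreal D"
  shows "emeasure M {x\<in>space M. P x} \<le> ennreal (C * D)"
proof -
  have "emeasure M {x\<in>space M. P x} = (\<integral>\<^sup>+x. indicator {x\<in>space M. P x} x \<partial>M)" by simp
  also have "\<dots> \<le> (\<integral>\<^sup>+x. ennreal C * ennreal (f x powr s) \<partial>M)"
    by (rule nn_integral_mono_AE, use le in eventually_elim)
      (use C in \<open>auto simp: indicator_def ennreal_mult[symmetric] simp del: ennreal_1 simp flip: ennreal_1\<close>)
  also have "\<dots> = ennreal C * (\<integral>\<^sup>+x. ennreal (f x powr s) \<partial>M)"
    by (rule nn_integral_cmult) measurable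
  also have "\<dots> \<le> ennreal C * ennreal D" by (intro mult_left_mono I) simp
  also have "\<dots> = ennreal (C * D)" using C by (simp add: ennreal_mult')
  finally show ?thesis .
qed

lemma ennreal_le_divideI:
  assumes "X * ennreal d \<le> ennreal b" "d > 0"
  shows "X \<le> ennreal (b / d)"
proof -
  have "X = X * ennreal d * ennreal (1 / d)"
    using assms(2) by (simp add: mult.assoc ennreal_mult'[symmetric])
  also have "\<dots> \<le> ennreal b * ennreal (1 / d)"
    using assms(1) by (intro mult_right_mono) auto
  also have "\<dots> = ennreal (b / d)" using assms(2) by (subst ennreal_mult''[symmetric]) auto
  finally show ?thesis .
qed

context
  fixes \<alpha> \<beta> l :: real
  assumes pos: "\<alpha> > 0" "\<beta> > 0" "l > 0"
begin

lemma exit_right_moment_eq: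
  assumes s: "0 < s" "s < l" and r: "r \<le> n"
  shows "(\<integral>\<^sup>+x. ennreal ((exit_right x m r * (\<Prod>k\<in>{r..n}. 1 / x (Suc m, k))) powr s) \<partial>grid_measure \<alpha> \<beta> l (Suc m) (Suc n))
    = (\<integral>\<^sup>+x. ennreal (exit_right x m r powr s) \<partial>bulk_measure \<alpha> \<beta> (Suc m) (Suc n)) * ennreal (mom_v \<alpha> l s ^ (Suc n - r))"
proof -
  let ?S = "(\<lambda>k. (Suc m, k)) ` {r..n}"
  have "(\<integral>\<^sup>+x. ennreal ((exit_right x m r * (\<Prod>k\<in>{r..n}. 1 / x (Suc m, k))) powr s) \<partial>grid_measure \<alpha> \<beta> l (Suc m) (Suc n))
    = (\<integral>\<^sup>+x. ennreal (exit_right x m r powr s) * (\<Prod>k\<in>?S. ennreal ((1 / x k) powr s)) \<partial>grid_measure \<alpha> \<beta> l (Suc m) (Suc n))"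
    by (intro nn_integral_cong)
      (simp add: powr_mult prod_powr_distrib ennreal_mult prod_nonneg prod_ennreal prod.reindex inj_on_def)
  also have "\<dots> = (\<integral>\<^sup>+x. ennreal (exit_right x m r powr s) \<partial>bulk_measure \<alpha> \<beta> (Suc m) (Suc n)) *
      (\<Prod>k\<in>?S. \<integral>\<^sup>+t. ennreal ((1 / t) powr s) \<partial>site_law \<alpha> \<beta> l (Suc m) (Suc n) k)"
    using r by (intro nn_integral_grid_boundary[OF pos]) (auto simp: boundary_def exit_restrict)
  also have "(\<Prod>k\<in>?S. \<integral>\<^sup>+t. ennreal ((1 / t) powr s) \<partial>site_law \<alpha> \<beta> l (Suc m) (Suc n) k) = ennreal (mom_v \<alpha> l s ^ (Suc n - r))"
    using mom_v_pos[OF pos s(2)] by (simp add: prod.reindex inj_on_def site_law_right_moment[OF pos s(2)] ennreal_power less_imp_le)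
  finally show ?thesis .
qed

lemma exit_top_moment_eq:
  assumes s: "0 < s" and c: "c \<le> m"
  shows "(\<integral>\<^sup>+x. ennreal ((exit_top x c n * (\<Prod>k\<in>{c..m}. x (k, Suc n))) powr s) \<partial>grid_measure \<alpha> \<beta> l (Suc m) (Suc n))
    = (\<integral>\<^sup>+x. ennreal (exit_top x c n powr s) \<partial>bulk_measure \<alpha> \<beta> (Suc m) (Suc n)) * ennreal (mom_h \<alpha> \<beta> l s ^ (Suc m - c))"
proof -
  let ?S = "(\<lambda>k. (k, Suc n)) ` {c..m}"
  have s': "- (\<alpha> + l) < s" using s pos by simp
  have "(\<integral>\<^sup>+x. ennreal ((exit_top x c n * (\<Prod>k\<in>{c..m}. x (k, Suc n))) powr s) \<partial>grid_measure \<alpha> \<beta> l (Suc m) (Suc n))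
    = (\<integral>\<^sup>+x. ennreal (exit_top x c n powr s) * (\<Prod>k\<in>?S. ennreal (x k powr s)) \<partial>grid_measure \<alpha> \<beta> l (Suc m) (Suc n))"
    by (intro nn_integral_cong)
      (simp add: powr_mult prod_powr_distrib ennreal_mult prod_nonneg prod_ennreal prod.reindex inj_on_def)
  also have "\<dots> = (\<integral>\<^sup>+x. ennreal (exit_top x c n powr s) \<partial>bulk_measure \<alpha> \<beta> (Suc m) (Suc n)) *
      (\<Prod>k\<in>?S. \<integral>\<^sup>+t. ennreal (t powr s) \<partial>site_law \<alpha> \<beta> l (Suc m) (Suc n) k)"
    using c by (intro nn_integral_grid_boundary[OF pos]) (auto simp: boundary_def exit_restrict)
  also have "(\<Prod>k\<in>?S. \<integral>\<^sup>+t. ennreal (t powr s) \<partial>site_law \<alpha> \<beta> l (Suc m) (Suc n) k) = ennreal (mom_h \<alpha> \<beta> l s ^ (Suc m - c))"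
    using mom_h_pos[OF pos s'] c by (simp add: prod.reindex inj_on_def site_law_top_moment[OF pos _ s'] ennreal_power less_imp_le)
  finally show ?thesis .
qed

text \<open>One exit term is at most the whole harmonic function, and its boundary factor is
  independent of its bulk factor. Dividing by the moment of the former bounds a pure bulk moment,
  with l still free.\<close>

lemma exit_right_moment_bound:
  assumes s: "0 < s" "2 * s < l" and r: "r \<le> n"
  shows "(\<integral>\<^sup>+x. ennreal (exit_right x m r powr s) \<partial>bulk_measure \<alpha> \<beta> (Suc m) (Suc n))
    \<le> ennreal (harm_bound \<alpha> \<beta> l (Suc m) (Suc n) s / mom_v \<alpha> l s ^ (Suc n - r))"
proof -
  have "(\<integral>\<^sup>+x. ennreal (exit_right x m r powr s) \<partial>bulk_measure \<alpha> \<beta> (Suc m) (Suc n)) * ennreal (mom_v \<alpha> l s ^ (Suc n - r))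
    = (\<integral>\<^sup>+x. ennreal ((exit_right x m r * (\<Prod>k\<in>{r..n}. 1 / x (Suc m, k))) powr s) \<partial>grid_measure \<alpha> \<beta> l (Suc m) (Suc n))"
    using s r by (intro exit_right_moment_eq[symmetric]) auto
  also have "\<dots> \<le> (\<integral>\<^sup>+x. ennreal (harm_ext (Suc m) (Suc n) x 0 0 powr s) \<partial>grid_measure \<alpha> \<beta> l (Suc m) (Suc n))"
    by (rule nn_integral_mono_AE, use AE_grid_measure[OF pos, of "Suc m" "Suc n"] in eventually_elim)
      (use s r exit_term_le_harm_ext(1) exit_term_nonneg(1) in \<open>auto intro!: ennreal_leI powr_mono2\<close>)
  also have "\<dots> \<le> ennreal (harm_bound \<alpha> \<beta> l (Suc m) (Suc n) s)"
    using s pos by (intro harm_ext_moment[OF pos]) auto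
  finally show ?thesis
    using mom_v_pos[OF pos, of s] s by (intro ennreal_le_divideI) auto
qed

lemma exit_top_moment_bound:
  assumes s: "0 < s" "2 * s < l" and c: "c \<le> m"
  shows "(\<integral>\<^sup>+x. ennreal (exit_top x c n powr s) \<partial>bulk_measure \<alpha> \<beta> (Suc m) (Suc n))
    \<le> ennreal (harm_bound \<alpha> \<beta> l (Suc m) (Suc n) s / mom_h \<alpha> \<beta> l s ^ (Suc m - c))"
proof -
  have "(\<integral>\<^sup>+x. ennreal (exit_top x c n powr s) \<partial>bulk_measure \<alpha> \<beta> (Suc m) (Suc n)) * ennreal (mom_h \<alpha> \<beta> l s ^ (Suc m - c))
    = (\<integral>\<^sup>+x. ennreal ((exit_top x c n * (\<Prod>k\<in>{c..m}. x (k, Suc n))) powr s) \<partial>grid_measure \<alpha> \<beta> l (Suc m) (Suc n))"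
    using s c by (intro exit_top_moment_eq[symmetric]) auto
  also have "\<dots> \<le> (\<integral>\<^sup>+x. ennreal (harm_ext (Suc m) (Suc n) x 0 0 powr s) \<partial>grid_measure \<alpha> \<beta> l (Suc m) (Suc n))"
    by (rule nn_integral_mono_AE, use AE_grid_measure[OF pos, of "Suc m" "Suc n"] in eventually_elim)
      (use s c exit_term_le_harm_ext(2) exit_term_nonneg(2) in \<open>auto intro!: ennreal_leI powr_mono2\<close>)
  also have "\<dots> \<le> ennreal (harm_bound \<alpha> \<beta> l (Suc m) (Suc n) s)"
    using s pos by (intro harm_ext_moment[OF pos]) auto
  finally show ?thesis
    using mom_h_pos[OF pos, of s] s pos by (intro ennreal_le_divideI) auto
qed

end

text \<open>The probability of leaving the rectangle at most K rows below, or at most K columns to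
  the left of, the corner (Suc m, Suc n).\<close>

definition near_exit :: "nat \<Rightarrow> nat \<Rightarrow> nat \<Rightarrow> (nat \<times> nat \<Rightarrow> real) \<Rightarrow> real" where
  "near_exit m n K w = (\<Sum>r\<in>{Suc n - K..n}. exit_right w m r) + (\<Sum>c\<in>{Suc m - K..m}. exit_top w c n)"

lemma near_exit_measurable [measurable]: "near_exit m n K \<in> borel_measurable (PiM J (\<lambda>_. borel))"
  unfolding near_exit_def[abs_def] by measurable

lemma near_exit_restrict: "near_exit m n K (restrict w (bulk (Suc m) (Suc n))) = near_exit m n K w"
  by (simp add: near_exit_def exit_restrict)

lemma emeasure_le_eq_nn_integral:
  fixes f :: "'a \<Rightarrow> real"
  assumes [measurable]: "f \<in> borel_measurable N"
  shows "emeasure N {w \<in> space N. f w \<le> c} = (\<integral>\<^sup>+w. indicator {u. u \<le> c} (f w) \<partial>N)"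
proof -
  have "(\<integral>\<^sup>+w. indicator {u. u \<le> c} (f w) \<partial>N) = (\<integral>\<^sup>+w. indicator {w \<in> space N. f w \<le> c} w \<partial>N)"
    by (intro nn_integral_cong) (auto simp: indicator_def)
  then show ?thesis by simp
qed

text \<open>An index below J - K has distance more than K from J, so its moment carries at least the
  factor q ^ K. Subadditivity of the power s then costs only the number of terms.\<close>

lemma truncated_sum_moment:
  fixes T :: "'a \<Rightarrow> nat \<Rightarrow> real"
  assumes [measurable]: "\<And>r. (\<lambda>x. T x r) \<in> borel_measurable P"
    and nonneg: "AE x in P. \<forall>r<J. 0 \<le> T x r" and s: "0 < s" "s \<le> 1"
    and q: "0 \<le> q" "q \<le> 1" "0 \<le> D"
    and moment: "\<And>r. r < J \<Longrightarrow> (\<integral>\<^sup>+x. ennreal (T x r powr s) \<partial>P) \<le> ennreal (D * q ^ (J - r))"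
  shows "(\<integral>\<^sup>+x. ennreal ((\<Sum>r<J - K. T x r) powr s) \<partial>P) \<le> ennreal (real J * D * q ^ K)"
proof -
  have "(\<integral>\<^sup>+x. ennreal ((\<Sum>r<J - K. T x r) powr s) \<partial>P) \<le> (\<integral>\<^sup>+x. (\<Sum>r<J - K. ennreal (T x r powr s)) \<partial>P)"
  proof (rule nn_integral_mono_AE, use nonneg in eventually_elim)
    case (elim x)
    then have "(\<Sum>r<J - K. T x r) powr s \<le> (\<Sum>r<J - K. T x r powr s)"
      using s by (intro powr_sum_le) auto
    then show "ennreal ((\<Sum>r<J - K. T x r) powr s) \<le> (\<Sum>r<J - K. ennreal (T x r powr s))"
      by (simp add: sum_ennreal ennreal_leI)
  qed
  also have "\<dots> = (\<Sum>r<J - K. \<integral>\<^sup>+x. ennreal (T x r powr s) \<partial>P)"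
    by (rule nn_integral_sum) measurable
  also have "\<dots> \<le> (\<Sum>r<J - K. ennreal (D * q ^ K))"
  proof (rule sum_mono)
    fix r assume r: "r \<in> {..<J - K}"
    then have "D * q ^ (J - r) \<le> D * q ^ K" using q by (intro mult_left_mono power_decreasing) auto
    moreover have "r < J" using r by simp
    ultimately show "(\<integral>\<^sup>+x. ennreal (T x r powr s) \<partial>P) \<le> ennreal (D * q ^ K)"
      using moment[of r] by (auto intro: order_trans ennreal_leI)
  qed
  also have "\<dots> = ennreal (real (J - K) * (D * q ^ K))"
    using q by (simp add: ennreal_mult' ennreal_of_nat_eq_real_of_nat)
  also have "\<dots> \<le> ennreal (real J * (D * q ^ K))"
    using q by (intro ennreal_leI mult_right_mono) auto
  finally show ?thesis by (simp add: mult.assoc)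
qed

context
  fixes \<alpha> \<beta> :: real
  assumes pos: "\<alpha> > 0" "\<beta> > 0"
begin

text \<open>The exchange of parameters: the bulk moment is bounded with l', whereas the boundary
  product is computed with l. Each boundary edge contributes the quotient of the two moments, and an
  exit far from the corner has at least K such edges.\<close>

lemma far_right_moment:
  assumes l: "l > 0" "l' > 0" and s: "0 < s" "s \<le> 1" "s < l" "2 * s < l'"
    and mono: "mom_v \<alpha> l s \<le> mom_v \<alpha> l' s"
  shows "(\<integral>\<^sup>+x. ennreal ((\<Sum>r<Suc n - K. exit_right x m r * (\<Prod>k\<in>{r..n}. 1 / x (Suc m, k))) powr s) \<partial>grid_measure \<alpha> \<beta> l (Suc m) (Suc n))
    \<le> ennreal (real (Suc n) * harm_bound \<alpha> \<beta> l' (Suc m) (Suc n) s * (mom_v \<alpha> l s / mom_v \<alpha> l' s) ^ K)"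
proof (rule truncated_sum_moment[OF _ _ s(1,2)])
  have mv: "mom_v \<alpha> l s > 0" "mom_v \<alpha> l' s > 0" using mom_v_pos[OF pos l(1)] mom_v_pos[OF pos l(2)] s by auto
  then show "0 \<le> mom_v \<alpha> l s / mom_v \<alpha> l' s" "mom_v \<alpha> l s / mom_v \<alpha> l' s \<le> 1" using mono by auto
  show hb: "0 \<le> harm_bound \<alpha> \<beta> l' (Suc m) (Suc n) s" by (simp add: harm_bound_def[OF pos l(2)])
  show "AE x in grid_measure \<alpha> \<beta> l (Suc m) (Suc n). \<forall>r<Suc n. 0 \<le> exit_right x m r * (\<Prod>k\<in>{r..n}. 1 / x (Suc m, k))"
    using AE_grid_measure[OF pos l(1), of "Suc m" "Suc n"] by eventually_elim (simp add: exit_term_nonneg(1))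
  fix r assume r: "r < Suc n"
  have "(\<integral>\<^sup>+x. ennreal ((exit_right x m r * (\<Prod>k\<in>{r..n}. 1 / x (Suc m, k))) powr s) \<partial>grid_measure \<alpha> \<beta> l (Suc m) (Suc n)) =
    (\<integral>\<^sup>+x. ennreal (exit_right x m r powr s) \<partial>bulk_measure \<alpha> \<beta> (Suc m) (Suc n)) * ennreal (mom_v \<alpha> l s ^ (Suc n - r))"
    using s r by (intro exit_right_moment_eq[OF pos l(1)]) auto
  also have "\<dots> \<le> ennreal (harm_bound \<alpha> \<beta> l' (Suc m) (Suc n) s / mom_v \<alpha> l' s ^ (Suc n - r)) * ennreal (mom_v \<alpha> l s ^ (Suc n - r))"
    using s r by (intro mult_right_mono exit_right_moment_bound[OF pos l(2)]) auto
  also have "\<dots> = ennreal (harm_bound \<alpha> \<beta> l' (Suc m) (Suc n) s * (mom_v \<alpha> l s / mom_v \<alpha> l' s) ^ (Suc n - r))"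
    using mv hb by (subst ennreal_mult[symmetric]) (auto simp: power_divide)
  finally show "(\<integral>\<^sup>+x. ennreal ((exit_right x m r * (\<Prod>k\<in>{r..n}. 1 / x (Suc m, k))) powr s) \<partial>grid_measure \<alpha> \<beta> l (Suc m) (Suc n))
    \<le> ennreal (harm_bound \<alpha> \<beta> l' (Suc m) (Suc n) s * (mom_v \<alpha> l s / mom_v \<alpha> l' s) ^ (Suc n - r))"
    by simp
qed measurable

lemma far_top_moment:
  assumes l: "l > 0" "l' > 0" and s: "0 < s" "s \<le> 1" "2 * s < l'"
    and mono: "mom_h \<alpha> \<beta> l s \<le> mom_h \<alpha> \<beta> l' s"
  shows "(\<integral>\<^sup>+x. ennreal ((\<Sum>r<Suc m - K. exit_top x r n * (\<Prod>k\<in>{r..m}. x (k, Suc n))) powr s) \<partial>grid_measure \<alpha> \<beta> l (Suc m) (Suc n))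
    \<le> ennreal (real (Suc m) * harm_bound \<alpha> \<beta> l' (Suc m) (Suc n) s * (mom_h \<alpha> \<beta> l s / mom_h \<alpha> \<beta> l' s) ^ K)"
proof (rule truncated_sum_moment[OF _ _ s(1,2)])
  have mv: "mom_h \<alpha> \<beta> l s > 0" "mom_h \<alpha> \<beta> l' s > 0" using mom_h_pos[OF pos l(1)] mom_h_pos[OF pos l(2)] s l pos by auto
  then show "0 \<le> mom_h \<alpha> \<beta> l s / mom_h \<alpha> \<beta> l' s" "mom_h \<alpha> \<beta> l s / mom_h \<alpha> \<beta> l' s \<le> 1" using mono by auto
  show hb: "0 \<le> harm_bound \<alpha> \<beta> l' (Suc m) (Suc n) s" by (simp add: harm_bound_def[OF pos l(2)])
  show "AE x in grid_measure \<alpha> \<beta> l (Suc m) (Suc n). \<forall>r<Suc m. 0 \<le> exit_top x r n * (\<Prod>k\<in>{r..m}. x (k, Suc n))"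
    using AE_grid_measure[OF pos l(1), of "Suc m" "Suc n"] by eventually_elim (simp add: exit_term_nonneg(2))
  fix r assume r: "r < Suc m"
  have "(\<integral>\<^sup>+x. ennreal ((exit_top x r n * (\<Prod>k\<in>{r..m}. x (k, Suc n))) powr s) \<partial>grid_measure \<alpha> \<beta> l (Suc m) (Suc n)) =
    (\<integral>\<^sup>+x. ennreal (exit_top x r n powr s) \<partial>bulk_measure \<alpha> \<beta> (Suc m) (Suc n)) * ennreal (mom_h \<alpha> \<beta> l s ^ (Suc m - r))"
    using s r by (intro exit_top_moment_eq[OF pos l(1)]) auto
  also have "\<dots> \<le> ennreal (harm_bound \<alpha> \<beta> l' (Suc m) (Suc n) s / mom_h \<alpha> \<beta> l' s ^ (Suc m - r)) * ennreal (mom_h \<alpha> \<beta> l s ^ (Suc m - r))"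
    using s r by (intro mult_right_mono exit_top_moment_bound[OF pos l(2)]) auto
  also have "\<dots> = ennreal (harm_bound \<alpha> \<beta> l' (Suc m) (Suc n) s * (mom_h \<alpha> \<beta> l s / mom_h \<alpha> \<beta> l' s) ^ (Suc m - r))"
    using mv hb by (subst ennreal_mult[symmetric]) (auto simp: power_divide)
  finally show "(\<integral>\<^sup>+x. ennreal ((exit_top x r n * (\<Prod>k\<in>{r..m}. x (k, Suc n))) powr s) \<partial>grid_measure \<alpha> \<beta> l (Suc m) (Suc n))
    \<le> ennreal (harm_bound \<alpha> \<beta> l' (Suc m) (Suc n) s * (mom_h \<alpha> \<beta> l s / mom_h \<alpha> \<beta> l' s) ^ (Suc m - r))"
    by simp
qed measurable

text \<open>For exits near the corner one product dominates all boundary products: the factors 1 / x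
  on the right side are at least 1, and the factors x on the top side are at most 1.\<close>

lemma harm_ext_le_near_exit:
  assumes x: "\<forall>k\<in>grid (Suc m) (Suc n). 0 < x k \<and> x k < 1"
  shows "harm_ext (Suc m) (Suc n) x 0 0 \<le> near_exit m n K x * (\<Prod>k\<in>{Suc n - K..n}. 1 / x (Suc m, k))
     + (\<Sum>r<Suc n - K. exit_right x m r * (\<Prod>k\<in>{r..n}. 1 / x (Suc m, k)))
     + (\<Sum>c<Suc m - K. exit_top x c n * (\<Prod>k\<in>{c..m}. x (k, Suc n)))"
proof -
  let ?B = "\<Prod>k\<in>{Suc n - K..n}. 1 / x (Suc m, k)"
  have b: "\<forall>k\<in>bulk (Suc m) (Suc n). 0 < x k \<and> x k < 1" using x by (auto simp: grid_def)
  have xr: "0 < x (Suc m, k)" "x (Suc m, k) < 1" if "k \<le> n" for k using x that by (auto simp: grid_def boundary_def)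
  have xt: "0 < x (k, Suc n)" "x (k, Suc n) < 1" if "k \<le> m" for k using x that by (auto simp: grid_def boundary_def)
  have B1: "?B \<ge> 1" using xr by (intro prod_ge_1) (auto simp: less_imp_le)
  have R: "exit_right x m r * (\<Prod>k\<in>{r..n}. 1 / x (Suc m, k)) \<le> exit_right x m r * ?B" if r: "r \<in> {Suc n - K..n}" for r
  proof (rule mult_left_mono)
    have "?B = (\<Prod>k\<in>{Suc n - K..<r}. 1 / x (Suc m, k)) * (\<Prod>k\<in>{r..n}. 1 / x (Suc m, k))"
      using r by (subst prod.union_disjoint[symmetric]) (auto intro!: prod.cong)
    moreover have "(\<Prod>k\<in>{Suc n - K..<r}. 1 / x (Suc m, k)) \<ge> 1" using r xr by (intro prod_ge_1) (auto simp: less_imp_le)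
    moreover have "(\<Prod>k\<in>{r..n}. 1 / x (Suc m, k)) \<ge> 0" using xr by (intro prod_nonneg) (auto simp: less_imp_le)
    ultimately show "(\<Prod>k\<in>{r..n}. 1 / x (Suc m, k)) \<le> ?B"
      using mult_right_mono[of 1 "\<Prod>k\<in>{Suc n - K..<r}. 1 / x (Suc m, k)" "\<Prod>k\<in>{r..n}. 1 / x (Suc m, k)"] by simp
    show "0 \<le> exit_right x m r" using exit_pos(1)[OF b, of m r] r by simp
  qed
  have T: "exit_top x c n * (\<Prod>k\<in>{c..m}. x (k, Suc n)) \<le> exit_top x c n * ?B" if c: "c \<in> {Suc m - K..m}" for c
  proof (rule mult_left_mono)
    have "(\<Prod>k\<in>{c..m}. x (k, Suc n)) \<le> 1" using xt by (intro prod_le_1) (auto simp: less_imp_le)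
    with B1 show "(\<Prod>k\<in>{c..m}. x (k, Suc n)) \<le> ?B" by simp
    show "0 \<le> exit_top x c n" using exit_pos(2)[OF b, of c n] c by simp
  qed
  have split: "{..n} = {..<Suc n - K} \<union> {Suc n - K..n}" "{..m} = {..<Suc m - K} \<union> {Suc m - K..m}" by auto
  have "harm_ext (Suc m) (Suc n) x 0 0 =
     (\<Sum>r<Suc n - K. exit_right x m r * (\<Prod>k\<in>{r..n}. 1 / x (Suc m, k)))
     + (\<Sum>r\<in>{Suc n - K..n}. exit_right x m r * (\<Prod>k\<in>{r..n}. 1 / x (Suc m, k)))
     + ((\<Sum>c<Suc m - K. exit_top x c n * (\<Prod>k\<in>{c..m}. x (k, Suc n)))
     + (\<Sum>c\<in>{Suc m - K..m}. exit_top x c n * (\<Prod>k\<in>{c..m}. x (k, Suc n))))"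
    unfolding harm_ext_exit_decomposition split
    by (subst (1 2) sum.union_disjoint) auto
  moreover have "(\<Sum>r\<in>{Suc n - K..n}. exit_right x m r * (\<Prod>k\<in>{r..n}. 1 / x (Suc m, k)))
     + (\<Sum>c\<in>{Suc m - K..m}. exit_top x c n * (\<Prod>k\<in>{c..m}. x (k, Suc n))) \<le> near_exit m n K x * ?B"
    unfolding near_exit_def distrib_right sum_distrib_right by (intro add_mono sum_mono R T)
  ultimately show ?thesis by linarith
qed

text \<open>
  The boundary law with parameter \<open>l1 < l\<close> controls exits far down the right side, that with
  \<open>l2 > l\<close> exits far to the left on the top side.
\<close>

lemma near_exit_small_prob:
  assumes l: "l > 0" "l1 > 0" "l2 > 0"
    and s: "0 < s" "s \<le> 1" "2 * s < l" "2 * s < l1" "2 * s < l2"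
    and mono: "mom_v \<alpha> l s \<le> mom_v \<alpha> l1 s" "mom_h \<alpha> \<beta> l s \<le> mom_h \<alpha> \<beta> l2 s"
    and tB: "t > 0" "B > 0" and K: "K \<le> Suc n"
  shows "emeasure (bulk_measure \<alpha> \<beta> (Suc m) (Suc n))
      {w \<in> space (bulk_measure \<alpha> \<beta> (Suc m) (Suc n)). near_exit m n K w \<le> t / (2 * B)}
    \<le> ennreal (t powr s * harm_bound \<alpha> \<beta> l (Suc m) (Suc n) (- s)
      + (4 / t) powr s * (real (Suc n) * harm_bound \<alpha> \<beta> l1 (Suc m) (Suc n) s * (mom_v \<alpha> l s / mom_v \<alpha> l1 s) ^ K)
      + (4 / t) powr s * (real (Suc m) * harm_bound \<alpha> \<beta> l2 (Suc m) (Suc n) s * (mom_h \<alpha> \<beta> l s / mom_h \<alpha> \<beta> l2 s) ^ K)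
      + B powr - s * mom_v \<alpha> l s ^ K)"
    (is "_ \<le> ennreal (?e1 + ?e2 + ?e3 + ?e4)")
proof -
  let ?P = "grid_measure \<alpha> \<beta> l (Suc m) (Suc n)"
  let ?Q = "bulk_measure \<alpha> \<beta> (Suc m) (Suc n)"
  define Bd where "Bd x = (\<Prod>k\<in>{Suc n - K..n}. 1 / x (Suc m, k))" for x :: "nat \<times> nat \<Rightarrow> real"
  define FR where "FR x = (\<Sum>r<Suc n - K. exit_right x m r * (\<Prod>k\<in>{r..n}. 1 / x (Suc m, k)))" for x :: "nat \<times> nat \<Rightarrow> real"
  define FT where "FT x = (\<Sum>c<Suc m - K. exit_top x c n * (\<Prod>k\<in>{c..m}. x (k, Suc n)))" for x :: "nat \<times> nat \<Rightarrow> real"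
  let ?h = "\<lambda>x. harm_ext (Suc m) (Suc n) x 0 0"
  have [measurable]: "Bd \<in> borel_measurable ?P" "FR \<in> borel_measurable ?P" "FT \<in> borel_measurable ?P"
    unfolding Bd_def[abs_def] FR_def[abs_def] FT_def[abs_def] by measurable
  have AE01: "AE x in ?P. \<forall>k\<in>grid (Suc m) (Suc n). 0 < x k \<and> x k < 1" by (rule AE_grid_measure[OF pos l(1)])
  have nneg: "Bd x \<ge> 0" "FR x \<ge> 0" "FT x \<ge> 0" if x: "\<forall>k\<in>grid (Suc m) (Suc n). 0 < x k \<and> x k < 1" for x
    unfolding Bd_def FR_def FT_def using exit_term_nonneg[OF x] x
    by (auto intro!: sum_nonneg prod_nonneg simp: less_imp_le grid_def boundary_def)
  have ge1: "1 \<le> (1 / c) powr s * u powr s" if "u \<ge> c" "c > 0" for u c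
  proof -
    have "1 \<le> (u / c) powr s" using that s by (intro ge_one_powr_ge_zero) auto
    then show ?thesis using that by (simp add: powr_mult[symmetric] field_simps)
  qed
  \<comment> \<open>The lower tail of the harmonic function is controlled by a moment of negative
    order.\<close>
  have E1: "emeasure ?P {x\<in>space ?P. ?h x \<le> t} \<le> ennreal ?e1"
  proof (rule emeasure_powr_Markov[where f = ?h and s = "-s"])
    show "AE x in ?P. ?h x \<le> t \<longrightarrow> 1 \<le> t powr s * ?h x powr - s"
      using AE01
    proof eventually_elim
      case (elim x)
      have h: "?h x > 0" by (rule harm_ext_pos[OF elim]) auto
      show ?case
      proof
        assume "?h x \<le> t"
        then have "?h x powr s \<le> t powr s" using h s by (intro powr_mono2) auto
        then show "1 \<le> t powr s * ?h x powr - s"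
          using h by (simp add: powr_minus field_simps)
      qed
    qed
    show "(\<integral>\<^sup>+x. ennreal (?h x powr - s) \<partial>?P) \<le> ennreal (harm_bound \<alpha> \<beta> l (Suc m) (Suc n) (- s))"
      using s l pos by (intro harm_ext_moment[OF pos l(1)]) auto
  qed (auto intro!: measurable_sets_Collect)
  have E2: "emeasure ?P {x\<in>space ?P. t / 4 \<le> FR x} \<le> ennreal ?e2"
  proof (rule emeasure_powr_Markov[where f = FR and s = s])
    show "AE x in ?P. t / 4 \<le> FR x \<longrightarrow> 1 \<le> (4 / t) powr s * FR x powr s"
      using ge1[of "t / 4"] tB by (intro AE_I2) auto
    show "(\<integral>\<^sup>+x. ennreal (FR x powr s) \<partial>?P) \<le> ennreal (real (Suc n) * harm_bound \<alpha> \<beta> l1 (Suc m) (Suc n) s * (mom_v \<alpha> l s / mom_v \<alpha> l1 s) ^ K)"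
      unfolding FR_def using s l mono by (intro far_right_moment) auto
  qed auto
  have E3: "emeasure ?P {x\<in>space ?P. t / 4 \<le> FT x} \<le> ennreal ?e3"
  proof (rule emeasure_powr_Markov[where f = FT and s = s])
    show "AE x in ?P. t / 4 \<le> FT x \<longrightarrow> 1 \<le> (4 / t) powr s * FT x powr s"
      using ge1[of "t / 4"] tB by (intro AE_I2) auto
    show "(\<integral>\<^sup>+x. ennreal (FT x powr s) \<partial>?P) \<le> ennreal (real (Suc m) * harm_bound \<alpha> \<beta> l2 (Suc m) (Suc n) s * (mom_h \<alpha> \<beta> l s / mom_h \<alpha> \<beta> l2 s) ^ K)"
      unfolding FT_def using s l mono by (intro far_top_moment) auto
  qed auto
  have E4: "emeasure ?P {x\<in>space ?P. B \<le> Bd x} \<le> ennreal ?e4"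
  proof (rule emeasure_powr_Markov[where f = Bd and s = s])
    show "AE x in ?P. B \<le> Bd x \<longrightarrow> 1 \<le> B powr - s * Bd x powr s"
      using ge1[of B] tB by (intro AE_I2) (auto simp: powr_divide powr_minus_divide)
    let ?S = "(\<lambda>k. (Suc m, k)) ` {Suc n - K..n}"
    have "(\<integral>\<^sup>+x. ennreal (Bd x powr s) \<partial>?P) = (\<integral>\<^sup>+x. 1 * (\<Prod>k\<in>?S. ennreal ((1 / x k) powr s)) \<partial>?P)"
      unfolding Bd_def by (intro nn_integral_cong)
        (simp add: prod_powr_distrib ennreal_mult prod_nonneg prod_ennreal prod.reindex inj_on_def)
    also have "\<dots> = (\<integral>\<^sup>+x. 1 \<partial>?Q) * (\<Prod>k\<in>?S. \<integral>\<^sup>+t. ennreal ((1 / t) powr s) \<partial>site_law \<alpha> \<beta> l (Suc m) (Suc n) k)"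
      by (rule nn_integral_grid_boundary[OF pos l(1)]) (auto simp: boundary_def)
    also have "\<dots> = ennreal (mom_v \<alpha> l s ^ K)"
      using mom_v_pos[OF pos l(1), of s] s K prob_space.emeasure_space_1[OF prob_space_bulk_measure[OF pos l(1)]]
      by (simp add: prod.reindex inj_on_def site_law_right_moment[OF pos l(1)] ennreal_power less_imp_le)
    finally show "(\<integral>\<^sup>+x. ennreal (Bd x powr s) \<partial>?P) \<le> ennreal (mom_v \<alpha> l s ^ K)" by simp
  qed auto
  have "emeasure ?Q {w \<in> space ?Q. near_exit m n K w \<le> t / (2 * B)} =
     (\<integral>\<^sup>+w. indicator {u. u \<le> t / (2 * B)} (near_exit m n K w) \<partial>?Q)"
    by (rule emeasure_le_eq_nn_integral) measurable
  \<comment> \<open>The event concerns only the bulk, so boundary ratios with parameter l can be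
    adjoined.\<close>
  also have "\<dots> = (\<integral>\<^sup>+w. indicator {u. u \<le> t / (2 * B)} (near_exit m n K w) \<partial>?P)"
    by (intro nn_integral_grid_bulk[OF pos l(1), symmetric]) (simp_all add: near_exit_restrict)
  also have "\<dots> = emeasure ?P {w \<in> space ?P. near_exit m n K w \<le> t / (2 * B)}"
    by (rule emeasure_le_eq_nn_integral[symmetric]) measurable
  also have "\<dots> \<le> emeasure ?P ({x\<in>space ?P. ?h x \<le> t} \<union> {x\<in>space ?P. t / 4 \<le> FR x} \<union> {x\<in>space ?P. t / 4 \<le> FT x} \<union> {x\<in>space ?P. B \<le> Bd x})"
  proof (rule emeasure_mono_AE)
    show "AE x in ?P. x \<in> {w \<in> space ?P. near_exit m n K w \<le> t / (2 * B)} \<longrightarrow>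
       x \<in> {x\<in>space ?P. ?h x \<le> t} \<union> {x\<in>space ?P. t / 4 \<le> FR x} \<union> {x\<in>space ?P. t / 4 \<le> FT x} \<union> {x\<in>space ?P. B \<le> Bd x}"
      using AE01
    proof eventually_elim
      case (elim x)
      have b: "\<forall>k\<in>bulk (Suc m) (Suc n). 0 < x k \<and> x k < 1" using elim by (auto simp: grid_def)
      have n0: "near_exit m n K x \<ge> 0"
        unfolding near_exit_def by (intro add_nonneg_nonneg sum_nonneg less_imp_le exit_pos[OF b]) auto
      show ?case
      proof (rule impI, rule ccontr)
        assume A: "x \<in> {w \<in> space ?P. near_exit m n K w \<le> t / (2 * B)}"
          "x \<notin> {x\<in>space ?P. ?h x \<le> t} \<union> {x\<in>space ?P. t / 4 \<le> FR x} \<union> {x\<in>space ?P. t / 4 \<le> FT x} \<union> {x\<in>space ?P. B \<le> Bd x}"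
        then have *: "near_exit m n K x \<le> t / (2 * B)" "?h x > t" "FR x < t / 4" "FT x < t / 4" "Bd x < B" by auto
        \<comment> \<open>The thresholds are balanced: t / 2 + t / 4 + t / 4 = t bounds the harmonic
          function, which was supposed to exceed t.\<close>
        have "near_exit m n K x * Bd x \<le> t / (2 * B) * B"
          using * nneg[OF elim] n0 tB by (intro mult_mono) auto
        then have "near_exit m n K x * Bd x \<le> t / 2" using tB by simp
        with * harm_ext_le_near_exit[OF elim, of K] show False by (simp add: FR_def FT_def Bd_def)
      qed
    qed
  qed measurable
  also have "\<dots> \<le> ennreal ?e1 + ennreal ?e2 + ennreal ?e3 + ennreal ?e4"
    by (intro order_trans[OF emeasure_subadditive] add_mono E1 E2 E3 E4) measurable
  also have "\<dots> = ennreal (?e1 + ?e2 + ?e3 + ?e4)"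
    using mom_v_pos[OF pos l(1), of s] mom_v_pos[OF pos l(2), of s] mom_h_pos[OF pos l(1), of s] mom_h_pos[OF pos l(3), of s] s l pos
    by (simp add: harm_bound_def[OF pos l(1)] harm_bound_def[OF pos l(2)] harm_bound_def[OF pos l(3)])
  finally show ?thesis .
qed

end

section \<open>The random environment\<close>

definition quadrant :: "(site \<Rightarrow> 's \<Rightarrow> real) \<Rightarrow> 's \<Rightarrow> nat \<times> nat \<Rightarrow> real" where
  "quadrant \<omega> s k = \<omega> (int (fst k), int (snd k)) s"

context
  fixes \<alpha> \<beta> :: real and M :: "'s measure" and \<omega> :: "site \<Rightarrow> 's \<Rightarrow> real"
  assumes pos: "\<alpha> > 0" "\<beta> > 0" and env: "beta_environment \<alpha> \<beta> M \<omega>"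
begin

lemma prob_space_env: "prob_space M"
  using env by (simp add: beta_environment_def)

lemma distributed_env: "distributed M lborel (\<omega> z) (\<lambda>t. ennreal (beta_density \<alpha> \<beta> t))"
  using env unfolding beta_environment_def by blast

lemma env_measurable [measurable]: "\<omega> z \<in> borel_measurable M"
  using distributed_measurable[OF distributed_env[of z]] by simp

lemma quadrant_measurable [measurable]: "(\<lambda>s. quadrant \<omega> s k) \<in> borel_measurable M"
  unfolding quadrant_def by measurable

lemma distr_env: "distr M borel (\<omega> z) = beta_measure \<alpha> \<beta>"
proof -
  have "distr M borel (\<omega> z) = distr M lborel (\<omega> z)" by (rule distr_cong) auto
  also have "\<dots> = beta_measure \<alpha> \<beta>"
    by (simp add: beta_measure_def distributed_distr_eq_density[OF distributed_env])
  finally show ?thesis .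
qed

lemma AE_env: "AE s in M. \<forall>z. 0 < \<omega> z s \<and> \<omega> z s < 1"
proof (subst AE_all_countable, rule allI)
  fix z
  have "AE t in distr M borel (\<omega> z). 0 < t \<and> t < 1" unfolding distr_env by (rule AE_beta_measure)
  then show "AE s in M. 0 < \<omega> z s \<and> \<omega> z s < 1" by (subst (asm) AE_distr_iff) auto
qed

lemma AE_quadrant: "AE s in M. \<forall>k. 0 < quadrant \<omega> s k \<and> quadrant \<omega> s k < 1"
  using AE_env by eventually_elim (simp add: quadrant_def)

lemma distr_quadrant:
  "distr M (PiM (bulk m n) (\<lambda>_. borel)) (\<lambda>s. restrict (quadrant \<omega> s) (bulk m n)) = bulk_measure \<alpha> \<beta> m n"
proof -
  interpret prob_space M by (rule prob_space_env)
  let ?j = "\<lambda>k::nat \<times> nat. (int (fst k), int (snd k)) :: site"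
  have "indep_vars (\<lambda>_. borel) \<omega> UNIV" using env by (simp add: beta_environment_def)
  then have "distr M (PiM UNIV (\<lambda>_. borel)) (\<lambda>s. \<lambda>z\<in>UNIV. \<omega> z s) = PiM UNIV (\<lambda>z. distr M borel (\<omega> z))"
    by (subst (asm) indep_vars_iff_distr_eq_PiM) auto
  then have *: "distr M (PiM UNIV (\<lambda>_. borel)) (\<lambda>s z. \<omega> z s) = PiM UNIV (\<lambda>z. beta_measure \<alpha> \<beta>)"
    by (simp only: distr_env restrict_UNIV)
  have "PiM (bulk m n) (\<lambda>_. beta_measure \<alpha> \<beta>) =
     distr (PiM (UNIV :: site set) (\<lambda>z. beta_measure \<alpha> \<beta>)) (PiM (bulk m n) (\<lambda>_. beta_measure \<alpha> \<beta>)) (\<lambda>x. \<lambda>k\<in>bulk m n. x (?j k))"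
    by (rule distr_PiM_reindex[symmetric]) (auto intro!: prob_space_beta_measure pos inj_onI simp: prod_eq_iff)
  also have "\<dots> = distr (PiM (UNIV :: site set) (\<lambda>z. beta_measure \<alpha> \<beta>)) (PiM (bulk m n) (\<lambda>_. borel)) (\<lambda>x. \<lambda>k\<in>bulk m n. x (?j k))"
    by (intro distr_cong sets_PiM_cong) auto
  also have "\<dots> = distr M (PiM (bulk m n) (\<lambda>_. borel)) ((\<lambda>x. \<lambda>k\<in>bulk m n. x (?j k)) \<circ> (\<lambda>s z. \<omega> z s))"
    unfolding *[symmetric]
    by (rule distr_distr) (auto intro!: measurable_restrict measurable_PiM_single' simp: space_PiM)
  also have "(\<lambda>x. \<lambda>k\<in>bulk m n. x (?j k)) \<circ> (\<lambda>s z. \<omega> z s) = (\<lambda>s. restrict (quadrant \<omega> s) (bulk m n))"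
    by (auto simp: fun_eq_iff quadrant_def)
  finally show ?thesis unfolding bulk_measure_def by (rule sym)
qed

lemma nn_integral_quadrant:
  assumes \<Phi>[measurable]: "\<Phi> \<in> borel_measurable (PiM (bulk m n) (\<lambda>_. borel))"
    and dep: "\<And>x. \<Phi> (restrict x (bulk m n)) = \<Phi> x"
  shows "(\<integral>\<^sup>+s. \<Phi> (quadrant \<omega> s) \<partial>M) = (\<integral>\<^sup>+x. \<Phi> x \<partial>bulk_measure \<alpha> \<beta> m n)"
proof -
  have [measurable]: "(\<lambda>s. restrict (quadrant \<omega> s) (bulk m n)) \<in> measurable M (PiM (bulk m n) (\<lambda>_. borel))"
    by (intro measurable_restrict) measurable
  have "(\<integral>\<^sup>+x. \<Phi> x \<partial>bulk_measure \<alpha> \<beta> m n) = (\<integral>\<^sup>+s. \<Phi> (restrict (quadrant \<omega> s) (bulk m n)) \<partial>M)"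
    unfolding distr_quadrant[symmetric] by (subst nn_integral_distr) measurable
  then show ?thesis by (simp only: dep)
qed

lemma nn_integral_quadrant_prod:
  assumes "finite S" and f[measurable]: "\<And>k. f k \<in> borel_measurable borel"
  shows "(\<integral>\<^sup>+s. (\<Prod>k\<in>S. f k (quadrant \<omega> s k)) \<partial>M) = (\<Prod>k\<in>S. \<integral>\<^sup>+t. f k t \<partial>beta_measure \<alpha> \<beta>)"
proof -
  obtain m where m: "fst ` S \<union> snd ` S \<subseteq> {..<m}"
    using finite_nat_iff_bounded[of "fst ` S \<union> snd ` S"] assms(1) by auto
  then have S: "S \<subseteq> bulk m m" by (force simp: bulk_def)
  interpret product_sigma_finite "\<lambda>_ :: nat \<times> nat. beta_measure \<alpha> \<beta>"
    by (simp add: product_sigma_finite_def prob_space_imp_sigma_finite prob_space_beta_measure pos)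
  have "(\<integral>\<^sup>+s. (\<Prod>k\<in>S. f k (quadrant \<omega> s k)) \<partial>M) = (\<integral>\<^sup>+x. (\<Prod>k\<in>S. f k (x k)) \<partial>bulk_measure \<alpha> \<beta> m m)"
    using S by (intro nn_integral_quadrant) (auto intro!: prod.cong)
  also have "\<dots> = (\<integral>\<^sup>+x. (\<Prod>k\<in>bulk m m. (if k \<in> S then f k else (\<lambda>_. 1)) (x k)) \<partial>bulk_measure \<alpha> \<beta> m m)"
    using S by (intro nn_integral_cong prod.mono_neutral_cong_left) auto
  also have "\<dots> = (\<Prod>k\<in>bulk m m. \<integral>\<^sup>+t. (if k \<in> S then f k else (\<lambda>_. 1)) t \<partial>beta_measure \<alpha> \<beta>)"
    unfolding bulk_measure_def
  proof (rule product_nn_integral_prod)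
    fix k
    have "f k \<in> borel_measurable (beta_measure \<alpha> \<beta>)" using f[of k] by (simp cong: measurable_cong_sets)
    then show "(if k \<in> S then f k else (\<lambda>_. 1)) \<in> borel_measurable (beta_measure \<alpha> \<beta>)" by simp
  qed simp
  also have "\<dots> = (\<Prod>k\<in>S. \<integral>\<^sup>+t. f k t \<partial>beta_measure \<alpha> \<beta>)"
    using S prob_space.emeasure_space_1[OF prob_space_beta_measure[OF pos]]
    by (intro prod.mono_neutral_cong_right) auto
  finally show ?thesis .
qed

lemma reach_quadrant_measurable [measurable]: "(\<lambda>s. reach (quadrant \<omega> s) c r) \<in> borel_measurable M"
  by (rule reach_measurable_family) measurable

text \<open>Markov's inequality of order -s, with moments that are finite because s < \<alpha> and s
  < \<beta>. For a prescribed path, H collects the sites left horizontally and V those left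
  vertically.\<close>

lemma weight_product_small_prob:
  assumes fin: "finite H" "finite V" "H \<inter> V = {}" and s: "0 < s" "s < \<alpha>" "s < \<beta>" and c: "c > 0"
  shows "prob_space.prob M {x\<in>space M. (\<Prod>k\<in>H. quadrant \<omega> x k) * (\<Prod>k\<in>V. 1 - quadrant \<omega> x k) \<le> c}
    \<le> c powr s * (Beta (\<alpha> - s) \<beta> / Beta \<alpha> \<beta>) ^ card H * (Beta \<alpha> (\<beta> - s) / Beta \<alpha> \<beta>) ^ card V"
proof -
  interpret prob_space M by (rule prob_space_env)
  let ?D = "\<lambda>x. (\<Prod>k\<in>H. quadrant \<omega> x k) * (\<Prod>k\<in>V. 1 - quadrant \<omega> x k)"
  have h: "Beta (\<alpha> - s) \<beta> / Beta \<alpha> \<beta> > 0" and v: "Beta \<alpha> (\<beta> - s) / Beta \<alpha> \<beta> > 0"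
    using pos s by (auto simp: Beta_pos)
  have AE: "AE t in beta_measure \<alpha> \<beta>. 0 < t \<and> t < 1" by (rule AE_beta_measure)
  have mh: "(\<integral>\<^sup>+t. ennreal (t powr - s) \<partial>beta_measure \<alpha> \<beta>) = ennreal (Beta (\<alpha> - s) \<beta> / Beta \<alpha> \<beta>)"
  proof -
    have "(\<integral>\<^sup>+t. ennreal (t powr - s) \<partial>beta_measure \<alpha> \<beta>) = (\<integral>\<^sup>+t. ennreal (t powr - s * (1 - t) powr 0) \<partial>beta_measure \<alpha> \<beta>)"
      by (rule nn_integral_cong_AE, use AE in eventually_elim) simp
    then show ?thesis using beta_measure_moment[of \<alpha> \<beta> "-s" 0] pos s by simp
  qed
  have mv: "(\<integral>\<^sup>+t. ennreal ((1 - t) powr - s) \<partial>beta_measure \<alpha> \<beta>) = ennreal (Beta \<alpha> (\<beta> - s) / Beta \<alpha> \<beta>)"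
  proof -
    have "(\<integral>\<^sup>+t. ennreal ((1 - t) powr - s) \<partial>beta_measure \<alpha> \<beta>) = (\<integral>\<^sup>+t. ennreal (t powr 0 * (1 - t) powr - s) \<partial>beta_measure \<alpha> \<beta>)"
      by (rule nn_integral_cong_AE, use AE in eventually_elim) simp
    then show ?thesis using beta_measure_moment[of \<alpha> \<beta> 0 "-s"] pos s by simp
  qed
  have "emeasure M {x\<in>space M. ?D x \<le> c} \<le> ennreal (c powr s * ((Beta (\<alpha> - s) \<beta> / Beta \<alpha> \<beta>) ^ card H * (Beta \<alpha> (\<beta> - s) / Beta \<alpha> \<beta>) ^ card V))"
  proof (rule emeasure_powr_Markov[where f = ?D and s = "-s"])
    show "AE x in M. ?D x \<le> c \<longrightarrow> 1 \<le> c powr s * ?D x powr - s"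
      using AE_quadrant
    proof eventually_elim
      case (elim x)
      then have D: "?D x > 0" by (intro mult_pos_pos prod_pos) auto
      show ?case
      proof
        assume "?D x \<le> c"
        then have "?D x powr s \<le> c powr s" using D s by (intro powr_mono2) auto
        moreover have "?D x powr s > 0" using D by (metis powr_gt_zero less_irrefl)
        ultimately show "1 \<le> c powr s * ?D x powr - s"
          by (simp only: powr_minus divide_inverse[symmetric] le_divide_eq_1_pos)
      qed
    qed
    define f where "f k t = ennreal ((if k \<in> H then t else 1 - t) powr - s)" for k :: "nat \<times> nat" and t
    have "(\<integral>\<^sup>+x. ennreal (?D x powr - s) \<partial>M) = (\<integral>\<^sup>+x. (\<Prod>k\<in>H \<union> V. f k (quadrant \<omega> x k)) \<partial>M)"
    proof (rule nn_integral_cong)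
      fix x
      have "(\<Prod>k\<in>H \<union> V. f k (quadrant \<omega> x k)) = (\<Prod>k\<in>H. f k (quadrant \<omega> x k)) * (\<Prod>k\<in>V. f k (quadrant \<omega> x k))"
        using fin by (intro prod.union_disjoint)
      also have "(\<Prod>k\<in>H. f k (quadrant \<omega> x k)) = ennreal ((\<Prod>k\<in>H. quadrant \<omega> x k) powr - s)"
        by (simp add: f_def prod_ennreal prod_powr_distrib)
      also have "(\<Prod>k\<in>V. f k (quadrant \<omega> x k)) = (\<Prod>k\<in>V. ennreal ((1 - quadrant \<omega> x k) powr - s))"
        using fin by (intro prod.cong) (auto simp: f_def)
      also have "\<dots> = ennreal ((\<Prod>k\<in>V. 1 - quadrant \<omega> x k) powr - s)"
        by (simp add: prod_ennreal prod_powr_distrib)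
      finally show "ennreal (?D x powr - s) = (\<Prod>k\<in>H \<union> V. f k (quadrant \<omega> x k))"
        by (simp add: powr_mult ennreal_mult)
    qed
    also have "\<dots> = (\<Prod>k\<in>H \<union> V. \<integral>\<^sup>+t. f k t \<partial>beta_measure \<alpha> \<beta>)"
      using fin unfolding f_def by (intro nn_integral_quadrant_prod) measurable
    also have "\<dots> = (\<Prod>k\<in>H. \<integral>\<^sup>+t. f k t \<partial>beta_measure \<alpha> \<beta>) * (\<Prod>k\<in>V. \<integral>\<^sup>+t. f k t \<partial>beta_measure \<alpha> \<beta>)"
      using fin by (intro prod.union_disjoint)
    also have "(\<Prod>k\<in>H. \<integral>\<^sup>+t. f k t \<partial>beta_measure \<alpha> \<beta>) = ennreal ((Beta (\<alpha> - s) \<beta> / Beta \<alpha> \<beta>) ^ card H)"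
      using h by (simp add: f_def mh ennreal_power less_imp_le)
    also have "(\<Prod>k\<in>V. \<integral>\<^sup>+t. f k t \<partial>beta_measure \<alpha> \<beta>) = (\<Prod>k\<in>V. \<integral>\<^sup>+t. ennreal ((1 - t) powr - s) \<partial>beta_measure \<alpha> \<beta>)"
    proof (rule prod.cong[OF refl])
      fix k assume "k \<in> V"
      then have "k \<notin> H" using fin by auto
      then show "(\<integral>\<^sup>+t. f k t \<partial>beta_measure \<alpha> \<beta>) = (\<integral>\<^sup>+t. ennreal ((1 - t) powr - s) \<partial>beta_measure \<alpha> \<beta>)"
        by (simp add: f_def)
    qed
    also have "\<dots> = ennreal ((Beta \<alpha> (\<beta> - s) / Beta \<alpha> \<beta>) ^ card V)"
      using v by (simp add: mv ennreal_power less_imp_le)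
    finally show "(\<integral>\<^sup>+x. ennreal (?D x powr - s) \<partial>M) \<le> ennreal ((Beta (\<alpha> - s) \<beta> / Beta \<alpha> \<beta>) ^ card H * (Beta \<alpha> (\<beta> - s) / Beta \<alpha> \<beta>) ^ card V)"
      using h v by (simp add: ennreal_mult)
  qed (use c in auto)
  then show ?thesis using h v by (simp add: emeasure_eq_measure mult.assoc)
qed

lemma near_exit_quadrant_small_prob:
  assumes l: "l > 0" "l1 > 0" "l2 > 0"
    and s: "0 < s" "s \<le> 1" "2 * s < l" "2 * s < l1" "2 * s < l2"
    and mono: "mom_v \<alpha> l s \<le> mom_v \<alpha> l1 s" "mom_h \<alpha> \<beta> l s \<le> mom_h \<alpha> \<beta> l2 s"
    and tB: "t > 0" "B > 0" and K: "K \<le> Suc n"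
  shows "prob_space.prob M {x \<in> space M. near_exit m n K (quadrant \<omega> x) \<le> t / (2 * B)}
    \<le> t powr s * harm_bound \<alpha> \<beta> l (Suc m) (Suc n) (- s)
      + (4 / t) powr s * (real (Suc n) * harm_bound \<alpha> \<beta> l1 (Suc m) (Suc n) s * (mom_v \<alpha> l s / mom_v \<alpha> l1 s) ^ K)
      + (4 / t) powr s * (real (Suc m) * harm_bound \<alpha> \<beta> l2 (Suc m) (Suc n) s * (mom_h \<alpha> \<beta> l s / mom_h \<alpha> \<beta> l2 s) ^ K)
      + B powr - s * mom_v \<alpha> l s ^ K"
    (is "_ \<le> ?E")
proof -
  interpret prob_space M by (rule prob_space_env)
  have m[measurable]: "(\<lambda>x. near_exit m n K (quadrant \<omega> x)) \<in> borel_measurable M"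
    unfolding near_exit_def exit_right_def exit_top_def by measurable
  have "emeasure M {x \<in> space M. near_exit m n K (quadrant \<omega> x) \<le> t / (2 * B)}
     = (\<integral>\<^sup>+x. indicator {u. u \<le> t / (2 * B)} (near_exit m n K (quadrant \<omega> x)) \<partial>M)"
    by (rule emeasure_le_eq_nn_integral) measurable
  also have "\<dots> = (\<integral>\<^sup>+x. indicator {u. u \<le> t / (2 * B)} (near_exit m n K x) \<partial>bulk_measure \<alpha> \<beta> (Suc m) (Suc n))"
    by (rule nn_integral_quadrant) (auto simp: near_exit_restrict)
  also have "\<dots> = emeasure (bulk_measure \<alpha> \<beta> (Suc m) (Suc n)) {w \<in> space (bulk_measure \<alpha> \<beta> (Suc m) (Suc n)). near_exit m n K w \<le> t / (2 * B)}"
    by (rule emeasure_le_eq_nn_integral[symmetric]) measurable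
  also have "\<dots> \<le> ennreal ?E" by (rule near_exit_small_prob[OF pos assms])
  finally have *: "emeasure M {x \<in> space M. near_exit m n K (quadrant \<omega> x) \<le> t / (2 * B)} \<le> ennreal ?E" .
  have "harm_bound \<alpha> \<beta> l (Suc m) (Suc n) (- s) \<ge> 0" "harm_bound \<alpha> \<beta> l1 (Suc m) (Suc n) s \<ge> 0"
    "harm_bound \<alpha> \<beta> l2 (Suc m) (Suc n) s \<ge> 0"
    by (simp_all add: harm_bound_def[OF pos l(1)] harm_bound_def[OF pos l(2)] harm_bound_def[OF pos l(3)])
  moreover have "mom_v \<alpha> l s > 0" "mom_v \<alpha> l1 s > 0" "mom_h \<alpha> \<beta> l s > 0" "mom_h \<alpha> \<beta> l2 s > 0"
    using mom_v_pos[OF pos l(1), of s] mom_v_pos[OF pos l(2), of s] mom_h_pos[OF pos l(1), of s] mom_h_pos[OF pos l(3), of s] s l pos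
    by auto
  ultimately have "0 \<le> ?E"
    by (intro add_nonneg_nonneg mult_nonneg_nonneg zero_le_power divide_nonneg_nonneg) auto
  with * show ?thesis by (simp only: emeasure_eq_measure ennreal_le_iff)
qed

lemma exit_right_large_prob:
  assumes "l > 0" "0 < s" "2 * s < l" "t > 0"
  shows "prob_space.prob M {x \<in> space M. t \<le> exit_right (quadrant \<omega> x) m n}
    \<le> (1 / t) powr s * (harm_bound \<alpha> \<beta> l (Suc m) (Suc n) s / mom_v \<alpha> l s)"
proof -
  interpret prob_space M by (rule prob_space_env)
  have [measurable]: "(\<lambda>x. exit_right (quadrant \<omega> x) m n) \<in> borel_measurable M"
    unfolding exit_right_def by measurable
  have mv: "mom_v \<alpha> l s > 0" using mom_v_pos[OF pos assms(1), of s] assms by simp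
  have "emeasure M {x \<in> space M. t \<le> exit_right (quadrant \<omega> x) m n}
     \<le> ennreal ((1 / t) powr s * (harm_bound \<alpha> \<beta> l (Suc m) (Suc n) s / mom_v \<alpha> l s))"
  proof (rule emeasure_powr_Markov[where f = "\<lambda>x. exit_right (quadrant \<omega> x) m n" and s = s])
    show "AE x in M. t \<le> exit_right (quadrant \<omega> x) m n \<longrightarrow> 1 \<le> (1 / t) powr s * exit_right (quadrant \<omega> x) m n powr s"
    proof (intro AE_I2 impI)
      fix x assume "t \<le> exit_right (quadrant \<omega> x) m n"
      then have "1 \<le> (exit_right (quadrant \<omega> x) m n / t) powr s"
        using assms by (intro ge_one_powr_ge_zero) auto
      then show "1 \<le> (1 / t) powr s * exit_right (quadrant \<omega> x) m n powr s"
        by (simp add: powr_mult[symmetric])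
    qed
    have "(\<integral>\<^sup>+x. ennreal (exit_right (quadrant \<omega> x) m n powr s) \<partial>M) =
        (\<integral>\<^sup>+x. ennreal (exit_right x m n powr s) \<partial>bulk_measure \<alpha> \<beta> (Suc m) (Suc n))"
      by (rule nn_integral_quadrant) (auto simp: exit_restrict)
    also have "\<dots> \<le> ennreal (harm_bound \<alpha> \<beta> l (Suc m) (Suc n) s / mom_v \<alpha> l s ^ (Suc n - n))"
      using assms by (intro exit_right_moment_bound[OF pos]) auto
    finally show "(\<integral>\<^sup>+x. ennreal (exit_right (quadrant \<omega> x) m n powr s) \<partial>M) \<le> ennreal (harm_bound \<alpha> \<beta> l (Suc m) (Suc n) s / mom_v \<alpha> l s)"
      by simp
  qed auto
  then show ?thesis using mv by (simp add: emeasure_eq_measure harm_bound_def[OF pos assms(1)])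
qed

end

section \<open>Exponential tails\<close>

text \<open>The prefactors p that occur are constants and side lengths, which grow at most
  linearly.\<close>

lemma exp_linear_tendsto_0:
  fixes g p :: "nat \<Rightarrow> real"
  assumes g: "(\<lambda>N. g N / real N) \<longlonglongrightarrow> c" "c < 0"
    and p: "(\<lambda>N. p N / real N) \<longlonglongrightarrow> d" "\<And>N. p N \<ge> 0"
  shows "(\<lambda>N. p N * exp (g N)) \<longlonglongrightarrow> 0"
proof (rule tendsto_sandwich)
  show "\<forall>\<^sub>F N in sequentially. 0 \<le> p N * exp (g N)" using p by simp
  have "\<forall>\<^sub>F N in sequentially. g N / real N < c / 2" using order_tendstoD(2)[OF g(1), of "c/2"] g(2) by simp
  moreover have "\<forall>\<^sub>F N in sequentially. p N / real N < d + 1" by (rule order_tendstoD(2)[OF p(1)]) simp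
  ultimately show "\<forall>\<^sub>F N in sequentially. p N * exp (g N) \<le> (d + 1) * real N * exp (c / 2 * real N)"
    using eventually_gt_at_top[of 0]
  proof eventually_elim
    case (elim N)
    then have "p N \<le> (d + 1) * real N" "g N \<le> c / 2 * real N" by (simp_all add: pos_divide_less_eq less_imp_le)
    then show ?case using p(2)[of N] by (intro mult_mono) auto
  qed
  show "(\<lambda>N. (d + 1) * real N * exp (c / 2 * real N)) \<longlonglongrightarrow> 0"
    using g(2) by real_asymp
qed simp

text \<open>Every exponent below is a function of the moment order s that vanishes at 0, so its
  derivative there decides whether small orders give decay.\<close>

lemma eventually_neg_of_deriv:
  fixes f :: "real \<Rightarrow> real"
  assumes "(f has_real_derivative d) (at 0)" "f 0 = 0" "d < 0"
  shows "\<forall>\<^sub>F s in at_right 0. f s < 0"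
proof -
  obtain e where "e > 0" "\<And>h. h > 0 \<Longrightarrow> h < e \<Longrightarrow> f (0 + h) < f 0"
    using DERIV_neg_dec_right[OF assms(1,3)] by blast
  then show ?thesis unfolding eventually_at_right_field using assms(2) by (intro exI[of _ e]) auto
qed

lemma floor_ratio_tendsto:
  assumes "e > 0"
  shows "(\<lambda>N. real (nat \<lfloor>e * real N\<rfloor>) / real N) \<longlonglongrightarrow> e"
proof -
  have "real (nat \<lfloor>e * real N\<rfloor>) = of_int \<lfloor>e * real N\<rfloor>" for N using assms by simp
  moreover have "(\<lambda>N. of_int \<lfloor>e * real N\<rfloor> / real N) \<longlonglongrightarrow> e" by real_asymp
  ultimately show ?thesis by simp
qed

lemma Suc_ratio_tendsto:
  assumes "(\<lambda>N. real (m N) / real N) \<longlonglongrightarrow> a"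
  shows "(\<lambda>N. real (Suc (m N)) / real N) \<longlonglongrightarrow> a"
proof -
  have "(\<lambda>N. real (m N) / real N + 1 / real N) \<longlonglongrightarrow> a + 0" by (intro tendsto_add assms lim_1_over_n)
  then show ?thesis by (simp add: add_divide_distrib add.commute)
qed

lemma eventually_exp_dominates:
  assumes "e > (0::real)"
  shows "\<forall>\<^sub>F N in sequentially. C * real N < exp (e * real N)"
  using assms by real_asymp

context
  fixes \<alpha> \<beta> :: real
  assumes pos: "\<alpha> > 0" "\<beta> > 0"
begin

text \<open>The derivative of a log-moment at order 0 is a mean logarithm; this is how the Digamma
  rates enter.\<close>

lemma ln_mom_v_deriv:
  assumes "l > 0"
  shows "((\<lambda>s. ln (mom_v \<alpha> l (c * s))) has_real_derivative - c * rate_v \<alpha> l) (at 0)"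
proof -
  have B: "Beta l \<alpha> > 0" using pos assms by (simp add: Beta_pos)
  have "((\<lambda>s. Beta (l - c * s) \<alpha>) has_real_derivative (Beta l \<alpha> * (Digamma l - Digamma (l + \<alpha>))) * (- c)) (at 0)"
    using has_field_derivative_Beta1[of l \<alpha> UNIV] assms pos
    by (intro DERIV_chain'[of "\<lambda>s. l - c * s" "-c" 0 UNIV "\<lambda>x. Beta x \<alpha>"])
      (auto intro!: derivative_eq_intros elim!: nonpos_Ints_cases)
  then have "((\<lambda>s. ln (Beta (l - c * s) \<alpha> / Beta l \<alpha>)) has_real_derivative
     (1 / (Beta (l - c * 0) \<alpha> / Beta l \<alpha>)) * ((Beta l \<alpha> * (Digamma l - Digamma (l + \<alpha>))) * (- c) / Beta l \<alpha>)) (at 0)"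
    using B by (intro DERIV_chain'[where g = ln] DERIV_ln_divide DERIV_cdivide) auto
  then show ?thesis using B by (simp add: mom_v_def rate_v_def add.commute mult.commute)
qed

lemma ln_mom_h_deriv:
  assumes "l > 0"
  shows "((\<lambda>s. ln (mom_h \<alpha> \<beta> l (c * s))) has_real_derivative - c * rate_h \<alpha> \<beta> l) (at 0)"
proof -
  have B: "Beta (\<alpha> + l) \<beta> > 0" using pos assms by (simp add: Beta_pos)
  have "((\<lambda>s. Beta (\<alpha> + l + c * s) \<beta>) has_real_derivative (Beta (\<alpha> + l) \<beta> * (Digamma (\<alpha> + l) - Digamma (\<alpha> + l + \<beta>))) * c) (at 0)"
    using has_field_derivative_Beta1[of "\<alpha> + l" \<beta> UNIV] assms pos
    by (intro DERIV_chain'[of "\<lambda>s. \<alpha> + l + c * s" c 0 UNIV "\<lambda>x. Beta x \<beta>"])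
      (auto intro!: derivative_eq_intros elim!: nonpos_Ints_cases)
  then have "((\<lambda>s. ln (Beta (\<alpha> + l + c * s) \<beta> / Beta (\<alpha> + l) \<beta>)) has_real_derivative
     (1 / (Beta (\<alpha> + l + c * 0) \<beta> / Beta (\<alpha> + l) \<beta>)) * ((Beta (\<alpha> + l) \<beta> * (Digamma (\<alpha> + l) - Digamma (\<alpha> + l + \<beta>))) * c / Beta (\<alpha> + l) \<beta>)) (at 0)"
    using B by (intro DERIV_chain'[where g = ln] DERIV_ln_divide DERIV_cdivide) auto
  moreover have "(1 / (Beta (\<alpha> + l + c * 0) \<beta> / Beta (\<alpha> + l) \<beta>)) * ((Beta (\<alpha> + l) \<beta> * (Digamma (\<alpha> + l) - Digamma (\<alpha> + l + \<beta>))) * c / Beta (\<alpha> + l) \<beta>)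
     = - c * rate_h \<alpha> \<beta> l"
    using B by (simp add: rate_h_def field_simps)
  ultimately show ?thesis by (simp add: mom_h_def)
qed

lemma mom_0: "l > 0 \<Longrightarrow> mom_h \<alpha> \<beta> l 0 = 1" "l > 0 \<Longrightarrow> mom_v \<alpha> l 0 = 1"
  using Beta_pos[of "\<alpha> + l" \<beta>] Beta_pos[of l \<alpha>] pos by (simp_all add: mom_h_def mom_v_def)

text \<open>The common form of the error terms. The summand with c comes from the threshold in
  Markov's inequality; the middle part is the exponent of \<open>harm_bound\<close>, with k = 1 or k
  = -1 for the sign of the moment and k = 0 where it is absent; D accounts for K further factors.
  Per unit of N the exponent converges to a function of s whose derivative at 0 is the quantity in
  \<open>neg\<close>.\<close>

lemma exponent_tail:
  fixes D :: "real \<Rightarrow> real" and m n K :: "nat \<Rightarrow> nat" and p :: "nat \<Rightarrow> real"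
  assumes l: "l > 0"
    and m: "(\<lambda>N. real (m N) / real N) \<longlonglongrightarrow> a" and n: "(\<lambda>N. real (n N) / real N) \<longlonglongrightarrow> b"
    and K: "(\<lambda>N. real (K N) / real N) \<longlonglongrightarrow> e"
    and p: "(\<lambda>N. p N / real N) \<longlonglongrightarrow> q" "\<And>N. p N \<ge> 0"
    and D: "(D has_real_derivative d) (at 0)" "D 0 = 0"
    and neg: "c - k * lin_rate \<alpha> \<beta> a b l + e * d < 0"
  shows "\<forall>\<^sub>F s in at_right 0. (\<lambda>N. p N * exp (s * (real N * c) + (real (Suc (m N)) * ln (mom_h \<alpha> \<beta> l (2 * k * s)) +
    real (Suc (n N)) * ln (mom_v \<alpha> l (2 * k * s))) / 2 + real (K N) * D s)) \<longlonglongrightarrow> 0"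
proof -
  define \<phi> where "\<phi> s = s * c + (a * ln (mom_h \<alpha> \<beta> l (2 * k * s)) + b * ln (mom_v \<alpha> l (2 * k * s))) / 2 + e * D s" for s
  have "\<forall>\<^sub>F s in at_right 0. \<phi> s < 0"
  proof (rule eventually_neg_of_deriv)
    show "(\<phi> has_real_derivative 1 * c + (a * (- (2 * k) * rate_h \<alpha> \<beta> l) + b * (- (2 * k) * rate_v \<alpha> l)) / 2 + e * d) (at 0)"
      unfolding \<phi>_def[abs_def]
      by (intro DERIV_add DERIV_cmult_right DERIV_cdivide DERIV_cmult ln_mom_h_deriv ln_mom_v_deriv l D(1) DERIV_ident)
    show "1 * c + (a * (- (2 * k) * rate_h \<alpha> \<beta> l) + b * (- (2 * k) * rate_v \<alpha> l)) / 2 + e * d < 0"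
      using neg by (simp add: lin_rate_def algebra_simps add_divide_distrib diff_divide_distrib)
  qed (simp add: \<phi>_def mom_0[OF l] D)
  then show ?thesis
  proof eventually_elim
    case (elim s)
    let ?g = "\<lambda>N. s * (real N * c) + (real (Suc (m N)) * ln (mom_h \<alpha> \<beta> l (2 * k * s)) +
      real (Suc (n N)) * ln (mom_v \<alpha> l (2 * k * s))) / 2 + real (K N) * D s"
    have NN: "(\<lambda>N. real N / real N) \<longlonglongrightarrow> 1"
      by (rule tendsto_eventually) (use eventually_gt_at_top[of 0] in \<open>auto elim: eventually_mono\<close>)
    have "(\<lambda>N. s * (real N / real N * c) + (real (Suc (m N)) / real N * ln (mom_h \<alpha> \<beta> l (2 * k * s)) +
        real (Suc (n N)) / real N * ln (mom_v \<alpha> l (2 * k * s))) / 2 + real (K N) / real N * D s)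
      \<longlonglongrightarrow> s * (1 * c) + (a * ln (mom_h \<alpha> \<beta> l (2 * k * s)) + b * ln (mom_v \<alpha> l (2 * k * s))) / 2 + e * D s"
      by (intro tendsto_add tendsto_mult tendsto_divide tendsto_const NN Suc_ratio_tendsto[OF m] Suc_ratio_tendsto[OF n] K) simp
    also have "(\<lambda>N. s * (real N / real N * c) + (real (Suc (m N)) / real N * ln (mom_h \<alpha> \<beta> l (2 * k * s)) +
        real (Suc (n N)) / real N * ln (mom_v \<alpha> l (2 * k * s))) / 2 + real (K N) / real N * D s) = (\<lambda>N. ?g N / real N)"
      by (rule ext, rename_tac N, case_tac "N = 0") (simp_all add: field_simps del: of_nat_Suc)
    finally have "(\<lambda>N. ?g N / real N) \<longlonglongrightarrow> \<phi> s" by (simp add: \<phi>_def)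
    from exp_linear_tendsto_0[OF this elim p] show ?case .
  qed
qed

lemma rate_v_strict_mono:
  assumes "0 < x" "x < y"
  shows "rate_v \<alpha> x < rate_v \<alpha> y"
proof (rule DERIV_pos_imp_increasing[OF assms(2)])
  fix l assume l: "x \<le> l" "l \<le> y"
  have "((\<lambda>l. Digamma (0 + l) - Digamma (\<alpha> + l)) has_real_derivative Polygamma (Suc 0) (0 + l) - Polygamma (Suc 0) (\<alpha> + l)) (at l)"
    using l assms pos by (intro DERIV_diff has_real_derivative_Polygamma_shift) auto
  then have "(rate_v \<alpha> has_real_derivative Polygamma (Suc 0) l - Polygamma (Suc 0) (\<alpha> + l)) (at l)"
    by (simp add: rate_v_def[abs_def])
  moreover have "Polygamma (Suc 0) l - Polygamma (Suc 0) (\<alpha> + l) > 0"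
    using Trigamma_gap_pos[OF pos, of l \<alpha>] l assms pos by simp
  ultimately show "\<exists>z. (rate_v \<alpha> has_real_derivative z) (at l) \<and> z > 0" by blast
qed

text \<open>\<open>l\<close> is a critical point of \<open>lin_rate \<alpha> \<beta> a b\<close>.\<close>

definition characteristic :: "real \<Rightarrow> real \<Rightarrow> real \<Rightarrow> bool" where
  "characteristic a b l \<longleftrightarrow>
     b * (Polygamma 1 l - Polygamma 1 (\<alpha> + l)) = a * (Polygamma 1 (\<alpha> + l) - Polygamma 1 (\<alpha> + \<beta> + l))"

lemma characteristic_derivative:
  assumes "l > 0" "characteristic a b l"
  shows "(lin_rate \<alpha> \<beta> a b has_real_derivative 0) (at l)"
  using has_real_derivative_lin_rate[OF pos assms(1), of a b] assms(2) by (simp add: characteristic_def)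

text \<open>At a critical point the linear rate changes to second order, the boundary rate to first order.\<close>

lemma comparison_parameter_v:
  assumes "l > 0" "characteristic a b l" "e > 0"
  obtains l1 where "0 < l1" "l1 < l" "lin_rate \<alpha> \<beta> a b l < lin_rate \<alpha> \<beta> a b l1 + e * (rate_v \<alpha> l - rate_v \<alpha> l1)"
proof -
  have rv: "(rate_v \<alpha> has_real_derivative Polygamma 1 l - Polygamma 1 (\<alpha> + l)) (at l)"
    using has_real_derivative_lin_rate[OF pos assms(1), of 0 1] by (simp add: lin_rate_def[abs_def])
  have "((\<lambda>x. lin_rate \<alpha> \<beta> a b x + e * (rate_v \<alpha> l - rate_v \<alpha> x)) has_real_derivative
     0 + e * (0 - (Polygamma 1 l - Polygamma 1 (\<alpha> + l)))) (at l)"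
    by (intro DERIV_add DERIV_cmult DERIV_diff DERIV_const rv characteristic_derivative assms)
  moreover have "0 + e * (0 - (Polygamma 1 l - Polygamma 1 (\<alpha> + l))) < 0"
    using Trigamma_gap_pos[OF pos assms(1), of \<alpha>] pos assms by (simp add: mult_less_0_iff)
  ultimately obtain d where d: "d > 0" "\<And>h. h > 0 \<Longrightarrow> h < d \<Longrightarrow>
     lin_rate \<alpha> \<beta> a b l + e * (rate_v \<alpha> l - rate_v \<alpha> l) < lin_rate \<alpha> \<beta> a b (l - h) + e * (rate_v \<alpha> l - rate_v \<alpha> (l - h))"
    using DERIV_neg_dec_left by blast
  define h where "h = min (d / 2) (l / 2)"
  have "h > 0" "h < d" "h < l" using d assms by (auto simp: h_def min_less_iff_disj)
  with d(2)[of h] that[of "l - h"] show ?thesis by simp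
qed

lemma comparison_parameter_h:
  assumes "l > 0" "characteristic a b l" "e > 0"
  obtains l2 where "l < l2" "lin_rate \<alpha> \<beta> a b l < lin_rate \<alpha> \<beta> a b l2 + e * (rate_h \<alpha> \<beta> l - rate_h \<alpha> \<beta> l2)"
proof -
  have rh: "(rate_h \<alpha> \<beta> has_real_derivative - (Polygamma 1 (\<alpha> + l) - Polygamma 1 (\<alpha> + \<beta> + l))) (at l)"
    using has_real_derivative_lin_rate[OF pos assms(1), of 1 0] by (simp add: lin_rate_def[abs_def])
  have "((\<lambda>x. lin_rate \<alpha> \<beta> a b x + e * (rate_h \<alpha> \<beta> l - rate_h \<alpha> \<beta> x)) has_real_derivative
     0 + e * (0 - (- (Polygamma 1 (\<alpha> + l) - Polygamma 1 (\<alpha> + \<beta> + l))))) (at l)"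
    by (intro DERIV_add DERIV_cmult DERIV_diff DERIV_const rh characteristic_derivative assms)
  moreover have "0 + e * (0 - (- (Polygamma 1 (\<alpha> + l) - Polygamma 1 (\<alpha> + \<beta> + l)))) > 0"
    using Trigamma_gap_pos[OF pos, of "\<alpha> + l" \<beta>] pos assms by (simp add: add_ac)
  ultimately obtain d where d: "d > 0" "\<And>h. h > 0 \<Longrightarrow> h < d \<Longrightarrow>
     lin_rate \<alpha> \<beta> a b l + e * (rate_h \<alpha> \<beta> l - rate_h \<alpha> \<beta> l) < lin_rate \<alpha> \<beta> a b (l + h) + e * (rate_h \<alpha> \<beta> l - rate_h \<alpha> \<beta> (l + h))"
    using DERIV_pos_inc_right by blast
  with d(2)[of "d / 2"] that[of "l + d / 2"] show ?thesis by simp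
qed

context
  fixes M :: "'s measure" and \<omega> :: "site \<Rightarrow> 's \<Rightarrow> real"
  assumes env: "beta_environment \<alpha> \<beta> M \<omega>"
begin

text \<open>The thresholds t = exp (- N (f + d)) and B = exp (N C e) turn
  \<open>near_exit_small_prob\<close> into four exponential terms. With K of order e N, the first
  order gain of the comparison parameters l1 and l2 outweighs the second order change of the linear
  rate.\<close>

lemma near_exit_tail:
  assumes l: "l > 0" and char: "characteristic a b l" and e: "0 < e" "e < b" and \<delta>: "\<delta> > 0"
    and m: "(\<lambda>N. real (m N) / real N) \<longlonglongrightarrow> a" and n: "(\<lambda>N. real (n N) / real N) \<longlonglongrightarrow> b"
  shows "(\<lambda>N. prob_space.prob M {x \<in> space M. near_exit (m N) (n N) (nat \<lfloor>e * real N\<rfloor>) (quadrant \<omega> x)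
     \<le> exp (- real N * (lin_rate \<alpha> \<beta> a b l + \<delta> + (1 - rate_v \<alpha> l) * e)) / 2}) \<longlonglongrightarrow> 0"
proof -
  interpret prob_space M by (rule prob_space_env[OF pos env])
  define f where "f = lin_rate \<alpha> \<beta> a b l"
  define K where "K N = nat \<lfloor>e * real N\<rfloor>" for N
  obtain l1 where l1: "0 < l1" "l1 < l" "f < lin_rate \<alpha> \<beta> a b l1 + e * (rate_v \<alpha> l - rate_v \<alpha> l1)"
    using comparison_parameter_v[OF l char e(1)] unfolding f_def by blast
  obtain l2 where l2: "l < l2" "f < lin_rate \<alpha> \<beta> a b l2 + e * (rate_h \<alpha> \<beta> l - rate_h \<alpha> \<beta> l2)"
    using comparison_parameter_h[OF l char e(1)] unfolding f_def by blast
  \<comment> \<open>At most half of each gap, so that f + d stays strictly below both comparison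
    values.\<close>
  define d where "d = min \<delta> (min ((lin_rate \<alpha> \<beta> a b l1 + e * (rate_v \<alpha> l - rate_v \<alpha> l1) - f) / 2)
     ((lin_rate \<alpha> \<beta> a b l2 + e * (rate_h \<alpha> \<beta> l - rate_h \<alpha> \<beta> l2) - f) / 2))"
  have d: "0 < d" "d \<le> \<delta>" "f + d < lin_rate \<alpha> \<beta> a b l1 + e * (rate_v \<alpha> l - rate_v \<alpha> l1)"
     "f + d < lin_rate \<alpha> \<beta> a b l2 + e * (rate_h \<alpha> \<beta> l - rate_h \<alpha> \<beta> l2)"
    using \<delta> l1 l2 by (auto simp: d_def min_def field_simps)
  \<comment> \<open>The boundary product over about e N edges has exponential growth rate -
    \<open>rate_v \<alpha> l\<close> * e; the summand 1 places the threshold exp (C e N) above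
    it.\<close>
  define C where "C = 1 - rate_v \<alpha> l"
  define Lh where "Lh l s = ln (mom_h \<alpha> \<beta> l s)" for l s
  define Lv where "Lv l s = ln (mom_v \<alpha> l s)" for l s
  have l20: "l2 > 0" using l l2 by simp
  have dLh: "(Lh l has_real_derivative - rate_h \<alpha> \<beta> l) (at 0)" if "l > 0" for l
    unfolding Lh_def using ln_mom_h_deriv[OF that, of 1] by simp
  have dLv: "(Lv l has_real_derivative - rate_v \<alpha> l) (at 0)" if "l > 0" for l
    unfolding Lv_def using ln_mom_v_deriv[OF that, of 1] by simp
  have L0: "Lh l 0 = 0" "Lv l 0 = 0" if "l > 0" for l using mom_0[OF that] by (simp_all add: Lh_def Lv_def)
  have KN: "(\<lambda>N. real (K N) / real N) \<longlonglongrightarrow> e" unfolding K_def by (rule floor_ratio_tendsto[OF e(1)])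
  note Sn = Suc_ratio_tendsto[OF n] and Sm = Suc_ratio_tendsto[OF m] and one = lim_1_over_n[where 'a = real]
  define g where "g k c l D s N = s * (real N * c) + (real (Suc (m N)) * ln (mom_h \<alpha> \<beta> l (2 * k * s)) +
    real (Suc (n N)) * ln (mom_v \<alpha> l (2 * k * s))) / 2 + real (K N) * D s" for k c l and D :: "real \<Rightarrow> real" and s N
  note ex = exponent_tail[OF _ m n KN]
  \<comment> \<open>This and the next three facts treat the four error terms in their order in
    \<open>near_exit_small_prob\<close>, with k = -1, 1, 1 and 0.\<close>
  have "\<forall>\<^sub>F s in at_right 0. (\<lambda>N. 1 * exp (g (- 1) (- (f + d)) l (\<lambda>_. 0) s N)) \<longlonglongrightarrow> 0"
    unfolding g_def by (rule ex[where d = 0, OF l one]) (use d in \<open>auto simp: f_def\<close>)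
  moreover have "\<forall>\<^sub>F s in at_right 0. (\<lambda>N. real (Suc (n N)) * exp (g 1 (f + d) l1 (\<lambda>s. Lv l s - Lv l1 s) s N)) \<longlonglongrightarrow> 0"
    unfolding g_def
    by (rule ex[OF l1(1) Sn _ DERIV_diff[OF dLv[OF l] dLv[OF l1(1)]]])
      (use d l l1 in \<open>auto simp: L0 algebra_simps\<close>)
  moreover have "\<forall>\<^sub>F s in at_right 0. (\<lambda>N. real (Suc (m N)) * exp (g 1 (f + d) l2 (\<lambda>s. Lh l s - Lh l2 s) s N)) \<longlonglongrightarrow> 0"
    unfolding g_def
    by (rule ex[OF l20 Sm _ DERIV_diff[OF dLh[OF l] dLh[OF l20]]])
      (use d l l20 in \<open>auto simp: L0 algebra_simps\<close>)
  moreover have "\<forall>\<^sub>F s in at_right 0. (\<lambda>N. 1 * exp (g 0 (- (C * e)) l (Lv l) s N)) \<longlonglongrightarrow> 0"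
    unfolding g_def
    by (rule ex[where d = "- rate_v \<alpha> l", OF l one]) (use e l dLv in \<open>auto simp: L0 C_def algebra_simps\<close>)
  moreover have "\<forall>\<^sub>F s in at_right 0. Lv l s - Lv l1 s < 0"
    by (rule eventually_neg_of_deriv[OF DERIV_diff[OF dLv[OF l] dLv[OF l1(1)]]])
      (use rate_v_strict_mono l l1 in \<open>auto simp: L0\<close>)
  moreover have "\<forall>\<^sub>F s in at_right 0. Lh l s - Lh l2 s < 0"
    by (rule eventually_neg_of_deriv[OF DERIV_diff[OF dLh[OF l] dLh[OF l20]]])
      (use rate_h_antimono[OF pos, of l l2] l l2 l20 in \<open>auto simp: L0\<close>)
  moreover have "\<forall>\<^sub>F s in at_right 0. (0::real) < s \<and> s < min 1 (l1 / 2)"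
    unfolding eventually_at_right_field using l1 by (intro exI[of _ "min 1 (l1 / 2)"]) auto
  ultimately have ev: "\<forall>\<^sub>F s in at_right 0. (\<lambda>N. 1 * exp (g (- 1) (- (f + d)) l (\<lambda>_. 0) s N)) \<longlonglongrightarrow> 0 \<and>
      (\<lambda>N. real (Suc (n N)) * exp (g 1 (f + d) l1 (\<lambda>s. Lv l s - Lv l1 s) s N)) \<longlonglongrightarrow> 0 \<and>
      (\<lambda>N. real (Suc (m N)) * exp (g 1 (f + d) l2 (\<lambda>s. Lh l s - Lh l2 s) s N)) \<longlonglongrightarrow> 0 \<and>
      (\<lambda>N. 1 * exp (g 0 (- (C * e)) l (Lv l) s N)) \<longlonglongrightarrow> 0 \<and>
      Lv l s - Lv l1 s < 0 \<and> Lh l s - Lh l2 s < 0 \<and> 0 < s \<and> s < min 1 (l1 / 2)"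
    unfolding eventually_conj_iff by simp
  have "at_right (0::real) \<noteq> bot" by simp
  \<comment> \<open>Finitely many properties hold for all sufficiently small s > 0, so one s
    satisfies them together.\<close>
  from eventually_happens'[OF this ev] obtain s where
    G: "(\<lambda>N. 1 * exp (g (- 1) (- (f + d)) l (\<lambda>_. 0) s N)) \<longlonglongrightarrow> 0"
      "(\<lambda>N. real (Suc (n N)) * exp (g 1 (f + d) l1 (\<lambda>s. Lv l s - Lv l1 s) s N)) \<longlonglongrightarrow> 0"
      "(\<lambda>N. real (Suc (m N)) * exp (g 1 (f + d) l2 (\<lambda>s. Lh l s - Lh l2 s) s N)) \<longlonglongrightarrow> 0"
      "(\<lambda>N. 1 * exp (g 0 (- (C * e)) l (Lv l) s N)) \<longlonglongrightarrow> 0"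
    and s: "Lv l s < Lv l1 s" "Lh l s < Lh l2 s" "0 < s" "s < 1" "2 * s < l1"
    by auto
  have sl: "2 * s < l" "2 * s < l2" "s < l" "s < l1" "s < l2" using s l1 l2 by auto
  have mp: "mom_v \<alpha> l s > 0" "mom_v \<alpha> l1 s > 0" "mom_h \<alpha> \<beta> l s > 0" "mom_h \<alpha> \<beta> l2 s > 0"
    using mom_v_pos[OF pos l, of s] mom_v_pos[OF pos l1(1), of s] mom_h_pos[OF pos l, of s] mom_h_pos[OF pos l20, of s] s sl pos l l20 by auto
  have mono: "mom_v \<alpha> l s \<le> mom_v \<alpha> l1 s" "mom_h \<alpha> \<beta> l s \<le> mom_h \<alpha> \<beta> l2 s"
    using s(1,2) mp by (simp_all add: Lv_def Lh_def)
  define E where "E N = 1 * exp (g (- 1) (- (f + d)) l (\<lambda>_. 0) s N)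
    + 4 powr s * (real (Suc (n N)) * exp (g 1 (f + d) l1 (\<lambda>s. Lv l s - Lv l1 s) s N))
    + 4 powr s * (real (Suc (m N)) * exp (g 1 (f + d) l2 (\<lambda>s. Lh l s - Lh l2 s) s N))
    + 1 * exp (g 0 (- (C * e)) l (Lv l) s N)" for N
  have "E \<longlonglongrightarrow> 0 + 4 powr s * 0 + 4 powr s * 0 + 0"
    unfolding E_def[abs_def] by (intro tendsto_add tendsto_mult_left G)
  then have E0: "E \<longlonglongrightarrow> 0" by simp
  have Kn: "\<forall>\<^sub>F N in sequentially. K N \<le> Suc (n N)"
  proof -
    have "(\<lambda>N. real (K N) / real N - real (Suc (n N)) / real N) \<longlonglongrightarrow> e - b" by (intro tendsto_diff KN Sn)
    then have "\<forall>\<^sub>F N in sequentially. real (K N) / real N - real (Suc (n N)) / real N < 0"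
      using e by (intro order_tendstoD(2)) auto
    then show ?thesis using eventually_gt_at_top[of 0]
      by eventually_elim (simp add: divide_strict_right_mono diff_divide_distrib[symmetric] divide_less_0_iff)
  qed
  show ?thesis
  proof (rule tendsto_sandwich[OF _ _ tendsto_const E0])
    show "\<forall>\<^sub>F N in sequentially. prob {x \<in> space M. near_exit (m N) (n N) (nat \<lfloor>e * real N\<rfloor>) (quadrant \<omega> x)
       \<le> exp (- real N * (lin_rate \<alpha> \<beta> a b l + \<delta> + (1 - rate_v \<alpha> l) * e)) / 2} \<le> E N"
      using Kn
    proof eventually_elim
      case (elim N)
      define t where "t = exp (- (real N * (f + d)))"
      define B where "B = exp (real N * (C * e))"
      have [measurable]: "(\<lambda>x. near_exit (m N) (n N) (K N) (quadrant \<omega> x)) \<in> borel_measurable M"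
        unfolding near_exit_def exit_right_def exit_top_def
        using reach_quadrant_measurable[OF pos env] quadrant_measurable[OF pos env] by measurable
      have "- real N * (f + d + C * e) = - (real N * (f + d)) - real N * (C * e)" by (simp add: algebra_simps)
      then have "t / (2 * B) = exp (- real N * (f + d + C * e)) / 2"
        by (simp only: t_def B_def exp_diff) simp
      moreover have "exp (- real N * (f + \<delta> + C * e)) \<le> exp (- real N * (f + d + C * e))"
        using d by (simp add: mult_left_mono)
      ultimately have le: "exp (- real N * (f + \<delta> + C * e)) / 2 \<le> t / (2 * B)" by simp
      have "prob {x \<in> space M. near_exit (m N) (n N) (K N) (quadrant \<omega> x) \<le> exp (- real N * (f + \<delta> + C * e)) / 2}
         \<le> prob {x \<in> space M. near_exit (m N) (n N) (K N) (quadrant \<omega> x) \<le> t / (2 * B)}"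
        using le by (intro finite_measure_mono) auto
      also have "\<dots> \<le> t powr s * harm_bound \<alpha> \<beta> l (Suc (m N)) (Suc (n N)) (- s)
        + (4 / t) powr s * (real (Suc (n N)) * harm_bound \<alpha> \<beta> l1 (Suc (m N)) (Suc (n N)) s * (mom_v \<alpha> l s / mom_v \<alpha> l1 s) ^ K N)
        + (4 / t) powr s * (real (Suc (m N)) * harm_bound \<alpha> \<beta> l2 (Suc (m N)) (Suc (n N)) s * (mom_h \<alpha> \<beta> l s / mom_h \<alpha> \<beta> l2 s) ^ K N)
        + B powr - s * mom_v \<alpha> l s ^ K N"
        using s sl elim
        by (intro near_exit_quadrant_small_prob[OF pos env l l1(1) l20 _ _ _ _ _ mono]) (auto simp: t_def B_def)
      also have "\<dots> = E N"
      proof -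
        have pw: "q ^ k = exp (real k * ln q)" if "q > 0" for q :: real and k using that by (simp add: exp_of_nat_mult)
        have t1: "t powr s = exp (s * (real N * - (f + d)))" by (simp add: t_def exp_powr_real algebra_simps)
        have "t powr s = exp (- (s * (real N * (f + d))))" unfolding t1 by (simp add: algebra_simps)
        then have t2: "(4 / t) powr s = 4 powr s * exp (s * (real N * (f + d)))"
          by (simp only: powr_divide) (simp add: exp_minus divide_inverse)
        have B1: "B powr - s = exp (s * (real N * - (C * e)))" by (simp add: B_def exp_powr_real algebra_simps)
        have q1: "(mom_v \<alpha> l s / mom_v \<alpha> l1 s) ^ K N = exp (real (K N) * (Lv l s - Lv l1 s))"
          using mp by (subst pw) (auto simp: Lv_def ln_div)
        have q2: "(mom_h \<alpha> \<beta> l s / mom_h \<alpha> \<beta> l2 s) ^ K N = exp (real (K N) * (Lh l s - Lh l2 s))"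
          using mp by (subst pw) (auto simp: Lh_def ln_div)
        have q3: "mom_v \<alpha> l s ^ K N = exp (real (K N) * Lv l s)"
          using mp by (subst pw) (auto simp: Lv_def)
        show ?thesis
          unfolding E_def t1 t2 B1 q1 q2 q3 harm_bound_def[OF pos l] harm_bound_def[OF pos l1(1)] harm_bound_def[OF pos l20]
            g_def exp_add
          using mom_0[OF l] by (simp add: mult_ac)
      qed
      finally show ?case by (simp add: K_def f_def C_def)
    qed
  qed simp
qed

end

end

lemma (in prob_space) prob_tendsto_0_of_subset_Un:
  assumes [measurable]: "\<And>N. B N \<in> sets M" "\<And>N. C N \<in> sets M"
    and sub: "\<forall>\<^sub>F N in sequentially. AE x in M. x \<in> A N \<longrightarrow> x \<in> B N \<union> C N"
    and lim: "(\<lambda>N. prob (B N)) \<longlonglongrightarrow> 0" "(\<lambda>N. prob (C N)) \<longlonglongrightarrow> 0"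
  shows "(\<lambda>N. prob (A N)) \<longlonglongrightarrow> 0"
proof (rule tendsto_sandwich[OF _ _ tendsto_const])
  show "(\<lambda>N. prob (B N) + prob (C N)) \<longlonglongrightarrow> 0" using tendsto_add[OF lim] by simp
  show "\<forall>\<^sub>F N in sequentially. prob (A N) \<le> prob (B N) + prob (C N)"
    using sub
  proof eventually_elim
    case (elim N)
    then have "prob (A N) \<le> prob (B N \<union> C N)" by (rule finite_measure_mono_AE) measurable
    also have "\<dots> \<le> prob (B N) + prob (C N)" by (rule measure_Un_le) measurable
    finally show ?case .
  qed
qed simp

section \<open>Reaching a corner along explicit paths\<close>

lemma prod_subset_ge:
  fixes f :: "'a \<Rightarrow> real"
  assumes "finite B" "A \<subseteq> B" "\<And>x. x \<in> B \<Longrightarrow> 0 \<le> f x" "\<And>x. x \<in> B \<Longrightarrow> f x \<le> 1"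
  shows "prod f B \<le> prod f A"
proof -
  have "prod f B = prod f (B - A) * prod f A" using assms by (intro prod.subset_diff)
  also have "\<dots> \<le> 1 * prod f A"
    using assms by (intro mult_right_mono prod_le_1 prod_nonneg) auto
  finally show ?thesis by simp
qed

lemma reach_pos':
  assumes "\<forall>k. 0 < w k \<and> w k < 1"
  shows "reach w c r > 0"
  using reach_pos[of "Suc c" "Suc r" w c r] assms by simp

lemma reach_step_le:
  assumes w: "\<forall>k. 0 < w k \<and> w k < 1"
  shows "exit_top w c r \<le> reach w c (Suc r)" "exit_right w c r \<le> reach w (Suc c) r"
proof -
  have "exit_right w c r > 0" "exit_top w c r > 0" for c r
    using exit_pos[of "Suc c" "Suc r" w c r] w by auto
  then have pos: "exit_right w c r \<ge> 0" "exit_top w c r \<ge> 0" for c r by (simp_all add: less_imp_le)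
  show "exit_top w c r \<le> reach w c (Suc r)"
    using pos unfolding reach_eq_row_entry[of w c "Suc r"] row_entry_def by (auto split: nat.splits)
  show "exit_right w c r \<le> reach w (Suc c) r"
    using pos unfolding reach_eq_row_entry[of w "Suc c" r] row_entry_def by (auto split: nat.splits)
qed

lemma reach_vertical_le:
  assumes w: "\<forall>k. 0 < w k \<and> w k < 1" and "r \<le> q"
  shows "reach w c r * (\<Prod>k\<in>{r..<q}. 1 - w (c, k)) \<le> reach w c q"
  using assms(2)
proof (induction q rule: dec_induct)
  case (step q)
  have "reach w c r * (\<Prod>k\<in>{r..<Suc q}. 1 - w (c, k)) = (reach w c r * (\<Prod>k\<in>{r..<q}. 1 - w (c, k))) * (1 - w (c, q))"
    using step by (simp add: atLeastLessThanSuc)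
  also have "\<dots> \<le> reach w c q * (1 - w (c, q))"
    using step w by (intro mult_right_mono) (auto simp: less_imp_le)
  also have "\<dots> \<le> reach w c (Suc q)" using reach_step_le(1)[OF w, of c q] by (simp add: exit_top_def mult.commute)
  finally show ?case .
qed simp

lemma reach_horizontal_le:
  assumes w: "\<forall>k. 0 < w k \<and> w k < 1" and "c \<le> q"
  shows "reach w c r * (\<Prod>k\<in>{c..<q}. w (k, r)) \<le> reach w q r"
  using assms(2)
proof (induction q rule: dec_induct)
  case (step q)
  have "reach w c r * (\<Prod>k\<in>{c..<Suc q}. w (k, r)) = (reach w c r * (\<Prod>k\<in>{c..<q}. w (k, r))) * w (q, r)"
    using step by (simp add: atLeastLessThanSuc)
  also have "\<dots> \<le> reach w q r * w (q, r)"
    using step w by (intro mult_right_mono) (auto simp: less_imp_le)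
  also have "\<dots> \<le> reach w (Suc q) r" using reach_step_le(2)[OF w, of q r] by (simp add: exit_right_def mult.commute)
  finally show ?case .
qed simp

text \<open>An exit within K of the corner is continued to the corner straight up the right column
  or along the top row. Each of the 2 K continuations has probability at least the product of all
  these weights.\<close>

lemma reach_ge_near_exit:
  assumes w: "\<forall>k. 0 < w k \<and> w k < 1" and K: "K \<le> Suc m" "K \<le> Suc n"
  shows "near_exit m n K w * ((\<Prod>k\<in>{Suc m - K..m} \<times> {Suc n}. w k) * (\<Prod>k\<in>{Suc m} \<times> {Suc n - K..n}. 1 - w k))
    \<le> 2 * real K * reach w (Suc m) (Suc n)"
proof -
  let ?A = "\<Prod>k\<in>{Suc m - K..m}. w (k, Suc n)" and ?B = "\<Prod>k\<in>{Suc n - K..n}. 1 - w (Suc m, k)"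
  have w01: "0 \<le> w k" "w k \<le> 1" for k using spec[OF w, of k] by auto
  have A: "(\<Prod>k\<in>{Suc m - K..m} \<times> {Suc n}. w k) = ?A"
  proof -
    have "{Suc m - K..m} \<times> {Suc n} = (\<lambda>k. (k, Suc n)) ` {Suc m - K..m}" by auto
    then show ?thesis by (simp add: prod.reindex inj_on_def)
  qed
  have B: "(\<Prod>k\<in>{Suc m} \<times> {Suc n - K..n}. 1 - w k) = ?B"
  proof -
    have "{Suc m} \<times> {Suc n - K..n} = (\<lambda>k. (Suc m, k)) ` {Suc n - K..n}" by auto
    then show ?thesis by (simp add: prod.reindex inj_on_def)
  qed
  have A01: "0 \<le> ?A" "?A \<le> 1" using w01 by (auto intro!: prod_nonneg prod_le_1)
  have B01: "0 \<le> ?B" "?B \<le> 1" using w01 by (auto intro!: prod_nonneg prod_le_1)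
  have ep: "0 \<le> exit_right w c r" "0 \<le> exit_top w c r" for c r
    using exit_pos[of "Suc c" "Suc r" w c r] w by (auto simp: less_imp_le)
  have R: "exit_right w m r * (?A * ?B) \<le> reach w (Suc m) (Suc n)" if r: "r \<in> {Suc n - K..n}" for r
  proof -
    have "?A * ?B \<le> 1 * (\<Prod>k\<in>{r..n}. 1 - w (Suc m, k))"
    proof (rule mult_mono)
      show "?B \<le> (\<Prod>k\<in>{r..n}. 1 - w (Suc m, k))"
        using r w01 by (intro prod_subset_ge) auto
    qed (use A01 B01 in auto)
    then have "exit_right w m r * (?A * ?B) \<le> exit_right w m r * (\<Prod>k\<in>{r..<Suc n}. 1 - w (Suc m, k))"
      using ep by (intro mult_left_mono) (auto simp: atLeastLessThanSuc_atLeastAtMost)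
    also have "\<dots> \<le> reach w (Suc m) r * (\<Prod>k\<in>{r..<Suc n}. 1 - w (Suc m, k))"
      using reach_step_le(2)[OF w] w01 by (intro mult_right_mono prod_nonneg) auto
    also have "\<dots> \<le> reach w (Suc m) (Suc n)" using r by (intro reach_vertical_le[OF w]) auto
    finally show ?thesis .
  qed
  have T: "exit_top w c n * (?A * ?B) \<le> reach w (Suc m) (Suc n)" if c: "c \<in> {Suc m - K..m}" for c
  proof -
    have "?A * ?B \<le> (\<Prod>k\<in>{c..m}. w (k, Suc n)) * 1"
    proof (rule mult_mono)
      show "?A \<le> (\<Prod>k\<in>{c..m}. w (k, Suc n))"
        using c w01 by (intro prod_subset_ge) auto
      show "0 \<le> (\<Prod>k\<in>{c..m}. w (k, Suc n))" using w01 by (intro prod_nonneg) auto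
    qed (use A01 B01 in auto)
    then have "exit_top w c n * (?A * ?B) \<le> exit_top w c n * (\<Prod>k\<in>{c..<Suc m}. w (k, Suc n))"
      using ep by (intro mult_left_mono) (auto simp: atLeastLessThanSuc_atLeastAtMost)
    also have "\<dots> \<le> reach w c (Suc n) * (\<Prod>k\<in>{c..<Suc m}. w (k, Suc n))"
      using reach_step_le(1)[OF w] w01 by (intro mult_right_mono prod_nonneg) auto
    also have "\<dots> \<le> reach w (Suc m) (Suc n)" using c by (intro reach_horizontal_le[OF w]) auto
    finally show ?thesis .
  qed
  have "near_exit m n K w * (?A * ?B) \<le> (\<Sum>r\<in>{Suc n - K..n}. reach w (Suc m) (Suc n)) + (\<Sum>c\<in>{Suc m - K..m}. reach w (Suc m) (Suc n))"
    unfolding near_exit_def distrib_right sum_distrib_right by (intro add_mono sum_mono R T)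
  also have "\<dots> = 2 * real K * reach w (Suc m) (Suc n)"
    using K by (simp add: Suc_diff_le algebra_simps)
  finally show ?thesis unfolding A B .
qed

lemma reach_bottom_row: "reach w c 0 = (\<Prod>k\<in>{..<c} \<times> {0}. w k)"
proof -
  have "reach w c 0 = (\<Prod>k<c. w (k, 0))" by (induction c) (auto simp: mult.commute)
  moreover have "{..<c} \<times> {0::nat} = (\<lambda>k. (k, 0)) ` {..<c}" by auto
  ultimately show ?thesis by (simp add: prod.reindex inj_on_def)
qed

text \<open>
  Up to an exponentially small probability, the product of the weights along \<open>k\<close> prescribed edges of
  each of the two types is at least \<open>exp (- path_cost \<alpha> \<beta> * k)\<close>; the formula is Markov's inequality
  for the negative moment of order \<open>s\<close>.
\<close>

definition path_cost :: "real \<Rightarrow> real \<Rightarrow> real" where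
  "path_cost \<alpha> \<beta> = (let s = min \<alpha> \<beta> / 2 in
     1 + (ln (Beta (\<alpha> - s) \<beta> / Beta \<alpha> \<beta>) + ln (Beta \<alpha> (\<beta> - s) / Beta \<alpha> \<beta>)) / s)"

context
  fixes \<alpha> \<beta> :: real and M :: "'s measure" and \<omega> :: "site \<Rightarrow> 's \<Rightarrow> real"
  assumes pos: "\<alpha> > 0" "\<beta> > 0" and env: "beta_environment \<alpha> \<beta> M \<omega>"
begin

text \<open>The summand 1 in \<open>path_cost\<close> is what leaves the decay exp (- s e N) after
  the moments are paid for. These moments h and v are at least 1, so the cardinalities may be
  replaced by their bound e N.\<close>

lemma path_weight_tail:
  assumes H: "\<And>N. finite (H N)" "\<And>N. finite (V N)" "\<And>N. H N \<inter> V N = {}"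
    and e: "e > 0" and card: "\<forall>\<^sub>F N in sequentially. real (card (H N)) \<le> e * real N \<and> real (card (V N)) \<le> e * real N"
  shows "(\<lambda>N. prob_space.prob M {x\<in>space M. (\<Prod>k\<in>H N. quadrant \<omega> x k) * (\<Prod>k\<in>V N. 1 - quadrant \<omega> x k)
     \<le> exp (- real N * (path_cost \<alpha> \<beta> * e))}) \<longlonglongrightarrow> 0"
proof (rule tendsto_sandwich[OF _ _ tendsto_const])
  interpret prob_space M by (rule prob_space_env[OF pos env])
  define s where "s = min \<alpha> \<beta> / 2"
  define h where "h = Beta (\<alpha> - s) \<beta> / Beta \<alpha> \<beta>"
  define v where "v = Beta \<alpha> (\<beta> - s) / Beta \<alpha> \<beta>"
  have s: "0 < s" "s < \<alpha>" "s < \<beta>" using pos by (auto simp: s_def min_def)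
  have h: "h \<ge> 1" "v \<ge> 1"
    using Beta_pos[OF pos] Beta_real_mono[of "\<alpha> - s" \<alpha> \<beta> \<beta>] Beta_real_mono[of \<alpha> \<alpha> "\<beta> - s" \<beta>] s pos
    by (auto simp: h_def v_def)
  show "(\<lambda>N. exp (- (s * e) * real N)) \<longlonglongrightarrow> 0" using s e by real_asymp
  show "\<forall>\<^sub>F N in sequentially. prob {x\<in>space M. (\<Prod>k\<in>H N. quadrant \<omega> x k) * (\<Prod>k\<in>V N. 1 - quadrant \<omega> x k)
     \<le> exp (- real N * (path_cost \<alpha> \<beta> * e))} \<le> exp (- (s * e) * real N)"
    using card
  proof eventually_elim
    case (elim N)
    have "prob {x\<in>space M. (\<Prod>k\<in>H N. quadrant \<omega> x k) * (\<Prod>k\<in>V N. 1 - quadrant \<omega> x k)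
       \<le> exp (- real N * (path_cost \<alpha> \<beta> * e))} \<le>
       exp (- real N * (path_cost \<alpha> \<beta> * e)) powr s * h ^ card (H N) * v ^ card (V N)"
      unfolding h_def v_def by (intro weight_product_small_prob[OF pos env] H s) simp
    also have "\<dots> = exp (s * (- real N * (path_cost \<alpha> \<beta> * e)) + real (card (H N)) * ln h + real (card (V N)) * ln v)"
      using h by (simp only: exp_add exp_of_nat_mult exp_powr_real) (simp add: mult.commute)
    also have "\<dots> \<le> exp (s * (- real N * (path_cost \<alpha> \<beta> * e)) + (e * real N) * ln h + (e * real N) * ln v)"
      using elim h by (intro iffD2[OF exp_le_cancel_iff] add_mono order.refl mult_right_mono) auto
    also have "\<dots> = exp (- (s * e) * real N)"
    proof -
      have "s * path_cost \<alpha> \<beta> = s + (ln h + ln v)"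
        using s by (simp add: path_cost_def Let_def s_def[symmetric] h_def[symmetric] v_def[symmetric] field_simps)
      then have "s * (- real N * (path_cost \<alpha> \<beta> * e)) = - real N * e * (s + (ln h + ln v))" by (metis mult.assoc mult.commute mult.left_commute)
      then show ?thesis by (simp add: algebra_simps)
    qed
    finally show ?case .
  qed
qed auto

text \<open>With high probability the exits near the corner carry mass of exponential rate close to
  f, and continuing them to the corner costs an exponent proportional to e, which is taken
  small.\<close>

lemma reach_lower_tail_Suc:
  assumes l: "l > 0" and char: "characteristic \<alpha> \<beta> a b l" and ab: "a > 0" "b > 0"
    and m: "(\<lambda>N. real (m N) / real N) \<longlonglongrightarrow> a" and n: "(\<lambda>N. real (n N) / real N) \<longlonglongrightarrow> b"
    and t: "lin_rate \<alpha> \<beta> a b l < t"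
  shows "(\<lambda>N. prob_space.prob M {x \<in> space M. reach (quadrant \<omega> x) (Suc (m N)) (Suc (n N)) \<le> exp (- real N * t)}) \<longlonglongrightarrow> 0"
proof -
  interpret prob_space M by (rule prob_space_env[OF pos env])
  note [measurable] = reach_quadrant_measurable[OF pos env] quadrant_measurable[OF pos env]
  define f where "f = lin_rate \<alpha> \<beta> a b l"
  define C where "C = 1 - rate_v \<alpha> l"
  define C' where "C' = path_cost \<alpha> \<beta>"
  \<comment> \<open>The gap t - f is split in three: one part for the tail of near exits, one for
    the costs C e and C' e, and one to absorb the factor 4 e N.\<close>
  define \<delta> where "\<delta> = (t - f) / 3"
  have \<delta>: "\<delta> > 0" using t by (simp add: \<delta>_def f_def)
  define e where "e = min (min (a / 2) (b / 2)) (\<delta> / (\<bar>C\<bar> + \<bar>C'\<bar> + 1))"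
  have e: "e > 0" "e < a" "e < b" using ab \<delta> by (auto simp: e_def min_less_iff_disj intro!: divide_pos_pos add_nonneg_pos)
  have eC: "C * e + C' * e \<le> \<delta>"
  proof -
    have "C * e + C' * e \<le> (\<bar>C\<bar> + \<bar>C'\<bar> + 1) * e" using e(1) by (simp add: distrib_right[symmetric] mult_right_mono)
    also have "\<dots> \<le> (\<bar>C\<bar> + \<bar>C'\<bar> + 1) * (\<delta> / (\<bar>C\<bar> + \<bar>C'\<bar> + 1))"
      by (intro mult_left_mono) (auto simp: e_def)
    also have "\<dots> = \<delta>" by (simp add: add_nonneg_eq_0_iff)
    finally show ?thesis .
  qed
  define K where "K N = nat \<lfloor>e * real N\<rfloor>" for N
  define Hs where "Hs N = {Suc (m N) - K N..m N} \<times> {Suc (n N)}" for N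
  define Vs where "Vs N = {Suc (m N)} \<times> {Suc (n N) - K N..n N}" for N
  have KN: "(\<lambda>N. real (K N) / real N) \<longlonglongrightarrow> e" unfolding K_def by (rule floor_ratio_tendsto[OF e(1)])
  have Kle: "real (K N) \<le> e * real N" for N using e(1) by (simp add: K_def)
  have less: "\<forall>\<^sub>F N in sequentially. K N \<le> Suc (p N)" if "(\<lambda>N. real (p N) / real N) \<longlonglongrightarrow> u" "e < u" for p u
  proof -
    have "(\<lambda>N. real (K N) / real N - real (p N) / real N) \<longlonglongrightarrow> e - u" by (intro tendsto_diff KN that)
    then have "\<forall>\<^sub>F N in sequentially. real (K N) / real N - real (p N) / real N < 0"
      using that by (intro order_tendstoD(2)) auto
    then show ?thesis using eventually_gt_at_top[of 0]
      by eventually_elim (simp add: diff_divide_distrib[symmetric] divide_less_0_iff)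
  qed
  have T1: "(\<lambda>N. prob {x \<in> space M. near_exit (m N) (n N) (K N) (quadrant \<omega> x) \<le> exp (- real N * (f + \<delta> + C * e)) / 2}) \<longlonglongrightarrow> 0"
    unfolding K_def f_def C_def by (rule near_exit_tail[OF pos env l char e(1,3) \<delta> m n])
  have T2: "(\<lambda>N. prob {x\<in>space M. (\<Prod>k\<in>Hs N. quadrant \<omega> x k) * (\<Prod>k\<in>Vs N. 1 - quadrant \<omega> x k) \<le> exp (- real N * (C' * e))}) \<longlonglongrightarrow> 0"
    unfolding C'_def
  proof (rule path_weight_tail[OF _ _ _ e(1)])
    show "\<forall>\<^sub>F N in sequentially. real (card (Hs N)) \<le> e * real N \<and> real (card (Vs N)) \<le> e * real N"
      using less[OF m e(2)] less[OF n e(3)]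
    proof eventually_elim
      case (elim N)
      then show ?case using Kle[of N] by (simp add: Hs_def Vs_def card_cartesian_product Suc_diff_le)
    qed
  qed (auto simp: Hs_def Vs_def)
  have gap: "t - (f + \<delta> + C * e) - C' * e > 0" using eC \<delta> by (simp add: \<delta>_def field_simps)
  have ev: "\<forall>\<^sub>F N in sequentially. (4 * e) * real N < exp ((t - (f + \<delta> + C * e) - C' * e) * real N)"
    by (rule eventually_exp_dominates[OF gap])
  show ?thesis
  proof (rule prob_tendsto_0_of_subset_Un[OF _ _ _ T1 T2])
    show "{x \<in> space M. near_exit (m N) (n N) (K N) (quadrant \<omega> x) \<le> exp (- real N * (f + \<delta> + C * e)) / 2} \<in> sets M" for N
      unfolding near_exit_def exit_right_def exit_top_def by measurable
    show "\<forall>\<^sub>F N in sequentially. AE x in M. x \<in> {x \<in> space M. reach (quadrant \<omega> x) (Suc (m N)) (Suc (n N)) \<le> exp (- real N * t)} \<longrightarrow>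
      x \<in> {x \<in> space M. near_exit (m N) (n N) (K N) (quadrant \<omega> x) \<le> exp (- real N * (f + \<delta> + C * e)) / 2}
        \<union> {x\<in>space M. (\<Prod>k\<in>Hs N. quadrant \<omega> x k) * (\<Prod>k\<in>Vs N. 1 - quadrant \<omega> x k) \<le> exp (- real N * (C' * e))}"
      using ev less[OF m e(2)] less[OF n e(3)]
    proof eventually_elim
      case (elim N)
      let ?near = "\<lambda>x. near_exit (m N) (n N) (K N) (quadrant \<omega> x)"
      let ?D = "\<lambda>x. (\<Prod>k\<in>Hs N. quadrant \<omega> x k) * (\<Prod>k\<in>Vs N. 1 - quadrant \<omega> x k)"
      show ?case
        using AE_quadrant[OF pos env]
      proof eventually_elim
          case w: (elim x)
          show ?case
          proof (rule impI, rule ccontr)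
            assume A: "x \<in> {x \<in> space M. reach (quadrant \<omega> x) (Suc (m N)) (Suc (n N)) \<le> exp (- real N * t)}"
              "x \<notin> {x \<in> space M. ?near x \<le> exp (- real N * (f + \<delta> + C * e)) / 2} \<union> {x\<in>space M. ?D x \<le> exp (- real N * (C' * e))}"
            then have *: "reach (quadrant \<omega> x) (Suc (m N)) (Suc (n N)) \<le> exp (- real N * t)"
              "?near x > exp (- real N * (f + \<delta> + C * e)) / 2" "?D x > exp (- real N * (C' * e))" by auto
            have n0: "0 \<le> ?near x" using *(2) by (intro order_trans[OF _ less_imp_le[OF *(2)]]) simp
            have "exp (- real N * (f + \<delta> + C * e)) / 2 * exp (- real N * (C' * e)) \<le> ?near x * ?D x"
              using * n0 by (intro mult_mono) (auto intro: less_imp_le)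
            also have "\<dots> \<le> 2 * real (K N) * reach (quadrant \<omega> x) (Suc (m N)) (Suc (n N))"
              unfolding Hs_def Vs_def using elim by (intro reach_ge_near_exit[OF w]) auto
            also have "\<dots> \<le> 2 * (e * real N) * exp (- real N * t)"
              using * Kle[of N] e(1) reach_pos'[OF w, of "Suc (m N)" "Suc (n N)"] by (intro mult_mono) (auto simp: less_imp_le)
            finally have "exp (- real N * (f + \<delta> + C * e)) * exp (- real N * (C' * e)) \<le> (4 * e) * real N * exp (- real N * t)"
              by simp
            then have "exp (- real N * (f + \<delta> + C * e)) * exp (- real N * (C' * e)) * exp (real N * t) \<le> (4 * e) * real N * exp (- real N * t) * exp (real N * t)"
              by (intro mult_right_mono) auto
            also have "\<dots> = (4 * e) * real N" by (simp add: exp_minus)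
            also have "exp (- real N * (f + \<delta> + C * e)) * exp (- real N * (C' * e)) * exp (real N * t) = exp ((t - (f + \<delta> + C * e) - C' * e) * real N)"
              unfolding exp_add[symmetric] by (simp add: algebra_simps)
            finally show False using elim(1) by simp
          qed
      qed
    qed
  qed measurable
qed

lemma reach_lower_tail:
  assumes l: "l > 0" and char: "characteristic \<alpha> \<beta> a b l" and ab: "a > 0" "b > 0"
    and m: "(\<lambda>N. real (m N) / real N) \<longlonglongrightarrow> a" and n: "(\<lambda>N. real (n N) / real N) \<longlonglongrightarrow> b"
    and t: "lin_rate \<alpha> \<beta> a b l < t"
  shows "(\<lambda>N. prob_space.prob M {x \<in> space M. reach (quadrant \<omega> x) (m N) (n N) \<le> exp (- real N * t)}) \<longlonglongrightarrow> 0"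
proof -
  have pos_ev: "\<forall>\<^sub>F N in sequentially. p N > 0" if "(\<lambda>N. real (p N) / real N) \<longlonglongrightarrow> u" "u > 0" for p :: "nat \<Rightarrow> nat" and u
    using order_tendstoD(1)[OF that] by eventually_elim (simp add: zero_less_divide_iff)
  have pred: "(\<lambda>N. real (p N - 1) / real N) \<longlonglongrightarrow> u" if p: "(\<lambda>N. real (p N) / real N) \<longlonglongrightarrow> u" "u > 0" for p u
  proof (rule Lim_transform_eventually)
    show "(\<lambda>N. real (p N) / real N - 1 / real N) \<longlonglongrightarrow> u" using tendsto_diff[OF p(1) lim_1_over_n] by simp
    show "\<forall>\<^sub>F N in sequentially. real (p N) / real N - 1 / real N = real (p N - 1) / real N"
      using pos_ev[OF p] by eventually_elim (simp add: of_nat_diff diff_divide_distrib)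
  qed
  show ?thesis
  proof (rule Lim_transform_eventually)
    show "(\<lambda>N. prob_space.prob M {x \<in> space M. reach (quadrant \<omega> x) (Suc (m N - 1)) (Suc (n N - 1)) \<le> exp (- real N * t)}) \<longlonglongrightarrow> 0"
      by (rule reach_lower_tail_Suc[OF l char ab pred[OF m ab(1)] pred[OF n ab(2)] t])
    show "\<forall>\<^sub>F N in sequentially. prob_space.prob M {x \<in> space M. reach (quadrant \<omega> x) (Suc (m N - 1)) (Suc (n N - 1)) \<le> exp (- real N * t)}
      = prob_space.prob M {x \<in> space M. reach (quadrant \<omega> x) (m N) (n N) \<le> exp (- real N * t)}"
      using pos_ev[OF m ab(1)] pos_ev[OF n ab(2)] by eventually_elim simp
  qed
qed

text \<open>The walk is led to height about b N in the target column and then straight up the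
  remaining edges, eventually at most e N in number.\<close>

lemma reach_lower_tail_vertical:
  assumes l: "l > 0" and char: "characteristic \<alpha> \<beta> a b l" and ab: "a > 0" "b > 0" "b < b'"
    and m: "(\<lambda>N. real (m N) / real N) \<longlonglongrightarrow> a" and n: "(\<lambda>N. real (n N) / real N) \<longlonglongrightarrow> b'"
    and e: "b' - b < e" and t: "lin_rate \<alpha> \<beta> a b l + path_cost \<alpha> \<beta> * e < t"
  shows "(\<lambda>N. prob_space.prob M {x \<in> space M. reach (quadrant \<omega> x) (m N) (n N) \<le> exp (- real N * t)}) \<longlonglongrightarrow> 0"
proof -
  interpret prob_space M by (rule prob_space_env[OF pos env])
  note [measurable] = reach_quadrant_measurable[OF pos env] quadrant_measurable[OF pos env]
  define q where "q N = nat \<lfloor>b * real N\<rfloor>" for N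
  have q: "(\<lambda>N. real (q N) / real N) \<longlonglongrightarrow> b" unfolding q_def by (rule floor_ratio_tendsto[OF ab(2)])
  define V where "V N = {m N} \<times> {q N..<n N}" for N
  define u where "u = t - path_cost \<alpha> \<beta> * e"
  have T1: "(\<lambda>N. prob {x \<in> space M. reach (quadrant \<omega> x) (m N) (q N) \<le> exp (- real N * u)}) \<longlonglongrightarrow> 0"
    using t by (intro reach_lower_tail[OF l char ab(1,2) m q]) (simp add: u_def)
  have diff: "(\<lambda>N. real (n N) / real N - real (q N) / real N) \<longlonglongrightarrow> b' - b" by (intro tendsto_diff n q)
  have ev1: "\<forall>\<^sub>F N in sequentially. q N \<le> n N"
  proof -
    have "\<forall>\<^sub>F N in sequentially. 0 < real (n N) / real N - real (q N) / real N"
      using order_tendstoD(1)[OF diff, of 0] ab by simp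
    then show ?thesis
      by eventually_elim (simp add: diff_divide_distrib[symmetric] zero_less_divide_iff)
  qed
  have ev2: "\<forall>\<^sub>F N in sequentially. real (n N) - real (q N) \<le> e * real N"
    using order_tendstoD(2)[OF diff e] eventually_gt_at_top[of 0]
    by eventually_elim (simp add: diff_divide_distrib[symmetric] pos_divide_less_eq less_imp_le)
  have T2: "(\<lambda>N. prob {x\<in>space M. (\<Prod>k\<in>{}. quadrant \<omega> x k) * (\<Prod>k\<in>V N. 1 - quadrant \<omega> x k) \<le> exp (- real N * (path_cost \<alpha> \<beta> * e))}) \<longlonglongrightarrow> 0"
  proof (rule path_weight_tail)
    show "e > 0" using ab e by simp
    show "\<forall>\<^sub>F N in sequentially. real (card ({} :: (nat \<times> nat) set)) \<le> e * real N \<and> real (card (V N)) \<le> e * real N"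
      using ev1 ev2 by eventually_elim (use ab e in \<open>simp add: V_def card_cartesian_product of_nat_diff\<close>)
  qed (auto simp: V_def)
  show ?thesis
  proof (rule prob_tendsto_0_of_subset_Un[OF _ _ _ T1 T2])
    show "\<forall>\<^sub>F N in sequentially. AE x in M. x \<in> {x \<in> space M. reach (quadrant \<omega> x) (m N) (n N) \<le> exp (- real N * t)} \<longrightarrow>
       x \<in> {x \<in> space M. reach (quadrant \<omega> x) (m N) (q N) \<le> exp (- real N * u)}
        \<union> {x\<in>space M. (\<Prod>k\<in>{}. quadrant \<omega> x k) * (\<Prod>k\<in>V N. 1 - quadrant \<omega> x k) \<le> exp (- real N * (path_cost \<alpha> \<beta> * e))}"
      using ev1
    proof eventually_elim
      case (elim N)
      let ?D = "\<lambda>x. (\<Prod>k\<in>{}. quadrant \<omega> x k) * (\<Prod>k\<in>V N. 1 - quadrant \<omega> x k)"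
      show ?case
        using AE_quadrant[OF pos env]
      proof eventually_elim
          case w: (elim x)
          have V: "V N = (\<lambda>k. (m N, k)) ` {q N..<n N}" by (auto simp: V_def)
          show ?case
          proof (rule impI, rule ccontr)
            assume A: "x \<in> {x \<in> space M. reach (quadrant \<omega> x) (m N) (n N) \<le> exp (- real N * t)}"
              "x \<notin> {x \<in> space M. reach (quadrant \<omega> x) (m N) (q N) \<le> exp (- real N * u)} \<union> {x\<in>space M. ?D x \<le> exp (- real N * (path_cost \<alpha> \<beta> * e))}"
            then have *: "reach (quadrant \<omega> x) (m N) (n N) \<le> exp (- real N * t)"
              "reach (quadrant \<omega> x) (m N) (q N) > exp (- real N * u)" "?D x > exp (- real N * (path_cost \<alpha> \<beta> * e))" by auto
            have "exp (- real N * t) = exp (- real N * u) * exp (- real N * (path_cost \<alpha> \<beta> * e))"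
              unfolding exp_add[symmetric] by (simp add: u_def algebra_simps)
            also have "\<dots> < reach (quadrant \<omega> x) (m N) (q N) * ?D x"
              using * reach_pos'[OF w, of "m N" "q N"] by (intro mult_strict_mono) auto
            also have "\<dots> \<le> reach (quadrant \<omega> x) (m N) (n N)"
              using reach_vertical_le[OF w elim, of "m N"] by (simp add: V prod.reindex inj_on_def)
            finally show False using * by simp
          qed
      qed
    qed
  qed measurable
qed

text \<open>Reaching the point and then stepping right is an exit term, for which
  \<open>exit_right_large_prob\<close> is available. The single weight of that step is exponentially
  small only with vanishing probability.\<close>

lemma reach_upper_tail:
  assumes l: "l > 0" and m: "(\<lambda>N. real (m N) / real N) \<longlonglongrightarrow> a" and n: "(\<lambda>N. real (n N) / real N) \<longlonglongrightarrow> b"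
    and t: "t < lin_rate \<alpha> \<beta> a b l"
  shows "(\<lambda>N. prob_space.prob M {x \<in> space M. exp (- real N * t) \<le> reach (quadrant \<omega> x) (m N) (n N)}) \<longlonglongrightarrow> 0"
proof -
  interpret prob_space M by (rule prob_space_env[OF pos env])
  note [measurable] = reach_quadrant_measurable[OF pos env] quadrant_measurable[OF pos env]
  define f where "f = lin_rate \<alpha> \<beta> a b l"
  define C where "C = path_cost \<alpha> \<beta>"
  \<comment> \<open>Keeps the cost C * e within a third of the gap f - t.\<close>
  define e where "e = (f - t) / 3 / (\<bar>C\<bar> + 1)"
  have e: "e > 0" using t by (simp add: e_def f_def add_nonneg_pos)
  have cancel: "x * (y / x) = y" if "x \<noteq> 0" for x y :: real using that by simp
  have "C * e \<le> (\<bar>C\<bar> + 1) * e" using e by (intro mult_right_mono) auto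
  also have "\<dots> = (f - t) / 3" unfolding e_def by (rule cancel) (simp add: add_nonneg_eq_0_iff)
  finally have Ce: "t + C * e < f" using t by (simp add: f_def field_simps)
  have "\<forall>\<^sub>F s in at_right 0. (\<lambda>N. 1 * exp (s * (real N * (t + C * e)) + (real (Suc (m N)) * ln (mom_h \<alpha> \<beta> l (2 * 1 * s)) +
      real (Suc (n N)) * ln (mom_v \<alpha> l (2 * 1 * s))) / 2 + real 0 * 0)) \<longlonglongrightarrow> 0"
    by (rule exponent_tail[OF pos l m n _ lim_1_over_n, where K = "\<lambda>_. 0" and D = "\<lambda>_. 0" and d = 0 and e = 0])
      (use Ce in \<open>auto simp: f_def\<close>)
  moreover have "\<forall>\<^sub>F s in at_right 0. (0::real) < s \<and> s < l / 2"
    unfolding eventually_at_right_field using l by (intro exI[of _ "l / 2"]) auto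
  ultimately have ev: "\<forall>\<^sub>F s in at_right 0. (\<lambda>N. 1 * exp (s * (real N * (t + C * e)) + (real (Suc (m N)) * ln (mom_h \<alpha> \<beta> l (2 * 1 * s)) +
      real (Suc (n N)) * ln (mom_v \<alpha> l (2 * 1 * s))) / 2 + real 0 * 0)) \<longlonglongrightarrow> 0 \<and> 0 < s \<and> s < l / 2"
    unfolding eventually_conj_iff by simp
  have "at_right (0::real) \<noteq> bot" by simp
  from eventually_happens'[OF this ev] obtain s where s: "0 < s" "2 * s < l" and
    G: "(\<lambda>N. 1 * exp (s * (real N * (t + C * e)) + (real (Suc (m N)) * ln (mom_h \<alpha> \<beta> l (2 * 1 * s)) +
      real (Suc (n N)) * ln (mom_v \<alpha> l (2 * 1 * s))) / 2 + real 0 * 0)) \<longlonglongrightarrow> 0" by auto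
  have T1: "(\<lambda>N. prob {x \<in> space M. exp (- real N * (t + C * e)) \<le> exit_right (quadrant \<omega> x) (m N) (n N)}) \<longlonglongrightarrow> 0"
  proof (rule tendsto_sandwich[OF _ _ tendsto_const])
    show "(\<lambda>N. 1 * exp (s * (real N * (t + C * e)) + (real (Suc (m N)) * ln (mom_h \<alpha> \<beta> l (2 * 1 * s)) +
      real (Suc (n N)) * ln (mom_v \<alpha> l (2 * 1 * s))) / 2 + real 0 * 0) * (1 / mom_v \<alpha> l s)) \<longlonglongrightarrow> 0"
      using tendsto_mult_right[OF G, of "1 / mom_v \<alpha> l s"] by simp
    show "\<forall>\<^sub>F N in sequentially. prob {x \<in> space M. exp (- real N * (t + C * e)) \<le> exit_right (quadrant \<omega> x) (m N) (n N)} \<le>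
      1 * exp (s * (real N * (t + C * e)) + (real (Suc (m N)) * ln (mom_h \<alpha> \<beta> l (2 * 1 * s)) +
      real (Suc (n N)) * ln (mom_v \<alpha> l (2 * 1 * s))) / 2 + real 0 * 0) * (1 / mom_v \<alpha> l s)"
    proof (rule always_eventually, rule allI)
      fix N
      let ?c = "exp (- real N * (t + C * e))"
      have "(1 / ?c) powr s = exp (s * (real N * (t + C * e)))"
        by (simp add: exp_minus powr_divide exp_powr_real mult.commute divide_inverse)
      then show "prob {x \<in> space M. ?c \<le> exit_right (quadrant \<omega> x) (m N) (n N)} \<le>
        1 * exp (s * (real N * (t + C * e)) + (real (Suc (m N)) * ln (mom_h \<alpha> \<beta> l (2 * 1 * s)) +
        real (Suc (n N)) * ln (mom_v \<alpha> l (2 * 1 * s))) / 2 + real 0 * 0) * (1 / mom_v \<alpha> l s)"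
        using exit_right_large_prob[OF pos env l s exp_gt_zero, of "- real N * (t + C * e)" "m N" "n N"]
        by (simp add: harm_bound_def[OF pos l] exp_add)
    qed
  qed simp
  have T2: "(\<lambda>N. prob {x\<in>space M. (\<Prod>k\<in>{(m N, n N)}. quadrant \<omega> x k) * (\<Prod>k\<in>{}. 1 - quadrant \<omega> x k) \<le> exp (- real N * (C * e))}) \<longlonglongrightarrow> 0"
    unfolding C_def
  proof (rule path_weight_tail[OF _ _ _ e])
    have "\<forall>\<^sub>F N in sequentially. 1 \<le> e * real N" using e by real_asymp
    then show "\<forall>\<^sub>F N in sequentially. real (card {(m N, n N)}) \<le> e * real N \<and> real (card ({} :: (nat \<times> nat) set)) \<le> e * real N"
      by eventually_elim (use e in simp)
  qed auto
  show ?thesis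
  proof (rule prob_tendsto_0_of_subset_Un[OF _ _ _ T1 T2])
    show "{x \<in> space M. exp (- real N * (t + C * e)) \<le> exit_right (quadrant \<omega> x) (m N) (n N)} \<in> sets M" for N
      unfolding exit_right_def by measurable
    show "\<forall>\<^sub>F N in sequentially. AE x in M. x \<in> {x \<in> space M. exp (- real N * t) \<le> reach (quadrant \<omega> x) (m N) (n N)} \<longrightarrow>
      x \<in> {x \<in> space M. exp (- real N * (t + C * e)) \<le> exit_right (quadrant \<omega> x) (m N) (n N)}
        \<union> {x\<in>space M. (\<Prod>k\<in>{(m N, n N)}. quadrant \<omega> x k) * (\<Prod>k\<in>{}. 1 - quadrant \<omega> x k) \<le> exp (- real N * (C * e))}"
    proof (intro always_eventually allI AE_I2 impI)
      fix N x assume x: "x \<in> {x \<in> space M. exp (- real N * t) \<le> reach (quadrant \<omega> x) (m N) (n N)}"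
      show "x \<in> {x \<in> space M. exp (- real N * (t + C * e)) \<le> exit_right (quadrant \<omega> x) (m N) (n N)}
        \<union> {x\<in>space M. (\<Prod>k\<in>{(m N, n N)}. quadrant \<omega> x k) * (\<Prod>k\<in>{}. 1 - quadrant \<omega> x k) \<le> exp (- real N * (C * e))}"
      proof (cases "quadrant \<omega> x (m N, n N) \<le> exp (- real N * (C * e))")
        case False
        then have qf: "exp (- real N * (C * e)) < quadrant \<omega> x (m N, n N)" by simp
        have "exp (- real N * (t + C * e)) = exp (- real N * (C * e)) * exp (- real N * t)"
          unfolding exp_add[symmetric] by (simp add: algebra_simps)
        also have "\<dots> \<le> quadrant \<omega> x (m N, n N) * reach (quadrant \<omega> x) (m N) (n N)"
          using qf x by (intro mult_mono order_trans[OF exp_ge_zero less_imp_le[OF qf]]) auto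
        finally show ?thesis using x by (simp add: exit_right_def)
      qed (use x in auto)
    qed
  qed measurable
qed

text \<open>On the axis the probability is a product of independent Beta(\<alpha>, \<beta>) weights,
  whose mean logarithm is minus \<open>rate_h \<alpha> \<beta> 0\<close>.\<close>

lemma reach_bottom_lower_tail:
  assumes t: "rate_h \<alpha> \<beta> 0 < t"
  shows "(\<lambda>N. prob_space.prob M {x \<in> space M. reach (quadrant \<omega> x) N 0 \<le> exp (- real N * t)}) \<longlonglongrightarrow> 0"
proof -
  interpret prob_space M by (rule prob_space_env[OF pos env])
  have B: "Beta \<alpha> \<beta> > 0" using pos by (simp add: Beta_pos)
  have "((\<lambda>s. Beta (\<alpha> - s) \<beta>) has_real_derivative (Beta \<alpha> \<beta> * (Digamma \<alpha> - Digamma (\<alpha> + \<beta>))) * (- 1)) (at 0)"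
    using has_field_derivative_Beta1[of \<alpha> \<beta> UNIV] pos
    by (intro DERIV_chain'[of "\<lambda>s. \<alpha> - s" "-1" 0 UNIV "\<lambda>x. Beta x \<beta>"])
      (auto intro!: derivative_eq_intros elim!: nonpos_Ints_cases)
  then have "((\<lambda>s. ln (Beta (\<alpha> - s) \<beta> / Beta \<alpha> \<beta>)) has_real_derivative
     (1 / (Beta (\<alpha> - 0) \<beta> / Beta \<alpha> \<beta>)) * ((Beta \<alpha> \<beta> * (Digamma \<alpha> - Digamma (\<alpha> + \<beta>))) * (- 1) / Beta \<alpha> \<beta>)) (at 0)"
    using B by (intro DERIV_chain'[where g = ln] DERIV_ln_divide DERIV_cdivide) auto
  then have d: "((\<lambda>s. ln (Beta (\<alpha> - s) \<beta> / Beta \<alpha> \<beta>)) has_real_derivative rate_h \<alpha> \<beta> 0) (at 0)"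
    using B by (simp add: rate_h_def)
  define g where "g s N = s * (real N * - t) + real N * ln (Beta (\<alpha> - s) \<beta> / Beta \<alpha> \<beta>)" for s N
  have NN: "(\<lambda>N. real N / real N) \<longlonglongrightarrow> 1"
    by (rule tendsto_eventually) (use eventually_gt_at_top[of 0] in \<open>auto elim: eventually_mono\<close>)
  \<comment> \<open>Here k = 0 reduces the stationary part to moments of order 0, which equal 1. The
    N weights enter through K N = N, with D their log-moment of order -s.\<close>
  have "\<forall>\<^sub>F s in at_right 0. (\<lambda>N. 1 * exp (s * (real N * - t) + (real (Suc 0) * ln (mom_h \<alpha> \<beta> 1 (2 * 0 * s)) +
      real (Suc 0) * ln (mom_v \<alpha> 1 (2 * 0 * s))) / 2 + real N * ln (Beta (\<alpha> - s) \<beta> / Beta \<alpha> \<beta>))) \<longlonglongrightarrow> 0"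
    by (rule exponent_tail[OF pos zero_less_one _ _ NN lim_1_over_n _ d, where m = "\<lambda>_. 0" and n = "\<lambda>_. 0" and a = 0 and b = 0])
      (use t B in auto)
  then have "\<forall>\<^sub>F s in at_right 0. (\<lambda>N. exp (g s N)) \<longlonglongrightarrow> 0"
    using mom_0[OF pos, of 1] by (simp add: g_def)
  moreover have "\<forall>\<^sub>F s in at_right 0. (0::real) < s \<and> s < min \<alpha> \<beta>"
    unfolding eventually_at_right_field using pos by (intro exI[of _ "min \<alpha> \<beta>"]) auto
  ultimately have ev: "\<forall>\<^sub>F s in at_right 0. (\<lambda>N. exp (g s N)) \<longlonglongrightarrow> 0 \<and> 0 < s \<and> s < min \<alpha> \<beta>" unfolding eventually_conj_iff by simp
  have "at_right (0::real) \<noteq> bot" by simp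
  from eventually_happens'[OF this ev] obtain s where G: "(\<lambda>N. exp (g s N)) \<longlonglongrightarrow> 0" and s: "0 < s" "s < \<alpha>" "s < \<beta>" by auto
  have h: "Beta (\<alpha> - s) \<beta> / Beta \<alpha> \<beta> > 0" using pos s by (simp add: Beta_pos)
  show ?thesis
  proof (rule tendsto_sandwich[OF _ _ tendsto_const G])
    show "\<forall>\<^sub>F N in sequentially. prob {x \<in> space M. reach (quadrant \<omega> x) N 0 \<le> exp (- real N * t)} \<le> exp (g s N)"
    proof (rule always_eventually, rule allI)
      fix N
      have "prob {x\<in>space M. (\<Prod>k\<in>{..<N} \<times> {0}. quadrant \<omega> x k) * (\<Prod>k\<in>{}. 1 - quadrant \<omega> x k) \<le> exp (- real N * t)}
        \<le> exp (- real N * t) powr s * (Beta (\<alpha> - s) \<beta> / Beta \<alpha> \<beta>) ^ card ({..<N} \<times> {0::nat}) * (Beta \<alpha> (\<beta> - s) / Beta \<alpha> \<beta>) ^ card ({} :: (nat \<times> nat) set)"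
        by (rule weight_product_small_prob[OF pos env]) (use s in auto)
      also have "\<dots> = exp (g s N)"
        using h unfolding g_def by (simp only: exp_add exp_of_nat_mult exp_powr_real) (simp add: card_cartesian_product mult.commute)
      finally show "prob {x \<in> space M. reach (quadrant \<omega> x) N 0 \<le> exp (- real N * t)} \<le> exp (g s N)"
        by (simp add: reach_bottom_row)
    qed
  qed simp
qed

end

section \<open>The quenched walk\<close>

lemma pmf_step_eq:
  assumes "0 \<le> w y" "w y \<le> 1"
  shows "pmf (step w y) z = w y * of_bool (z = y + e1) + (1 - w y) * of_bool (z = y + e2)"
proof -
  have "e1 \<noteq> e2" by (simp add: e1_def e2_def)
  consider "z = y + e1" | "z = y + e2" | "z \<noteq> y + e1" "z \<noteq> y + e2" by blast
  then show ?thesis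
  proof cases
    case 3
    then have "z \<notin> set_pmf (step w y)" by (auto simp: step_def)
    with 3 show ?thesis by (simp add: set_pmf_iff)
  qed (use pmf_step[of w y, OF assms] \<open>e1 \<noteq> e2\<close> in auto)
qed

lemma position_set_measurable:
  "{h \<in> space (PiM {0..<Suc n} (\<lambda>_. count_space (UNIV :: site set))). h n = z} \<in> sets (PiM {0..<Suc n} (\<lambda>_. count_space UNIV))"
proof -
  have "(\<lambda>h. h n) \<in> measurable (PiM {0..<Suc n} (\<lambda>_. count_space (UNIV :: site set))) (count_space UNIV)"
    by (rule measurable_component_singleton) simp
  from measurable_sets[OF this, of "{z}"] show ?thesis by (simp add: vimage_def Int_def conj_commute)
qed

lemma quenched_law_position:
  "emeasure (quenched_law w x) {X. X n = z} =
   emeasure (walk.C w x 0 (Suc n) (\<lambda>_. undefined)) {h \<in> space (PiM {0..<Suc n} (\<lambda>_. count_space UNIV)). h n = z}"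
proof -
  let ?A = "{h \<in> space (PiM {0..<Suc n} (\<lambda>_. count_space (UNIV :: site set))). h n = z}"
  have eq: "{X. X n = z} = prod_emb UNIV (\<lambda>_. count_space UNIV) {0..<Suc n} ?A"
    by (auto simp: prod_emb_def space_PiM PiE_def)
  have "prod_emb {0..<Suc n} (\<lambda>_. count_space UNIV) {0..<Suc n} ?A = ?A"
    by (intro prod_emb_id) (auto simp: space_PiM)
  then show ?thesis
    unfolding eq quenched_law_def
    using walk.lim[of "{0..<Suc n}" ?A w x] walk.emeasure_CI[of "{0..<Suc n}" "Suc n" ?A w x] position_set_measurable[of n z]
    by simp
qed

text \<open>The forward equation of the chain, which has the shape of the recursion defining
  \<open>reach\<close>. It comes from integrating the kernel at time Suc n over the past.\<close>

lemma quenched_law_position_Suc: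
  assumes w: "\<And>y. 0 \<le> w y \<and> w y \<le> 1"
  shows "emeasure (quenched_law w x) {X. X (Suc n) = z} =
    ennreal (w (z - e1)) * emeasure (quenched_law w x) {X. X n = z - e1} +
    ennreal (1 - w (z - e2)) * emeasure (quenched_law w x) {X. X n = z - e2}"
proof -
  let ?u = "\<lambda>_. undefined" and ?C = "walk.C w x 0"
  let ?M = "\<lambda>_::nat. count_space (UNIV :: site set)"
  let ?A = "\<lambda>n z. {h \<in> space (PiM {0..<Suc n} ?M). h n = z}"
  have u: "?u \<in> space (PiM {0..<0} ?M)" by simp
  have gen: "emeasure (?C (Suc p) ?u) A = (\<integral>\<^sup>+h. emeasure (walk.eP w x p h) A \<partial>?C p ?u)"
    if "A \<in> sets (PiM {0..<Suc p} ?M)" for p A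
    using walk.space_C[OF u, of w x p] walk.sets_C[OF u, of w x p] walk.measurable_eP[of w x p] that
    by (simp del: walk.eP_def, subst emeasure_bind[where N = "PiM {0..<Suc p} ?M"])
      (auto simp: measurable_cong_sets[OF walk.sets_C[OF u, of w x p] refl] space_PiM)
  have "emeasure (?C (Suc (Suc n)) ?u) (?A (Suc n) z) =
     (\<integral>\<^sup>+h. emeasure (walk.eP w x (Suc n) h) (?A (Suc n) z) \<partial>?C (Suc n) ?u)"
    by (rule gen) (rule position_set_measurable)
  also have "\<dots> = (\<integral>\<^sup>+h. ennreal (w (z - e1)) * indicator (?A n (z - e1)) h + ennreal (1 - w (z - e2)) * indicator (?A n (z - e2)) h \<partial>?C (Suc n) ?u)"
  proof (rule nn_integral_cong)
    fix h assume "h \<in> space (?C (Suc n) ?u)"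
    then have h: "h \<in> space (PiM {0..<Suc n} ?M)" using walk.space_C[OF u, of w x "Suc n"] by simp
    have "emeasure (walk.eP w x (Suc n) h) (?A (Suc n) z) =
        emeasure (walk_kernel w x (Suc n) h) ((\<lambda>y. fun_upd h (Suc n) y) -` ?A (Suc n) z \<inter> UNIV)"
      using walk.emeasure_eP[OF h position_set_measurable[of "Suc n" z], of w x] by simp
    also have "(\<lambda>y. fun_upd h (Suc n) y) -` ?A (Suc n) z \<inter> UNIV = {z}"
      using h by (auto simp: space_PiM PiE_def extensional_def)
    also have "emeasure (walk_kernel w x (Suc n) h) {z} = ennreal (pmf (step w (h n)) z)"
      by (simp add: walk_kernel_def emeasure_pmf_single)
    also have "\<dots> = ennreal (w (z - e1)) * indicator (?A n (z - e1)) h + ennreal (1 - w (z - e2)) * indicator (?A n (z - e2)) h"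
    proof -
      have i: "indicator (?A n y) h = ennreal (of_bool (h n = y))" for y using h by (simp add: indicator_def)
      have "pmf (step w (h n)) z = w (z - e1) * of_bool (h n = z - e1) + (1 - w (z - e2)) * of_bool (h n = z - e2)"
        using pmf_step_eq[of w "h n" z] w[of "h n"] by (auto simp: algebra_simps of_bool_def)
      then show ?thesis unfolding i using w[of "z - e1"] w[of "z - e2"] by (simp add: ennreal_mult)
    qed
    finally show "emeasure (walk.eP w x (Suc n) h) (?A (Suc n) z) =
      ennreal (w (z - e1)) * indicator (?A n (z - e1)) h + ennreal (1 - w (z - e2)) * indicator (?A n (z - e2)) h" .
  qed
  also have "\<dots> = ennreal (w (z - e1)) * emeasure (?C (Suc n) ?u) (?A n (z - e1)) + ennreal (1 - w (z - e2)) * emeasure (?C (Suc n) ?u) (?A n (z - e2))"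
  proof -
    have "(\<integral>\<^sup>+h. a * indicator A h + b * indicator B h \<partial>Q) = a * emeasure Q A + b * emeasure Q B"
      if "A \<in> sets Q" "B \<in> sets Q" for Q :: "(nat \<Rightarrow> site) measure" and A B a b
      using that by (subst nn_integral_add) (auto simp: nn_integral_cmult_indicator)
    then show ?thesis
      using position_set_measurable[of n] by (simp only: walk.sets_C[OF u, of w x "Suc n", simplified add_0])
  qed
  finally show ?thesis by (simp only: quenched_law_position)
qed

lemma quenched_law_start_eq: "emeasure (quenched_law w x) {X. X 0 = z} = (if z = x then 1 else 0)"
proof -
  interpret prob_space "quenched_law w x" by (rule prob_space_quenched_law)
  have ms: "{X. X 0 = z} \<in> sets (quenched_law w x)" for z :: site
  proof -
    have "(\<lambda>X. X 0) \<in> measurable (PiM UNIV (\<lambda>_::nat. count_space (UNIV :: site set))) (count_space UNIV)"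
      by (rule measurable_component_singleton) simp
    from measurable_sets[OF this, of "{z}"] show ?thesis by (simp add: vimage_def space_PiM)
  qed
  show ?thesis
  proof (cases "z = x")
    case True
    then show ?thesis using quenched_law_start[of w x] by (simp add: emeasure_eq_measure)
  next
    case False
    have "prob {X. X 0 = z} + prob {X. X 0 = x} = prob ({X. X 0 = z} \<union> {X. X 0 = x})"
      using False by (intro finite_measure_Union[symmetric] ms) auto
    also have "\<dots> \<le> 1" by simp
    finally have "prob {X. X 0 = z} = 0" using quenched_law_start[of w x] measure_nonneg[of "quenched_law w x" "{X. X 0 = z}"] by linarith
    then show ?thesis using False by (simp add: emeasure_eq_measure)
  qed
qed

lemma quenched_law_outside_quadrant:
  assumes w: "\<And>y. 0 \<le> w y \<and> w y \<le> 1" and "fst z < 0 \<or> snd z < 0"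
  shows "emeasure (quenched_law w 0) {X. X n = z} = 0"
  using assms(2)
proof (induction n arbitrary: z)
  case 0
  then show ?case by (auto simp: quenched_law_start_eq)
next
  case (Suc n)
  have "emeasure (quenched_law w 0) {X. X n = z - e1} = 0" "emeasure (quenched_law w 0) {X. X n = z - e2} = 0"
    using Suc.prems by (intro Suc.IH; auto simp: e1_def e2_def)+
  then show ?case by (simp add: quenched_law_position_Suc[of w, OF w])
qed

text \<open>Induction on the time c + r. Predecessors outside the quadrant have probability 0, in
  agreement with the boundary clauses of \<open>reach\<close>.\<close>

lemma quenched_law_eq_reach:
  assumes w: "\<And>y. 0 \<le> w y \<and> w y \<le> 1"
  shows "measure (quenched_law w 0) {X. X (c + r) = (int c, int r)} = reach (\<lambda>k. w (int (fst k), int (snd k))) c r"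
proof -
  let ?w = "\<lambda>k. w (int (fst k), int (snd k))"
  have nonneg: "reach v c r \<ge> 0" if "\<forall>k. 0 \<le> v k \<and> v k \<le> 1" for v c r
    using that by (induction v c r rule: reach.induct) auto
  have rn: "reach ?w c r \<ge> 0" for c r by (rule nonneg) (use w in auto)
  have "emeasure (quenched_law w 0) {X. X (c + r) = (int c, int r)} = ennreal (reach ?w c r)" for c r
  proof (induction "c + r" arbitrary: c r)
    case 0
    then show ?case by (simp add: quenched_law_start_eq zero_prod_def)
  next
    case (Suc n)
    have "emeasure (quenched_law w 0) {X. X (Suc n) = (int c, int r)} =
      ennreal (w (int c - 1, int r)) * emeasure (quenched_law w 0) {X. X n = (int c - 1, int r)} +
      ennreal (1 - w (int c, int r - 1)) * emeasure (quenched_law w 0) {X. X n = (int c, int r - 1)}"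
      by (subst quenched_law_position_Suc[of w, OF w]) (simp add: e1_def e2_def)
    moreover have "ennreal (w (int c - 1, int r)) * emeasure (quenched_law w 0) {X. X n = (int c - 1, int r)} =
      (case c of 0 \<Rightarrow> 0 | Suc b \<Rightarrow> ennreal (?w (b, r) * reach ?w b r))"
      using Suc.hyps(1)[of "c - 1" r] Suc.hyps(2) quenched_law_outside_quadrant[of w "(int c - 1, int r)" n, OF w] w rn
      by (cases c) (auto simp: ennreal_mult)
    moreover have "ennreal (1 - w (int c, int r - 1)) * emeasure (quenched_law w 0) {X. X n = (int c, int r - 1)} =
      (case r of 0 \<Rightarrow> 0 | Suc b \<Rightarrow> ennreal ((1 - ?w (c, b)) * reach ?w c b))"
      using Suc.hyps(1)[of c "r - 1"] Suc.hyps(2) quenched_law_outside_quadrant[of w "(int c, int r - 1)" n, OF w] w rn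
      by (cases r) (auto simp: ennreal_mult)
    ultimately show ?case
      using Suc.hyps(2) w rn by (cases c; cases r) (auto simp flip: ennreal_plus)
  qed
  then show ?thesis using rn by (simp add: measure_def)
qed

text \<open>Reflection in the diagonal exchanges the two kinds of steps, hence the weights w and 1 -
  w.\<close>

lemma reach_transpose:
  "reach w c r = reach (\<lambda>k. 1 - w (snd k, fst k)) r c"
  by (induction w c r rule: reach.induct) (simp_all add: add.commute)

text \<open>Among sites with coordinate sum N the Euclidean distance is sqrt 2 times the error in
  the first coordinate, so the minimiser is at least as good as the site whose first coordinate is N
  t rounded down.\<close>

lemma nearest_site_bounds:
  assumes z: "nearest_site N (t, 1 - t) z" and t: "0 \<le> t" "t \<le> 1"
  shows "\<bar>real_of_int (fst z) - real N * t\<bar> < 1" "fst z + snd z = int N" "fst z \<ge> 0" "snd z \<ge> 0"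
proof -
  define k where "k = \<lfloor>real N * t\<rfloor>"
  have d: "dist (real_of_int (fst y), real_of_int (snd y)) (real N *\<^sub>R (t, 1 - t)) = sqrt 2 * \<bar>real_of_int (fst y) - real N * t\<bar>"
    if "fst y + snd y = int N" for y
  proof -
    have "real_of_int (snd y) = real N - real_of_int (fst y)" using that by (metis add_diff_cancel_left' of_int_diff of_int_of_nat_eq)
    then have "real_of_int (snd y) - real N * (1 - t) = - (real_of_int (fst y) - real N * t)"
      by (simp add: algebra_simps)
    then have "dist (real_of_int (fst y), real_of_int (snd y)) (real N *\<^sub>R (t, 1 - t)) =
      sqrt ((real_of_int (fst y) - real N * t)\<^sup>2 + (real_of_int (fst y) - real N * t)\<^sup>2)"
      unfolding dist_prod_def dist_real_def by (simp only: scaleR_Pair fst_conv snd_conv real_scaleR_def power2_abs power2_minus)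
    also have "\<dots> = sqrt (2 * (real_of_int (fst y) - real N * t)\<^sup>2)" by simp
    finally show ?thesis by (simp only: real_sqrt_mult real_sqrt_abs)
  qed
  show sum: "fst z + snd z = int N" using z by (simp add: nearest_site_def is_arg_min_def)
  have "\<not> dist (real_of_int (fst (k, int N - k)), real_of_int (snd (k, int N - k))) (real N *\<^sub>R (t, 1 - t))
     < dist (real_of_int (fst z), real_of_int (snd z)) (real N *\<^sub>R (t, 1 - t))"
  proof -
    have "\<forall>y. fst y + snd y = int N \<longrightarrow> \<not> dist (real_of_int (fst y), real_of_int (snd y)) (real N *\<^sub>R (t, 1 - t))
       < dist (real_of_int (fst z), real_of_int (snd z)) (real N *\<^sub>R (t, 1 - t))"
      using z unfolding nearest_site_def is_arg_min_def by blast
    from this[rule_format, of "(k, int N - k)"] show ?thesis by simp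
  qed
  then have "\<bar>real_of_int (fst z) - real N * t\<bar> \<le> \<bar>real_of_int k - real N * t\<bar>"
    using d[of z] d[of "(k, int N - k)"] sum by (simp add: not_less)
  also have "\<dots> < 1" unfolding k_def by linarith
  finally show *: "\<bar>real_of_int (fst z) - real N * t\<bar> < 1" .
  have "0 \<le> real N * t" "real N * t \<le> real N" using t by (auto simp: mult_left_le)
  then have "real_of_int (fst z) > -1" "real_of_int (fst z) < real N + 1" using * by linarith+
  then show "fst z \<ge> 0" "snd z \<ge> 0" using sum by linarith+
qed

section \<open>Identification of the rate function\<close>

lemma (in prob_space) prob_tendsto_1_of_AE_eventually:
  assumes A[measurable]: "\<And>N. A N \<in> sets M" and ev: "AE s in M. \<forall>\<^sub>F N in sequentially. s \<in> A N"
  shows "(\<lambda>N. prob (A N)) \<longlonglongrightarrow> 1"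
proof -
  have "(\<lambda>N. \<integral>s. indicator (A N) s \<partial>M) \<longlonglongrightarrow> (\<integral>s. 1 \<partial>M :: real)"
  proof (rule integral_dominated_convergence[where w = "\<lambda>_. 1"])
    show "AE s in M. (\<lambda>N. indicator (A N) s :: real) \<longlonglongrightarrow> 1"
      using ev by eventually_elim (rule tendsto_eventually, auto elim: eventually_mono)
    show "AE s in M. norm (indicator (A N) s :: real) \<le> 1" for N by (auto simp: indicator_def)
  qed auto
  then show ?thesis by (simp add: prob_space)
qed

context prob_space
begin

text \<open>If L exceeded t, the event would almost surely hold for all large N, and by dominated
  convergence its probability would tend to 1.\<close>

lemma exponential_rate_le:
  fixes R :: "nat \<Rightarrow> 'a \<Rightarrow> real"
  assumes R[measurable]: "\<And>N. R N \<in> borel_measurable M" and pos: "AE s in M. \<forall>N. R N s > 0"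
    and lim: "AE s in M. (\<lambda>N. - (ln (R N s) / real N)) \<longlonglongrightarrow> L"
    and small: "(\<lambda>N. prob {s \<in> space M. R N s \<le> exp (- real N * t)}) \<longlonglongrightarrow> 0"
  shows "L \<le> t"
proof (rule ccontr)
  assume "\<not> L \<le> t"
  have "(\<lambda>N. prob {s \<in> space M. R N s \<le> exp (- real N * t)}) \<longlonglongrightarrow> 1"
  proof (rule prob_tendsto_1_of_AE_eventually)
    show "AE s in M. \<forall>\<^sub>F N in sequentially. s \<in> {s \<in> space M. R N s \<le> exp (- real N * t)}"
      using lim pos AE_space
    proof eventually_elim
      case (elim s)
      have "\<forall>\<^sub>F N in sequentially. t < - (ln (R N s) / real N)"
        using order_tendstoD(1)[OF elim(1), of t] \<open>\<not> L \<le> t\<close> by simp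
      then show ?case using eventually_gt_at_top[of 0]
      proof eventually_elim
        case N: (elim N)
        then have "ln (R N s) \<le> - real N * t" by (simp add: field_simps)
        then have "exp (ln (R N s)) \<le> exp (- real N * t)" by simp
        then show ?case using elim by simp
      qed
    qed
  qed measurable
  with small show False using LIMSEQ_unique by fastforce
qed

lemma exponential_rate_ge:
  fixes R :: "nat \<Rightarrow> 'a \<Rightarrow> real"
  assumes R[measurable]: "\<And>N. R N \<in> borel_measurable M" and pos: "AE s in M. \<forall>N. R N s > 0"
    and lim: "AE s in M. (\<lambda>N. - (ln (R N s) / real N)) \<longlonglongrightarrow> L"
    and small: "(\<lambda>N. prob {s \<in> space M. exp (- real N * t) \<le> R N s}) \<longlonglongrightarrow> 0"
  shows "t \<le> L"
proof (rule ccontr)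
  assume "\<not> t \<le> L"
  have "(\<lambda>N. prob {s \<in> space M. exp (- real N * t) \<le> R N s}) \<longlonglongrightarrow> 1"
  proof (rule prob_tendsto_1_of_AE_eventually)
    show "AE s in M. \<forall>\<^sub>F N in sequentially. s \<in> {s \<in> space M. exp (- real N * t) \<le> R N s}"
      using lim pos AE_space
    proof eventually_elim
      case (elim s)
      have "\<forall>\<^sub>F N in sequentially. - (ln (R N s) / real N) < t"
        using order_tendstoD(2)[OF elim(1), of t] \<open>\<not> t \<le> L\<close> by simp
      then show ?case using eventually_gt_at_top[of 0]
      proof eventually_elim
        case N: (elim N)
        then have "- real N * t \<le> ln (R N s)" by (simp add: field_simps)
        then have "exp (- real N * t) \<le> exp (ln (R N s))" by simp
        then show ?case using elim by simp
      qed
    qed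
  qed measurable
  with small show False using LIMSEQ_unique by fastforce
qed

end

text \<open>The critical point equation is homogeneous in (a, b); the factor c allows the first
  component to be prescribed.\<close>

lemma characteristic_right_ratio:
  assumes "\<alpha> > 0" "\<beta> > 0" "l > 0"
  shows "characteristic \<alpha> \<beta> (c * right_ratio \<alpha> \<beta> l) (c * (1 - right_ratio \<alpha> \<beta> l)) l"
  using lin_rate_derivative_eq[OF assms, of "right_ratio \<alpha> \<beta> l"]
  by (simp add: characteristic_def[OF assms(1,2)] mult.assoc)

context
  fixes \<alpha> \<beta> :: real and M :: "'s measure" and \<omega> :: "site \<Rightarrow> 's \<Rightarrow> real"
    and m n :: "nat \<Rightarrow> nat" and \<xi> L :: real
  assumes pos: "\<alpha> > 0" "\<beta> > 0" and env: "beta_environment \<alpha> \<beta> M \<omega>"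
    and sum: "\<And>N. m N + n N = N" and near: "\<And>N. \<bar>real (m N) - real N * \<xi>\<bar> < 1"
    and lim: "AE s in M. (\<lambda>N. - (ln (reach (quadrant \<omega> s) (m N) (n N)) / real N)) \<longlonglongrightarrow> L"
begin

lemma m_ratio: "(\<lambda>N. real (m N) / real N) \<longlonglongrightarrow> \<xi>"
proof -
  have "(\<lambda>N. real (m N) / real N - \<xi>) \<longlonglongrightarrow> 0"
  proof (rule Lim_null_comparison)
    show "\<forall>\<^sub>F N in sequentially. norm (real (m N) / real N - \<xi>) \<le> 1 / real N"
      using eventually_gt_at_top[of 0]
    proof eventually_elim
      case (elim N)
      have "real (m N) / real N - \<xi> = (real (m N) - real N * \<xi>) / real N"
        using elim by (simp add: field_simps)
      then show ?case using near[of N] elim by (simp add: divide_right_mono)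
    qed
  qed (rule lim_1_over_n)
  then show ?thesis by (simp add: LIM_zero_iff)
qed

lemma n_ratio: "(\<lambda>N. real (n N) / real N) \<longlonglongrightarrow> 1 - \<xi>"
proof (rule Lim_transform_eventually)
  show "(\<lambda>N. 1 - real (m N) / real N) \<longlonglongrightarrow> 1 - \<xi>" by (intro tendsto_intros m_ratio)
  show "\<forall>\<^sub>F N in sequentially. 1 - real (m N) / real N = real (n N) / real N"
    using eventually_gt_at_top[of 0]
  proof eventually_elim
    case (elim N)
    have "real N = real (m N) + real (n N)" using sum[of N] by (metis of_nat_add)
    then show ?case using elim by (simp add: field_simps)
  qed
qed

lemma reach_AE_pos: "AE s in M. \<forall>N. reach (quadrant \<omega> s) (m N) (n N) > 0"
  using AE_quadrant[OF pos env] by eventually_elim (auto intro: reach_pos')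

lemma rate_ge_lin_rate:
  assumes "l > 0"
  shows "lin_rate \<alpha> \<beta> \<xi> (1 - \<xi>) l \<le> L"
proof (rule dense_le)
  interpret prob_space M by (rule prob_space_env[OF pos env])
  fix t assume "t < lin_rate \<alpha> \<beta> \<xi> (1 - \<xi>) l"
  from reach_upper_tail[OF pos env assms m_ratio n_ratio this] show "t \<le> L"
    by (intro exponential_rate_ge[OF _ reach_AE_pos lim] reach_quadrant_measurable[OF pos env])
qed

text \<open>The linear rates, all lower bounds for L, tend to 0 as l \<rightarrow>
  \<infinity>.\<close>

lemma rate_nonneg: "0 \<le> L"
  by (rule tendsto_upperbound[OF lin_rate_tendsto_at_top[OF pos]])
    (use rate_ge_lin_rate in \<open>auto intro: eventually_mono[OF eventually_gt_at_top[of 0]]\<close>)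

lemma rate_eq_right_rate:
  assumes "\<alpha> / (\<alpha> + \<beta>) < \<xi>" "\<xi> < 1"
  shows "L = right_rate \<alpha> \<beta> \<xi>"
proof -
  interpret prob_space M by (rule prob_space_env[OF pos env])
  obtain l where l: "l > 0" "right_ratio \<alpha> \<beta> l = \<xi>" using right_ratio_surj[OF pos assms] .
  have "0 < \<alpha> / (\<alpha> + \<beta>)" using pos by simp
  then have \<xi>: "\<xi> > 0" using assms by linarith
  have "L \<le> lin_rate \<alpha> \<beta> \<xi> (1 - \<xi>) l"
  proof (rule dense_ge)
    fix t assume t: "lin_rate \<alpha> \<beta> \<xi> (1 - \<xi>) l < t"
    have "characteristic \<alpha> \<beta> \<xi> (1 - \<xi>) l" using characteristic_right_ratio[OF pos l(1), of 1] l by simp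
    from reach_lower_tail[OF pos env l(1) this \<xi> _ m_ratio n_ratio t] assms show "L \<le> t"
      by (intro exponential_rate_le[OF _ reach_AE_pos lim] reach_quadrant_measurable[OF pos env]) auto
  qed
  with rate_ge_lin_rate[OF l(1)] right_rate_eq_lin_rate[OF pos l] show ?thesis by simp
qed

lemma rate_eq_right_rate_e1:
  assumes "\<xi> = 1"
  shows "L = right_rate \<alpha> \<beta> \<xi>"
proof -
  interpret prob_space M by (rule prob_space_env[OF pos env])
  \<comment> \<open>At e1 an error below 1 leaves only the site (N, 0), so the walk stays on the
    axis.\<close>
  have mN: "m N = N" "n N = 0" for N
  proof -
    have "real N < real (m N) + 1" using near[of N] by (simp add: assms abs_if split: if_splits)
    then have "N < m N + 1" by linarith
    then show "m N = N" "n N = 0" using sum[of N] by auto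
  qed
  \<comment> \<open>The lower bound is the limit l \<rightarrow> 0 of the linear rates.\<close>
  have "rate_h \<alpha> \<beta> 0 \<le> L"
  proof (rule tendsto_upperbound[OF rate_h_tendsto_at_0[OF pos]])
    show "\<forall>\<^sub>F l in at_right 0. rate_h \<alpha> \<beta> l \<le> L"
      unfolding eventually_at_right_field using rate_ge_lin_rate assms
      by (intro exI[of _ 1]) (auto simp: lin_rate_def)
  qed simp
  moreover have "L \<le> rate_h \<alpha> \<beta> 0"
  proof (rule dense_ge)
    fix t assume "rate_h \<alpha> \<beta> 0 < t"
    from reach_bottom_lower_tail[OF pos env this] show "L \<le> t"
      by (intro exponential_rate_le[OF _ reach_AE_pos lim] reach_quadrant_measurable[OF pos env]) (simp add: mN)
  qed
  ultimately show ?thesis using assms by (simp add: right_rate_e1[OF pos])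
qed

text \<open>
  The direction \<open>\<xi>\<^sup>*\<close> is not characteristic for any finite parameter: it is reached from the
  characteristic direction of a large \<open>l\<close> by a short vertical path.
\<close>

lemma rate_eq_0:
  assumes "\<xi> = \<alpha> / (\<alpha> + \<beta>)"
  shows "L = 0"
proof -
  interpret prob_space M by (rule prob_space_env[OF pos env])
  \<comment> \<open>The critical direction of l, rescaled to first component \<xi>. Its second
    component falls short of 1 - \<xi>, and the vertical path makes up the difference.\<close>
  define b where "b l = \<xi> * (1 - right_ratio \<alpha> \<beta> l) / right_ratio \<alpha> \<beta> l" for l
  \<comment> \<open>The factor 2 leaves room for the strict inequality \<open>b' - b < e\<close> in
    \<open>reach_lower_tail_vertical\<close>.\<close>
  define U where "U l = \<xi> * rate_h \<alpha> \<beta> l + \<bar>path_cost \<alpha> \<beta>\<bar> * (2 * (1 - \<xi> - b l))" for l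
  have \<xi>: "0 < \<xi>" "\<xi> < 1" using pos assms by auto
  have "(b \<longlongrightarrow> \<xi> * (1 - \<xi>) / \<xi>) at_top"
    unfolding b_def[abs_def]
    using right_ratio_tendsto_at_top[OF pos] \<xi> unfolding assms[symmetric] by (intro tendsto_intros) auto
  then have blim: "(b \<longlongrightarrow> 1 - \<xi>) at_top" using \<xi> by simp
  have "(U \<longlongrightarrow> \<xi> * 0 + \<bar>path_cost \<alpha> \<beta>\<bar> * (2 * (1 - \<xi> - (1 - \<xi>)))) at_top"
    unfolding U_def[abs_def] by (intro tendsto_intros rate_h_tendsto_at_top[OF pos] blim)
  then have Ulim: "(U \<longlongrightarrow> 0) at_top" by simp
  have "L \<le> 0"
  proof (rule tendsto_lowerbound[OF Ulim])
    show "\<forall>\<^sub>F l in at_top. L \<le> U l"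
      using eventually_gt_at_top[of 0]
    proof eventually_elim
      case (elim l)
      let ?r = "right_ratio \<alpha> \<beta> l"
      have r: "\<xi> < ?r" "?r < 1" using right_ratio_gt[OF pos elim] right_ratio_less_1[OF pos elim] assms by auto
      have char: "characteristic \<alpha> \<beta> \<xi> (b l) l"
        using characteristic_right_ratio[OF pos elim, of "\<xi> / ?r"] r \<xi> by (simp add: b_def)
      have b: "b l > 0" "b l < 1 - \<xi>"
        using r \<xi> by (simp_all add: b_def field_simps)
      have "lin_rate \<alpha> \<beta> \<xi> (b l) l + path_cost \<alpha> \<beta> * (2 * (1 - \<xi> - b l)) \<le> U l"
      proof -
        have "rate_v \<alpha> l \<le> 0" using Digamma_diff_bounds(1)[of l \<alpha>] pos elim by (simp add: rate_v_def)
        then have "b l * rate_v \<alpha> l \<le> 0" using b by (simp add: mult_nonneg_nonpos)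
        moreover have "path_cost \<alpha> \<beta> * (2 * (1 - \<xi> - b l)) \<le> \<bar>path_cost \<alpha> \<beta>\<bar> * (2 * (1 - \<xi> - b l))"
          using b by (intro mult_right_mono) auto
        ultimately show ?thesis by (simp add: lin_rate_def U_def)
      qed
      moreover have "L \<le> lin_rate \<alpha> \<beta> \<xi> (b l) l + path_cost \<alpha> \<beta> * (2 * (1 - \<xi> - b l))"
      proof (rule dense_ge)
        fix t assume t: "lin_rate \<alpha> \<beta> \<xi> (b l) l + path_cost \<alpha> \<beta> * (2 * (1 - \<xi> - b l)) < t"
        have "(\<lambda>N. prob {x \<in> space M. reach (quadrant \<omega> x) (m N) (n N) \<le> exp (- real N * t)}) \<longlonglongrightarrow> 0"
          by (rule reach_lower_tail_vertical[OF pos env elim char \<xi>(1) b m_ratio n_ratio _ t]) (use b in simp)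
        then show "L \<le> t"
          by (intro exponential_rate_le[OF _ reach_AE_pos lim] reach_quadrant_measurable[OF pos env])
      qed
      ultimately show ?case by simp
    qed
  qed simp
  with rate_nonneg show ?thesis by simp
qed

end

section \<open>Exchange of the coordinates\<close>

definition transpose_env :: "(site \<Rightarrow> 's \<Rightarrow> real) \<Rightarrow> site \<Rightarrow> 's \<Rightarrow> real" where
  "transpose_env \<omega> z s = 1 - \<omega> (snd z, fst z) s"

text \<open>If \<omega> has law Beta(\<alpha>, \<beta>), then 1 - \<omega> has law Beta(\<beta>,
  \<alpha>); transposing the sites is an injective reindexing of an independent family.\<close>

lemma beta_environment_transpose:
  assumes "\<alpha> > 0" "\<beta> > 0" "beta_environment \<alpha> \<beta> M \<omega>"
  shows "beta_environment \<beta> \<alpha> M (transpose_env \<omega>)"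
proof -
  interpret prob_space M by (rule prob_space_env[OF assms])
  note [measurable] = env_measurable[OF assms]
  have meas [measurable]: "transpose_env \<omega> z \<in> borel_measurable M" for z
    unfolding transpose_env_def by measurable
  have dist: "distributed M lborel (transpose_env \<omega> z) (\<lambda>t. ennreal (beta_density \<beta> \<alpha> t))" for z
  proof -
    have "distributed M lborel (\<lambda>s. 1 + (- 1) * \<omega> (snd z, fst z) s)
      (\<lambda>t. ennreal (beta_density \<alpha> \<beta> ((t - 1) / (- 1))) / ennreal \<bar>- 1\<bar>)"
      by (rule distributed_affine[OF distributed_env[OF assms]]) simp
    moreover have "ennreal (beta_density \<alpha> \<beta> ((t - 1) / (- 1))) / ennreal \<bar>- 1\<bar> = ennreal (beta_density \<beta> \<alpha> t)" for t
      by (auto simp: beta_density_def indicator_def Beta_commute[of \<alpha>] mult.commute divide_ennreal_def)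
    ultimately show ?thesis by (simp add: transpose_env_def[abs_def])
  qed
  have law: "distr M borel (transpose_env \<omega> z) = beta_measure \<beta> \<alpha>" for z
  proof -
    have "distr M borel (transpose_env \<omega> z) = distr M lborel (transpose_env \<omega> z)" by (rule distr_cong) auto
    then show ?thesis by (simp add: beta_measure_def distributed_distr_eq_density[OF dist])
  qed
  have "indep_vars (\<lambda>_. borel) \<omega> UNIV" using assms(3) by (simp add: beta_environment_def)
  then have "indep_vars (\<lambda>_. borel) (\<lambda>z s. 1 - \<omega> z s) UNIV"
    by (rule indep_vars_compose2[where Y = "\<lambda>_ t. 1 - t"]) simp
  then have *: "distr M (PiM UNIV (\<lambda>_. borel)) (\<lambda>s z. 1 - \<omega> z s) = PiM UNIV (\<lambda>z. distr M borel (\<lambda>s. 1 - \<omega> z s))"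
    by (subst (asm) indep_vars_iff_distr_eq_PiM) (auto simp: restrict_UNIV)
  have law': "distr M borel (\<lambda>s. 1 - \<omega> z s) = beta_measure \<beta> \<alpha>" for z
    using law[of "(snd z, fst z)"] by (simp add: transpose_env_def[abs_def])
  let ?j = "\<lambda>z::site. (snd z, fst z)"
  have "PiM UNIV (\<lambda>_::site. beta_measure \<beta> \<alpha>) =
     distr (PiM UNIV (\<lambda>_::site. beta_measure \<beta> \<alpha>)) (PiM UNIV (\<lambda>_. beta_measure \<beta> \<alpha>)) (\<lambda>x. \<lambda>z\<in>UNIV. x (?j z))"
    by (rule distr_PiM_reindex[symmetric]) (auto intro!: prob_space_beta_measure assms inj_onI simp: prod_eq_iff)
  also have "\<dots> = distr (PiM UNIV (\<lambda>_::site. beta_measure \<beta> \<alpha>)) (PiM UNIV (\<lambda>_. borel)) (\<lambda>x z. x (?j z))"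
    by (intro distr_cong sets_PiM_cong) (auto simp: restrict_UNIV)
  also have "\<dots> = distr M (PiM UNIV (\<lambda>_. borel)) ((\<lambda>x z. x (?j z)) \<circ> (\<lambda>s z. 1 - \<omega> z s))"
    unfolding *[unfolded law', symmetric]
    by (rule distr_distr) (auto intro!: measurable_PiM_single' simp: space_PiM)
  also have "(\<lambda>x z. x (?j z)) \<circ> (\<lambda>s z. 1 - \<omega> z s) = (\<lambda>s z. transpose_env \<omega> z s)"
    by (auto simp: fun_eq_iff transpose_env_def)
  finally have "indep_vars (\<lambda>_. borel) (transpose_env \<omega>) UNIV"
    by (subst indep_vars_iff_distr_eq_PiM) (auto simp: restrict_UNIV law)
  then show ?thesis using dist prob_space_axioms by (simp add: beta_environment_def)
qed

lemma reach_transpose_env: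
  "reach (quadrant (transpose_env \<omega>) s) r c = reach (quadrant \<omega> s) c r"
  unfolding reach_transpose[of "quadrant \<omega> s" c r]
  by (rule arg_cong[where f = "\<lambda>w. reach w r c"]) (simp add: fun_eq_iff quadrant_def transpose_env_def)

theorem theorem2p7:
  fixes \<alpha> \<beta> :: real
    and M :: "'s measure"
    and \<omega> :: "site \<Rightarrow> 's \<Rightarrow> real"
    and br :: "nat \<Rightarrow> real \<times> real \<Rightarrow> site"
    and Iq :: "real \<times> real \<Rightarrow> real"
  assumes "\<alpha> > 0" "\<beta> > 0"
    and "beta_environment \<alpha> \<beta> M \<omega>"
    and "\<And>N \<xi>. \<xi> \<in> dirs \<Longrightarrow> nearest_site N \<xi> (br N \<xi>)"
    and "quenched_rate_function M \<omega> br Iq"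
  shows "Iq (xi_star \<alpha> \<beta>) = 0 \<and>
    (\<forall>\<xi>\<in>dirs.
       (fst \<xi> \<in> {fst (xi_star \<alpha> \<beta>)<..1} \<longrightarrow>
          Iq \<xi> = fst \<xi> * Digamma (\<alpha> + \<beta> + lambda_real \<alpha> \<beta> \<xi>)
                 + snd \<xi> * Digamma (lambda_real \<alpha> \<beta> \<xi>)
                 - Digamma (\<alpha> + lambda_real \<alpha> \<beta> \<xi>)) \<and>
       (fst \<xi> \<in> {0..<fst (xi_star \<alpha> \<beta>)} \<longrightarrow>
          Iq \<xi> = snd \<xi> * Digamma (\<alpha> + \<beta> + lambda_real \<alpha> \<beta> \<xi>)
                 + fst \<xi> * Digamma (lambda_real \<alpha> \<beta> \<xi>)
                 - Digamma (\<beta> + lambda_real \<alpha> \<beta> \<xi>))) \<and>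
    strictly_convex_on {0..1} (\<lambda>t. Iq (t, 1 - t)) \<and>
    (\<forall>\<xi>\<in>dirs - {xi_star \<alpha> \<beta>}. Iq \<xi> > averaged_rate \<alpha> \<beta> \<xi>)"
proof -
  note pos = assms(1,2) and env = assms(3)
  define F where "F t = Iq (t, 1 - t)" for t
  let ?x = "\<alpha> / (\<alpha> + \<beta>)"
  have dirs: "\<xi> \<in> dirs \<longleftrightarrow> (\<exists>t. 0 \<le> t \<and> t \<le> 1 \<and> \<xi> = (t, 1 - t))" for \<xi> by (auto simp: dirs_def)
  have star: "xi_star \<alpha> \<beta> = (?x, 1 - ?x)" using pos by (simp add: xi_star_def field_simps)
  have x01: "0 < ?x" "?x < 1" using pos by auto
  define m where "m t N = nat (fst (br N (t, 1 - t)))" for t N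
  define n where "n t N = nat (snd (br N (t, 1 - t)))" for t N
  have mn: "m t N + n t N = N" "\<bar>real (m t N) - real N * t\<bar> < 1" "\<bar>real (n t N) - real N * (1 - t)\<bar> < 1"
    "br N (t, 1 - t) = (int (m t N), int (n t N))" if "0 \<le> t" "t \<le> 1" for t N
  proof -
    have "nearest_site N (t, 1 - t) (br N (t, 1 - t))" using that by (intro assms(4)) (auto simp: dirs)
    note b = nearest_site_bounds[OF this that]
    show 1: "m t N + n t N = N" using b by (simp add: m_def n_def)
    show 2: "\<bar>real (m t N) - real N * t\<bar> < 1" using b by (simp add: m_def)
    have "real (n t N) = real N - real (m t N)" using 1 by (metis add_diff_cancel_left' of_nat_add)
    then show "\<bar>real (n t N) - real N * (1 - t)\<bar> < 1" using 2 by (simp add: algebra_simps abs_minus_commute)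
    show "br N (t, 1 - t) = (int (m t N), int (n t N))" using b by (simp add: m_def n_def prod_eq_iff)
  qed
  \<comment> \<open>The limit is transferred from the path measure to \<open>reach\<close> on the
    almost sure event that all weights lie in (0, 1).\<close>
  have lim: "AE s in M. (\<lambda>N. - (ln (reach (quadrant \<omega> s) (m t N) (n t N)) / real N)) \<longlonglongrightarrow> F t"
    if t: "0 \<le> t" "t \<le> 1" for t
  proof -
    have "AE s in M. (\<lambda>N. - (ln (measure (quenched_law (\<lambda>x. \<omega> x s) 0) {X. X N = br N (t, 1 - t)}) / real N)) \<longlonglongrightarrow> Iq (t, 1 - t)"
      using assms(5) t unfolding quenched_rate_function_def by (auto simp: dirs)
    with AE_env[OF pos env] show ?thesis
    proof eventually_elim
      case (elim s)
      have "measure (quenched_law (\<lambda>x. \<omega> x s) 0) {X. X N = br N (t, 1 - t)} = reach (quadrant \<omega> s) (m t N) (n t N)" for N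
        using quenched_law_eq_reach[of "\<lambda>x. \<omega> x s" "m t N" "n t N"] elim(1) mn(1,4)[OF t, of N]
        by (simp add: less_imp_le quadrant_def[abs_def])
      with elim(2) show ?case by (simp add: F_def)
    qed
  qed
  have F_star: "F ?x = 0"
    by (rule rate_eq_0[OF pos env mn(1) mn(2) lim refl]) (use x01 in auto)
  have F_right: "F t = right_rate \<alpha> \<beta> t" if t: "?x < t" "t \<le> 1" for t
  proof (cases "t = 1")
    case True
    show ?thesis by (rule rate_eq_right_rate_e1[OF pos env mn(1) mn(2) lim True]) (use True in auto)
  next
    case False
    show ?thesis by (rule rate_eq_right_rate[OF pos env mn(1) mn(2) lim t(1)]) (use False t x01 in auto)
  qed
  have F_left: "F t = right_rate \<beta> \<alpha> (1 - t)" if t: "0 \<le> t" "t < ?x" for t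
  proof -
    \<comment> \<open>A direction to the left of \<open>xi_star\<close> is the direction (1 - t, t)
      of the transposed environment, where it lies to the right.\<close>
    note env' = beta_environment_transpose[OF pos env]
    have t1: "t \<le> 1" using t x01 by simp
    have lim': "AE s in M. (\<lambda>N. - (ln (reach (quadrant (transpose_env \<omega>) s) (n t N) (m t N)) / real N)) \<longlonglongrightarrow> F t"
      using lim[OF t(1) t1] by (simp add: reach_transpose_env)
    have sum': "n t N + m t N = N" for N using mn(1)[OF t(1) t1, of N] by simp
    show ?thesis
    proof (cases "t = 0")
      case True
      then show ?thesis
        by (intro rate_eq_right_rate_e1[OF pos(2,1) env' sum' mn(3)[OF t(1) t1] lim']) simp
    next
      case False
      have "\<beta> / (\<beta> + \<alpha>) < 1 - t" using t pos by (simp add: field_simps)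
      then show ?thesis
        by (rule rate_eq_right_rate[OF pos(2,1) env' sum' mn(3)[OF t(1) t1] lim']) (use False t in simp)
    qed
  qed
  have formula_right: "Iq \<xi> = fst \<xi> * Digamma (\<alpha> + \<beta> + lambda_real \<alpha> \<beta> \<xi>)
        + snd \<xi> * Digamma (lambda_real \<alpha> \<beta> \<xi>) - Digamma (\<alpha> + lambda_real \<alpha> \<beta> \<xi>)"
    if "\<xi> \<in> dirs" "fst \<xi> \<in> {fst (xi_star \<alpha> \<beta>)<..1}" for \<xi>
    using that F_right by (auto simp: dirs star F_def right_rate_def Let_def)
  have formula_left: "Iq \<xi> = snd \<xi> * Digamma (\<alpha> + \<beta> + lambda_real \<alpha> \<beta> \<xi>)
        + fst \<xi> * Digamma (lambda_real \<alpha> \<beta> \<xi>) - Digamma (\<beta> + lambda_real \<alpha> \<beta> \<xi>)"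
    if \<xi>: "\<xi> \<in> dirs" "fst \<xi> \<in> {0..<fst (xi_star \<alpha> \<beta>)}" for \<xi>
  proof -
    obtain t where t: "\<xi> = (t, 1 - t)" "0 \<le> t" "t < ?x" using \<xi> by (auto simp: dirs star)
    have "lambda_real \<beta> \<alpha> (1 - t, t) = lambda_real \<alpha> \<beta> (t, 1 - t)"
      by (rule lambda_real_left[OF pos t(3), symmetric])
    then show ?thesis
      using F_left[OF t(2,3)] by (simp add: t(1) F_def right_rate_def Let_def add_ac)
  qed
  have convex: "strictly_convex_on {0..1} F"
    by (rule rate_function_strictly_convex[OF pos F_star F_right F_left])
  have larger: "Iq \<xi> > averaged_rate \<alpha> \<beta> \<xi>" if \<xi>: "\<xi> \<in> dirs - {xi_star \<alpha> \<beta>}" for \<xi>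
  proof -
    obtain t where t: "\<xi> = (t, 1 - t)" "0 \<le> t" "t \<le> 1" "t \<noteq> ?x" using \<xi> by (auto simp: dirs star)
    show ?thesis
    proof (cases "?x < t")
      case True
      then show ?thesis
        using F_right[OF True t(3)] averaged_less_right_rate[OF pos True t(3)] by (simp add: t(1) F_def)
    next
      case False
      then have l: "t < ?x" using t by simp
      then have "\<beta> / (\<beta> + \<alpha>) < 1 - t" using pos by (simp add: field_simps)
      then have "averaged_rate \<beta> \<alpha> (1 - t, 1 - (1 - t)) < right_rate \<beta> \<alpha> (1 - t)"
        using t by (intro averaged_less_right_rate pos) auto
      then show ?thesis
        using F_left[OF t(2) l] by (simp add: t(1) F_def averaged_rate_swap[of \<alpha>])
    qed
  qed
  show ?thesis
    using F_star formula_right formula_left convex larger by (auto simp: star F_def[abs_def])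
qed

end
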